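(* Let $\{z_t^{ag}\}=\{(x_t^{ag},y_t^{ag})\}$ be the iterates generated by the stochastic APD algorithm described in the context with $V_X(x,x_t)=\|x-x_t\|^2/2$ and $V_Y(y,y_t)=\|y-y_t\|^2/2$, under assumption A1 (bounded variance, see context). Assume that the parameters $\beta_t,\theta_t,\eta_t,\tau_t$ satisfy $\beta_1=1$ and, for all $t\ge1$ (the second condition for all $t\ge2$) and some $p,q\in(0,1)$, $$\beta_{t+1}-1=\beta_t\theta_{t+1},$$ $$\theta_t=\frac{\eta_{t-1}}{\eta_t}=\frac{\tau_{t-1}}{\tau_t},$$ $$\frac{q\alpha_X}{\eta_t}-\frac{L_G}{\beta_t}-\frac{L_K^2\tau_t}{p\alpha_Y}\ge0,$$ where $\alpha_X=\alpha_Y=1$. Let $(\hat x,\hat y)$ be a pair of solutions (saddle point) of the saddle point problem, and let $$D:=\sqrt{\|\hat x-x_1\|^2+\frac{\eta_1}{\tau_1}\|\hat y-y_1\|^2},\qquad C:=\sqrt{\sum_{i=1}^t\frac{\eta_i^2\sigma_x^2}{1-q}+\sum_{i=1}^t\frac{\eta_i\tau_i\sigma_y^2}{1-p}}.$$ Then for any $t\ge1$ there exists a (random) perturbation vector $v_{t+1}$ such that $$\mathbb E[\tilde g(z_{t+1}^{ag},v_{t+1})]\le\frac1{\beta_t\eta_t}\left(\frac{6-4p}{1-p}D^2+\frac{5-3p}{2-2p}C^2\right)$$ and moreover $$\mathbb E[\|v_{t+1}\|]\le\frac{2\|\hat x-x_1\|}{\beta_t\eta_t}+\frac{2\|\hat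 y-y_1\|}{\beta_t\tau_t}+\sqrt{2D^2+C^2}\left[\frac2{\beta_t\eta_t}+\frac1{\beta_t\tau_t}\sqrt{\frac{\tau_1}{\eta_1}}\left(\sqrt{\frac1{1-p}}+1\right)+\frac{2L_K}{\beta_t}\right].$$
   Context: Setting. $\mathcal X,\mathcal Y$ are finite-dimensional real vector spaces, each with an inner product $\langle\cdot,\cdot\rangle$ and, here (Euclidean setting), $\|\cdot\|$ the associated norm; $\|\cdot\|_*$ denotes the dual norm; $X\subseteq\mathcal X$, $Y\subseteq\mathcal Y$ are closed convex sets (possibly unbounded), $Z=X\times Y$, with $\langle(x,y),(x',y')\rangle=\langle x,x'\rangle+\langle y,y'\rangle$ and $\|(x,y)\|^2=\|x\|^2+\|y\|^2$. $G$ is a smooth convex function with $G(y)-G(x)-\langle\nabla G(x),y-x\rangle\le\frac{L_G}{2}\|y-x\|^2$ for all $x,y\in X$, for some $L_G\ge0$. $K:\mathcal X\to\mathcal Y$ is linear with transpose $K^T$ and operator norm $L_K=\|K\|$. $J:Y\to\mathbb R$ is proper, convex and lower semicontinuous. The saddle point problem is $\min_{x\in X}\max_{y\in Y}G(x)+\langle Kx,y\rangle-J(y)$, which is assumed to have a saddle point. Stochastic oracle. A stochastic oracle returns unbiased estimators $\hat{\mathcal G}(x)=\mathcal G(x,\xi)$, $\hat{\mathcal K}_x(x)=\mathcal K_x(x,\xi)$, $\hat{\mathcal K}_y(y)=\mathcal K_y(y,\xi)$, with i.i.d. random vectors $\xi$: $\mathbb E[\hat{\mathcal G}(x)]=\nabla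 G(x)$, $\mathbb E[\hat{\mathcal K}_x(x)]=Kx$, $\mathbb E[\hat{\mathcal K}_y(y)]=K^Ty$. The samples used for the three evaluations in each iteration are independent of each other and of all previous iterations. A1: for constants $\sigma_{x,G},\sigma_y,\sigma_{x,K}\ge0$ and all query points, $\mathbb E\|\hat{\mathcal G}(x)-\nabla G(x)\|_*^2\le\sigma_{x,G}^2$, $\mathbb E\|\hat{\mathcal K}_x(x)-Kx\|_*^2\le\sigma_y^2$, $\mathbb E\|\hat{\mathcal K}_y(y)-K^Ty\|_*^2\le\sigma_{x,K}^2$. Notation: $\sigma_x:=\sqrt{\sigma_{x,G}^2+\sigma_{x,K}^2}$. Stochastic APD algorithm. Choose $x_1\in X$, $y_1\in Y$; set $x_1^{ag}=x_1$, $y_1^{ag}=y_1$, $\bar x_1=x_1$. With positive stepsizes $\eta_t,\tau_t$, for $t=1,2,\dots$: $x_t^{md}=(1-\beta_t^{-1})x_t^{ag}+\beta_t^{-1}x_t$; $y_{t+1}=\operatorname{argmin}_{y\in Y}\langle-\hat{\mathcal K}_x(\bar x_t),y\rangle+J(y)+\frac1{\tau_t}V_Y(y,y_t)$; $x_{t+1}=\operatorname{argmin}_{x\in X}\langle\hat{\mathcal G}(x_t^{md}),x\rangle+\langle x,\hat{\mathcal K}_y(y_{t+1})\rangle+\frac1{\eta_t}V_X(x,x_t)$; $x_{t+1}^{ag}=(1-\beta_t^{-1})x_t^{ag}+\beta_t^{-1}x_{t+1}$; $y_{t+1}^{ag}=(1-\beta_t^{-1})y_t^{ag}+\beta_t^{-1}y_{t+1}$;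 $\bar x_{t+1}=\theta_{t+1}(x_{t+1}-x_t)+x_{t+1}$. In general $V_X,V_Y$ are Bregman divergences of functions with strong convexity parameters $\alpha_X,\alpha_Y$; for the Euclidean choice used here $\alpha_X=\alpha_Y=1$. Gap functions. For $\tilde z=(\tilde x,\tilde y)$, $z=(x,y)\in Z$: $Q(\tilde z,z)=[G(\tilde x)+\langle K\tilde x,y\rangle-J(y)]-[G(x)+\langle Kx,\tilde y\rangle-J(\tilde y)]$. A point $\hat z\in Z$ is a solution (saddle point) iff $Q(\hat z,z)\le0$ for all $z\in Z$. For $v\in\mathcal X\times\mathcal Y$, $\tilde g(\tilde z,v)=\max_{z\in Z}\{Q(\tilde z,z)-\langle v,\tilde z-z\rangle\}$ (understood as a supremum). *)

theory Defs
  imports "HOL-Probability.Probability"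
begin

(* The norm dual to the Euclidean norm: the operator norm of the functional <v, .>. *)
definition dual_norm :: "'a::euclidean_space \<Rightarrow> real" where
  "dual_norm v = onorm (\<lambda>u. v \<bullet> u)"

definition lsc_on :: "'a::topological_space set \<Rightarrow> ('a \<Rightarrow> real) \<Rightarrow> bool" where
  "lsc_on A f \<longleftrightarrow> (\<forall>x\<in>A. \<forall>c<f x. eventually (\<lambda>u. c < f u) (at x within A))"

definition eucl_div :: "'a::real_inner \<Rightarrow> 'a \<Rightarrow> real" where
  "eucl_div u w = (norm (u - w))\<^sup>2 / 2"

definition gap_Q :: "('a::euclidean_space \<Rightarrow> real) \<Rightarrow> ('a \<Rightarrow> 'b::euclidean_space) \<Rightarrow> ('b \<Rightarrow> real)
    \<Rightarrow> 'a \<times> 'b \<Rightarrow> 'a \<times> 'b \<Rightarrow> real" where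
  "gap_Q G K J z' z =
     (G (fst z') + K (fst z') \<bullet> snd z - J (snd z)) -
     (G (fst z) + K (fst z) \<bullet> snd z' - J (snd z'))"

definition saddle_point :: "'a::euclidean_space set \<Rightarrow> 'b::euclidean_space set \<Rightarrow> ('a \<Rightarrow> real)
    \<Rightarrow> ('a \<Rightarrow> 'b) \<Rightarrow> ('b \<Rightarrow> real) \<Rightarrow> 'a \<times> 'b \<Rightarrow> bool" where
  "saddle_point X Y G K J z' \<longleftrightarrow> z' \<in> X \<times> Y \<and> (\<forall>z\<in>X \<times> Y. gap_Q G K J z' z \<le> 0)"

(* Z may be unbounded, so the supremum may be infinite. *)
definition perturbed_gap :: "'a::euclidean_space set \<Rightarrow> 'b::euclidean_space set \<Rightarrow> ('a \<Rightarrow> real)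
    \<Rightarrow> ('a \<Rightarrow> 'b) \<Rightarrow> ('b \<Rightarrow> real) \<Rightarrow> 'a \<times> 'b \<Rightarrow> 'a \<times> 'b \<Rightarrow> ereal" where
  "perturbed_gap X Y G K J z' v =
     (SUP z\<in>X \<times> Y. ereal (gap_Q G K J z' z - v \<bullet> (z' - z)))"

(* An estimator F is a function of the query point and of one sample with distribution P.
   The joint measurability makes its value at a random query point a random vector. *)
definition unbiased_estimator :: "'s measure \<Rightarrow> 'a::euclidean_space set
    \<Rightarrow> ('a \<Rightarrow> 's \<Rightarrow> 'b::euclidean_space) \<Rightarrow> ('a \<Rightarrow> 'b) \<Rightarrow> bool" where
  "unbiased_estimator P A F m \<longleftrightarrow>
     (\<lambda>(u, s). F u s) \<in> borel_measurable (restrict_space borel A \<Otimes>\<^sub>M P) \<and>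
     (\<forall>u\<in>A. integrable P (F u) \<and> (\<integral>s. F u s \<partial>P) = m u)"

definition variance_bounded :: "'s measure \<Rightarrow> 'a::euclidean_space set
    \<Rightarrow> ('a \<Rightarrow> 's \<Rightarrow> 'b::euclidean_space) \<Rightarrow> ('a \<Rightarrow> 'b) \<Rightarrow> real \<Rightarrow> bool" where
  "variance_bounded P A F m \<sigma> \<longleftrightarrow>
     (\<forall>u\<in>A. integrable P (\<lambda>s. (dual_norm (F u s - m u))\<^sup>2) \<and>
             (\<integral>s. (dual_norm (F u s - m u))\<^sup>2 \<partial>P) \<le> \<sigma>\<^sup>2)"

(* The three oracle evaluations made in each iteration. *)
datatype evaluation = Eval_G | Eval_Kx | Eval_Ky

(* One realisation of the stochastic APD algorithm: gG t, gKx t, gKy t are the estimators with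
   the samples of iteration t plugged in. Iterations start at t = 1. *)
definition stochastic_apd :: "'a::euclidean_space set \<Rightarrow> 'b::euclidean_space set \<Rightarrow> ('b \<Rightarrow> real)
    \<Rightarrow> (nat \<Rightarrow> real) \<Rightarrow> (nat \<Rightarrow> real) \<Rightarrow> (nat \<Rightarrow> real) \<Rightarrow> (nat \<Rightarrow> real)
    \<Rightarrow> (nat \<Rightarrow> 'a \<Rightarrow> 'a) \<Rightarrow> (nat \<Rightarrow> 'a \<Rightarrow> 'b) \<Rightarrow> (nat \<Rightarrow> 'b \<Rightarrow> 'a)
    \<Rightarrow> 'a \<Rightarrow> 'b
    \<Rightarrow> (nat \<Rightarrow> 'a) \<Rightarrow> (nat \<Rightarrow> 'b) \<Rightarrow> (nat \<Rightarrow> 'a) \<Rightarrow> (nat \<Rightarrow> 'b) \<Rightarrow> (nat \<Rightarrow> 'a) \<Rightarrow> (nat \<Rightarrow> 'a)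
    \<Rightarrow> bool" where
  "stochastic_apd X Y J \<beta> \<theta> \<eta> \<tau> gG gKx gKy x1 y1 x y xag yag xmd xbar \<longleftrightarrow>
     x 1 = x1 \<and> y 1 = y1 \<and> xag 1 = x1 \<and> yag 1 = y1 \<and> xbar 1 = x1 \<and>
     (\<forall>t\<ge>1.
        xmd t = (1 - inverse (\<beta> t)) *\<^sub>R xag t + inverse (\<beta> t) *\<^sub>R x t \<and>
        is_arg_min (\<lambda>u. - gKx t (xbar t) \<bullet> u + J u + 1 / \<tau> t * eucl_div u (y t))
          (\<lambda>u. u \<in> Y) (y (t + 1)) \<and>
        is_arg_min (\<lambda>u. gG t (xmd t) \<bullet> u + u \<bullet> gKy t (y (t + 1)) + 1 / \<eta> t * eucl_div u (x t))
          (\<lambda>u. u \<in> X) (x (t + 1)) \<and>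
        xag (t + 1) = (1 - inverse (\<beta> t)) *\<^sub>R xag t + inverse (\<beta> t) *\<^sub>R x (t + 1) \<and>
        yag (t + 1) = (1 - inverse (\<beta> t)) *\<^sub>R yag t + inverse (\<beta> t) *\<^sub>R y (t + 1) \<and>
        xbar (t + 1) = \<theta> (t + 1) *\<^sub>R (x (t + 1) - x t) + x (t + 1))"

end

theory Submission
  imports Defs
begin

text \<open>
The proof is an energy estimate along a single trajectory, followed by taking expectations.

On a fixed trajectory the oracle answers are exact values plus errors \<open>dx i\<close> (in the primal
step) and \<open>dy i\<close> (in the dual step). Convexity and smoothness of \<open>G\<close> and the
three-point inequality of the two proximal steps bound
\<open>\<beta> i * Q (i + 1) - (\<beta> i - 1) * Q i\<close>, where \<open>Q i\<close> is the gap between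
the \<open>i\<close>-th aggregate and an arbitrary \<open>z\<close>, by differences of squared distances,
a bilinear term in \<open>K\<close> and the errors. After multiplication by \<open>\<eta> i\<close> the
estimate telescopes, because the stepsize rules say that
\<open>\<eta> (i + 1) * (\<beta> (i + 1) - 1) = \<eta> i * \<beta> i\<close>, that
\<open>\<eta> (i + 1) * \<theta> (i + 1) = \<eta> i\<close>, and that \<open>\<eta> i / \<tau> i\<close>
is a constant \<open>r\<close>; the last stepsize condition lets the negative squares of the increments
absorb the extrapolation error and the noise. This is \<open>telescoped_gap\<close>.

The inequality is used for two kinds of points. At a saddle point the gap is nonnegative, so the
telescoped inequality bounds the distance of the iterates to the saddle point by \<open>D\<^sup>2\<close>
plus noise (\<open>energy_bound\<close>). For general \<open>z\<close> the right-hand side is an affine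
function of \<open>z\<close>: in \<open>(norm (u - x1))\<^sup>2 - (norm (u - x (k + 1)))\<^sup>2\<close>
the squares of \<open>u\<close> cancel, and the errors are paired with \<open>x i - u\<close>. The
perturbation is, up to sign and weight, the linear part of this function, so that after its subtraction
only the value at the aggregate itself remains, which does not depend on \<open>z\<close>
(\<open>perturbed_gap_bound\<close>). Hence the supremum is finite even if the feasible sets are
unbounded, and the perturbation consists only of \<open>x1\<close>, \<open>y1\<close>, the last iterates
and the weighted sums of the errors.

It remains to take expectations. The iterates are measurable functions of the samples, since proximal
maps are nonexpansive. Every error therefore has mean zero against all square-integrable functions of the
earlier samples (\<open>oracle_error_mean_zero\<close>): the inner products with \<open>x i - xh\<close>
and \<open>y i - yh\<close> vanish in expectation, and the weighted error sums have the sum of the single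
variances as a bound. This gives the mean energy bound \<open>D\<^sup>2 + C\<^sup>2\<close> for iterates
and aggregates. Inserting it into the bound on the perturbed gap and into the triangle inequality for the
perturbation yields the two estimates. In the first one Young's inequality has to be used with the weight
\<open>(1 - p) * r\<close> on the dual side, so that the energy is reproduced exactly; this is what makes
the coefficient of \<open>C\<^sup>2\<close> come out as
\<open>3 / 2 + 1 / (1 - p) = (5 - 3 * p) / (2 - 2 * p)\<close>.
\<close>

section \<open>Proximal steps and convexity\<close>

lemma inner_young:
  fixes a b :: "'a::real_inner"
  assumes "c > 0"
  shows "a \<bullet> b \<le> c / 2 * (norm a)\<^sup>2 + 1 / (2 * c) * (norm b)\<^sup>2"
proof -
  have "0 \<le> (norm (c *\<^sub>R a - b))\<^sup>2"
    by simp
  also have "\<dots> = c\<^sup>2 * (norm a)\<^sup>2 - 2 * c * (a \<bullet> b) + (norm b)\<^sup>2"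
    by (simp only: power2_norm_eq_inner) (simp add: inner_diff_left inner_diff_right inner_commute power2_eq_square)
  finally have "2 * c * (a \<bullet> b) \<le> c\<^sup>2 * (norm a)\<^sup>2 + (norm b)\<^sup>2"
    by simp
  with assms show ?thesis
    by (simp add: field_simps power2_eq_square)
qed

lemma norm_sum_square_le:
  fixes a b :: "'a::real_inner"
  shows "(norm (a + b))\<^sup>2 \<le> 2 * (norm a)\<^sup>2 + 2 * (norm b)\<^sup>2"
  using inner_young[of 1 a b] by (simp add: power2_norm_eq_inner inner_add_left inner_add_right inner_commute)

lemma three_point_identity:
  fixes u y w :: "'a::real_inner"
  shows "(norm (y - w))\<^sup>2 - (norm (y - u))\<^sup>2 - (norm (u - w))\<^sup>2 = 2 * ((u - w) \<bullet> (y - u))"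
  by (simp add: power2_norm_eq_inner inner_diff_left inner_diff_right inner_commute)

text \<open>
Letting a step of size \<open>s\<close> shrink to zero: this turns the comparison of a minimiser with a nearby
point of a segment into a first-order condition.
\<close>
lemma le_of_le_add_mult:
  fixes a b c :: real
  assumes "\<And>s. 0 < s \<Longrightarrow> s \<le> 1 \<Longrightarrow> a \<le> b + s * c"
  shows "a \<le> b"
proof -
  have "((\<lambda>s. b + s * c) \<longlongrightarrow> b + 0 * c) (at_right 0)"
    by (intro tendsto_intros)
  moreover have "eventually (\<lambda>s. a \<le> b + s * c) (at_right (0::real))"
    using eventually_at_right_real[of 0 "1::real"] by (auto elim!: eventually_mono intro!: assms)
  ultimately have "a \<le> b + 0 * c"
    by (intro tendsto_lowerbound) auto
  then show ?thesis by simp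
qed

text \<open>
Comparing the minimiser \<open>u\<close> with \<open>u + s (y - u)\<close>, the convex part changes at most linearly in \<open>s\<close>
and the quadratic part has a linear term plus an error of order \<open>s\<^sup>2\<close>.
\<close>
lemma prox_first_order:
  fixes h :: "'a::real_inner \<Rightarrow> real"
  assumes h: "convex_on A h" and c: "c > 0"
    and u: "is_arg_min (\<lambda>u. h u + 1 / c * eucl_div u w) (\<lambda>u. u \<in> A) u" and y: "y \<in> A"
  shows "h u - h y \<le> 1 / c * ((u - w) \<bullet> (y - u))"
proof (rule le_of_le_add_mult)
  fix s :: real assume s: "0 < s" "s \<le> 1"
  let ?z = "(1 - s) *\<^sub>R u + s *\<^sub>R y"
  have uA: "u \<in> A" using u by (simp add: is_arg_min_def)
  have zA: "?z \<in> A"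
    using convex_on_imp_convex[OF h] uA y s by (auto simp: convex_alt)
  have "h u + 1 / c * eucl_div u w \<le> h ?z + 1 / c * eucl_div ?z w"
    using u zA by (auto simp: is_arg_min_def not_less)
  also have "h ?z \<le> (1 - s) * h u + s * h y"
    using convex_onD[OF h, of s u y] uA y s by simp
  also have "eucl_div ?z w = eucl_div u w + s * ((u - w) \<bullet> (y - u)) + s\<^sup>2 * (norm (y - u))\<^sup>2 / 2"
  proof -
    have *: "?z - w = (u - w) + s *\<^sub>R (y - u)" by (simp add: algebra_simps)
    show ?thesis
      unfolding eucl_div_def * power2_norm_eq_inner
      by (simp only: inner_add_left inner_add_right inner_scaleR_left inner_scaleR_right inner_commute[of "y - u" "u - w"])
        (simp add: power2_eq_square field_simps del: inner_diff_left inner_diff_right)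
  qed
  finally have "s * (h u - h y) \<le> s * (1 / c * ((u - w) \<bullet> (y - u)) + s * ((norm (y - u))\<^sup>2 / (2 * c)))"
    by (simp add: algebra_simps power2_eq_square add_divide_distrib)
  then show "h u - h y \<le> 1 / c * ((u - w) \<bullet> (y - u)) + s * ((norm (y - u))\<^sup>2 / (2 * c))"
    using s by simp
qed

lemma prox_three_point:
  fixes h :: "'a::real_inner \<Rightarrow> real"
  assumes "convex_on A h" "c > 0"
    and "is_arg_min (\<lambda>u. h u + 1 / c * eucl_div u w) (\<lambda>u. u \<in> A) u" "y \<in> A"
  shows "h u - h y \<le> 1 / (2 * c) * ((norm (y - w))\<^sup>2 - (norm (y - u))\<^sup>2 - (norm (u - w))\<^sup>2)"
  using prox_first_order[OF assms] unfolding three_point_identity by simp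

lemma convex_on_inner_left: "convex A \<Longrightarrow> convex_on A (\<lambda>u. a \<bullet> u)"
  by (intro convex_onI) (auto simp: inner_add_right)

text \<open>
Adding the first-order conditions of two proximal steps cancels the values of \<open>h\<close>.  Only the
combination \<open>w - c *\<^sub>R a\<close> of the centre and the linear term enters the minimiser.
\<close>
lemma prox_nonexpansive:
  fixes h :: "'a::real_inner \<Rightarrow> real"
  assumes h: "convex_on A h" and c: "c > 0"
    and u: "is_arg_min (\<lambda>u. a \<bullet> u + h u + 1 / c * eucl_div u w) (\<lambda>u. u \<in> A) u"
    and u': "is_arg_min (\<lambda>u. a' \<bullet> u + h u + 1 / c * eucl_div u w') (\<lambda>u. u \<in> A) u'"
  shows "norm (u - u') \<le> norm ((w - c *\<^sub>R a) - (w' - c *\<^sub>R a'))"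
proof -
  have A: "u \<in> A" "u' \<in> A" using u u' by (simp_all add: is_arg_min_def)
  have cv: "convex_on A (\<lambda>u. b \<bullet> u + h u)" for b
    using h by (intro convex_on_add convex_on_inner_left convex_on_imp_convex[OF h])
  have 1: "a \<bullet> u + h u - (a \<bullet> u' + h u') \<le> 1 / c * ((u - w) \<bullet> (u' - u))"
    using prox_first_order[OF cv c u A(2)] by simp
  have 2: "a' \<bullet> u' + h u' - (a' \<bullet> u + h u) \<le> 1 / c * ((u' - w') \<bullet> (u - u'))"
    using prox_first_order[OF cv c u' A(1)] by simp
  have "(a - a') \<bullet> (u - u') \<le> 1 / c * ((u - w) \<bullet> (u' - u) + (u' - w') \<bullet> (u - u'))"
    using 1 2 by (simp add: algebra_simps)
  then have "c * ((a - a') \<bullet> (u - u')) \<le> (u - w) \<bullet> (u' - u) + (u' - w') \<bullet> (u - u')"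
    using c by (simp add: field_simps)
  then have "(norm (u - u'))\<^sup>2 \<le> ((w - c *\<^sub>R a) - (w' - c *\<^sub>R a')) \<bullet> (u - u')"
    by (simp add: power2_norm_eq_inner inner_diff_left inner_diff_right inner_commute algebra_simps)
  also have "\<dots> \<le> norm ((w - c *\<^sub>R a) - (w' - c *\<^sub>R a')) * norm (u - u')"
    by (rule norm_cauchy_schwarz)
  finally show ?thesis
    by (cases "u = u'") (auto simp: power2_eq_square)
qed

text \<open>
By nonexpansiveness a selected minimiser is a Lipschitz, hence Borel, function of
\<open>w - c *\<^sub>R a\<close>, on the set of the values that this combination takes.
\<close>
lemma prox_measurable:
  fixes h :: "'a::euclidean_space \<Rightarrow> real"
  assumes h: "convex_on A h" and c: "c > 0"
    and [measurable]: "a \<in> borel_measurable N" "w \<in> borel_measurable N"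
    and u: "\<And>\<omega>. \<omega> \<in> space N \<Longrightarrow>
      is_arg_min (\<lambda>u. a \<omega> \<bullet> u + h u + 1 / c * eucl_div u (w \<omega>)) (\<lambda>u. u \<in> A) (u \<omega>)"
  shows "u \<in> borel_measurable N"
proof -
  define b where "b = (\<lambda>\<omega>. w \<omega> - c *\<^sub>R a \<omega>)"
  define f where "f = (\<lambda>z. u (SOME \<omega>. \<omega> \<in> space N \<and> b \<omega> = z))"
  have ne: "norm (u \<omega> - u \<omega>') \<le> norm (b \<omega> - b \<omega>')" if "\<omega> \<in> space N" "\<omega>' \<in> space N" for \<omega> \<omega>'
    unfolding b_def by (rule prox_nonexpansive[OF h c u[OF that(1)] u[OF that(2)]])
  have sel: "(SOME \<omega>. \<omega> \<in> space N \<and> b \<omega> = z) \<in> space N \<and> b (SOME \<omega>. \<omega> \<in> space N \<and> b \<omega> = z) = z"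
    if "z \<in> b ` space N" for z
  proof -
    have "\<exists>\<omega>. \<omega> \<in> space N \<and> b \<omega> = z" using that by blast
    then show ?thesis by (rule someI_ex)
  qed
  have "dist (f z) (f z') \<le> 1 * dist z z'" if "z \<in> b ` space N" "z' \<in> b ` space N" for z z'
    using ne[of "SOME \<omega>. \<omega> \<in> space N \<and> b \<omega> = z" "SOME \<omega>. \<omega> \<in> space N \<and> b \<omega> = z'"]
      sel[OF that(1)] sel[OF that(2)] by (simp add: f_def dist_norm)
  then have "1-lipschitz_on (b ` space N) f"
    by (intro lipschitz_onI) auto
  then have f: "f \<in> borel_measurable (restrict_space borel (b ` space N))"
    by (intro borel_measurable_continuous_on_restrict lipschitz_on_continuous_on)
  have b: "b \<in> N \<rightarrow>\<^sub>M restrict_space borel (b ` space N)"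
    unfolding b_def by (rule measurable_restrict_space2) auto
  have "u \<omega> = f (b \<omega>)" if "\<omega> \<in> space N" for \<omega>
    using ne[OF that, of "SOME \<omega>'. \<omega>' \<in> space N \<and> b \<omega>' = b \<omega>"] sel[of "b \<omega>"] that
    by (auto simp: f_def)
  then show ?thesis
    using measurable_compose[OF b f] by (simp cong: measurable_cong)
qed

text \<open>
The difference quotient along the segment from \<open>u\<close> to \<open>w\<close> is at most \<open>g w - g u\<close> by convexity and
tends to \<open>d \<bullet> (w - u)\<close>.  The point \<open>u\<close> may lie on the boundary of \<open>A\<close>, where the
derivative is one-sided.
\<close>
lemma convex_on_above_tangent_within:
  fixes g :: "'a::real_inner \<Rightarrow> real"
  assumes g: "convex_on A g" and D: "(g has_derivative (\<lambda>h. d \<bullet> h)) (at u within A)"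
    and u: "u \<in> A" and w: "w \<in> A"
  shows "g u + d \<bullet> (w - u) \<le> g w"
proof -
  define l where "l = (\<lambda>s::real. u + s *\<^sub>R (w - u))"
  have l01: "l ` {0..1} \<subseteq> A"
    using convex_on_imp_convex[OF g] u w by (auto simp: l_def convex_alt algebra_simps)
  have "(l has_derivative (\<lambda>s. s *\<^sub>R (w - u))) (at 0 within {0..1})"
    unfolding l_def by (auto intro!: derivative_eq_intros)
  moreover have "(g has_derivative (\<lambda>h. d \<bullet> h)) (at (l 0) within l ` {0..1})"
    using has_derivative_subset[OF D l01] by (simp add: l_def)
  ultimately have "((\<lambda>s. g (l s)) has_derivative (\<lambda>s. d \<bullet> (s *\<^sub>R (w - u)))) (at 0 within {0..1})"
    by (rule has_derivative_in_compose)
  then have "((\<lambda>s. g (l s)) has_field_derivative (d \<bullet> (w - u))) (at 0 within {0..1})"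
    by (simp add: has_field_derivative_def mult_commute_abs)
  then have "((\<lambda>s. (g (l s) - g (l 0)) / (s - 0)) \<longlongrightarrow> d \<bullet> (w - u)) (at 0 within {0..1})"
    unfolding has_field_derivative_iff .
  moreover have "eventually (\<lambda>s. (g (l s) - g (l 0)) / (s - 0) \<le> g w - g u) (at 0 within {0..1})"
    unfolding eventually_at_filter
  proof (intro always_eventually allI impI)
    fix s :: real assume s: "s \<noteq> 0" "s \<in> {0..1}"
    have "g (l s) \<le> (1 - s) * g u + s * g w"
      using convex_onD[OF g, of s u w] s u w by (simp add: l_def algebra_simps)
    then have "g (l s) - g (l 0) \<le> s * (g w - g u)"
      by (simp add: l_def algebra_simps)
    then show "(g (l s) - g (l 0)) / (s - 0) \<le> g w - g u"
      using s by (simp add: field_simps)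
  qed
  moreover have "at (0::real) within {0..1} \<noteq> bot"
    by (simp add: trivial_limit_within islimpt_Icc)
  ultimately have "d \<bullet> (w - u) \<le> g w - g u"
    by (intro tendsto_upperbound) auto
  then show ?thesis by simp
qed

section \<open>Measurability of suprema and semicontinuous functions\<close>

lemma borel_measurable_lsc_on:
  assumes "lsc_on A f"
  shows "f \<in> borel_measurable (restrict_space borel A)"
  unfolding borel_measurable_iff_greater
proof
  fix c
  have "\<exists>T. open T \<and> u \<in> T \<and> (\<forall>w\<in>A \<inter> T. c < f w)" if "u \<in> A" "c < f u" for u
  proof -
    have "eventually (\<lambda>w. c < f w) (at u within A)"
      using assms that by (auto simp: lsc_on_def)
    then show ?thesis
      unfolding eventually_at_topological using that(2) by auto
  qed
  then obtain T where T: "\<And>u. u \<in> A \<Longrightarrow> c < f u \<Longrightarrow> open (T u) \<and> u \<in> T u \<and> (\<forall>w\<in>A \<inter> T u. c < f w)"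
    by metis
  have "{w \<in> A. c < f w} = A \<inter> (\<Union>u\<in>{w \<in> A. c < f w}. T u)"
    using T by blast
  moreover have "open (\<Union>u\<in>{w \<in> A. c < f w}. T u)"
    using T by blast
  ultimately show "{w \<in> space (restrict_space borel A). c < f w} \<in> sets (restrict_space borel A)"
    unfolding sets_restrict_space space_restrict_space by (auto intro!: image_eqI borel_open)
qed

text \<open>
An arbitrary supremum of continuous functions is lower semicontinuous.  This makes the perturbed gap,
a supremum over an uncountable set, a random variable.
\<close>
lemma borel_measurable_SUP_continuous:
  fixes f :: "'i \<Rightarrow> 'a::topological_space \<Rightarrow> real"
  assumes "\<And>i. i \<in> I \<Longrightarrow> continuous_on UNIV (f i)"
  shows "(\<lambda>x. SUP i\<in>I. ereal (f i x)) \<in> borel_measurable borel"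
proof (rule borel_measurableI_greater)
  fix c :: ereal
  have "{x \<in> space borel. c < (SUP i\<in>I. ereal (f i x))} = (\<Union>i\<in>I. (\<lambda>x. ereal (f i x)) -` {c<..})"
    by (auto simp: less_SUP_iff)
  moreover have "open ((\<lambda>x. ereal (f i x)) -` {c<..})" if "i \<in> I" for i
    using assms[OF that] by (intro open_vimage continuous_intros) auto
  ultimately show "{x \<in> space borel. c < (SUP i\<in>I. ereal (f i x))} \<in> sets borel"
    by (auto intro!: borel_open)
qed

lemma dual_norm_eq_norm: "dual_norm v = norm (v::'a::euclidean_space)"
proof (rule antisym)
  show "dual_norm v \<le> norm v"
    unfolding dual_norm_def by (rule onorm_bound) (auto simp: Cauchy_Schwarz_ineq2)
  have "v \<bullet> v \<le> dual_norm v * norm v"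
    using onorm[OF bounded_linear_inner_right, of v v] unfolding dual_norm_def by simp
  then show "norm v \<le> dual_norm v"
    by (cases "v = 0") (auto simp: dual_norm_def dot_square_norm power2_eq_square onorm_zero)
qed

section \<open>Stepsizes\<close>

locale apd_problem =
  fixes X :: "'a::euclidean_space set" and Y :: "'b::euclidean_space set"
    and G :: "'a \<Rightarrow> real" and gradG :: "'a \<Rightarrow> 'a" and L_G :: real
    and K :: "'a \<Rightarrow> 'b" and J :: "'b \<Rightarrow> real"
    and p q :: real and \<beta> \<theta> \<eta> \<tau> :: "nat \<Rightarrow> real" and x1 :: 'a and y1 :: 'b
  assumes G_convex: "convex_on X G"
    and G_grad: "\<And>u. u \<in> X \<Longrightarrow> (G has_derivative (\<lambda>h. gradG u \<bullet> h)) (at u within X)"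
    and G_smooth: "\<And>u w. u \<in> X \<Longrightarrow> w \<in> X \<Longrightarrow>
           G w - G u - gradG u \<bullet> (w - u) \<le> L_G / 2 * (norm (w - u))\<^sup>2"
    and K: "linear K"
    and J_convex: "convex_on Y J"
    and init: "x1 \<in> X" "y1 \<in> Y"
    and stepsizes_pos: "\<And>i. i \<ge> 1 \<Longrightarrow> \<eta> i > 0" "\<And>i. i \<ge> 1 \<Longrightarrow> \<tau> i > 0"
    and pq: "0 < p" "p < 1" "0 < q" "q < 1"
    and \<beta>1: "\<beta> 1 = 1"
    and \<beta>_step: "\<And>i. i \<ge> 1 \<Longrightarrow> \<beta> (i + 1) - 1 = \<beta> i * \<theta> (i + 1)"
    and \<theta>: "\<And>i. i \<ge> 2 \<Longrightarrow> \<theta> i = \<eta> (i - 1) / \<eta> i"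
           "\<And>i. i \<ge> 2 \<Longrightarrow> \<theta> i = \<tau> (i - 1) / \<tau> i"
    and step_cond: "\<And>i. i \<ge> 1 \<Longrightarrow> q / \<eta> i - L_G / \<beta> i - (onorm K)\<^sup>2 * \<tau> i / p \<ge> 0"
begin

lemma convex_XY: "convex X" "convex Y"
  using G_convex J_convex by (auto dest: convex_on_imp_convex)

lemma G_above_tangent: "u \<in> X \<Longrightarrow> w \<in> X \<Longrightarrow> G u + gradG u \<bullet> (w - u) \<le> G w"
  by (rule convex_on_above_tangent_within[OF G_convex G_grad])

lemma norm_K_le: "norm (K u) \<le> onorm K * norm u"
  using K by (intro onorm) (rule linear_conv_bounded_linear[THEN iffD1])

lemma onorm_K_nonneg: "0 \<le> onorm K"
  using K by (intro onorm_pos_le) (rule linear_conv_bounded_linear[THEN iffD1])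

text \<open>
The ratio of primal and dual stepsizes, which the two formulas for \<open>\<theta>\<close> keep constant.  It converts
dual squared distances to the scale of the primal ones.
\<close>
definition r :: real where "r = \<eta> 1 / \<tau> 1"

text \<open>
What iteration \<open>i\<close> with errors \<open>d\<close>, \<open>e\<close> contributes to the telescoped gap when \<open>u\<close> and \<open>w\<close> are the
displacements of the current iterates from the point of comparison.  The inner products have mean
zero; the squares arise from Young's inequality, their coefficients from the share of the increments
that is left for the noise.
\<close>
definition noise :: "nat \<Rightarrow> 'a \<Rightarrow> 'b \<Rightarrow> 'a \<Rightarrow> 'b \<Rightarrow> real" where
  "noise i d e u w = (\<eta> i)\<^sup>2 / (2 * (1 - q)) * (norm d)\<^sup>2 + \<eta> i * \<tau> i / (2 * (1 - p)) * (norm e)\<^sup>2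
     - \<eta> i * (d \<bullet> u) - \<eta> i * (e \<bullet> w)"

text \<open>
The weight \<open>1 - p\<close> is the part of the dual squared distance that survives after the last
extrapolation term has been absorbed.
\<close>
definition energy :: "'a \<Rightarrow> 'b \<Rightarrow> real" where
  "energy u w = (norm u)\<^sup>2 + (1 - p) * r * (norm w)\<^sup>2"

lemma r_pos: "r > 0"
  using stepsizes_pos[of 1] by (simp add: r_def)

lemma \<theta>_\<eta>: "i \<ge> 1 \<Longrightarrow> \<eta> (i + 1) * \<theta> (i + 1) = \<eta> i"
  using \<theta>(1)[of "i + 1"] stepsizes_pos(1)[of "i + 1"] by simp

lemma \<eta>_eq: "i \<ge> 1 \<Longrightarrow> \<eta> i = r * \<tau> i"
proof (induction i rule: nat_induct_at_least)
  case base
  then show ?case using stepsizes_pos[of 1] by (simp add: r_def)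
next
  case (Suc i)
  have "\<eta> i / \<eta> (Suc i) = \<tau> i / \<tau> (Suc i)"
    using \<theta>[of "Suc i"] Suc.hyps by simp
  then show ?case
    using Suc stepsizes_pos[of i] stepsizes_pos[of "Suc i"] by (simp add: field_simps)
qed

lemma \<beta>_ge_1: "i \<ge> 1 \<Longrightarrow> \<beta> i \<ge> 1"
proof (induction i rule: nat_induct_at_least)
  case base
  then show ?case using \<beta>1 by simp
next
  case (Suc i)
  have "\<theta> (i + 1) > 0"
    using \<theta>(1)[of "i + 1"] stepsizes_pos(1)[of i] stepsizes_pos(1)[of "i + 1"] Suc.hyps by simp
  then have "\<beta> i * \<theta> (i + 1) \<ge> 0"
    using Suc.IH by simp
  then show ?case
    using \<beta>_step[of i] Suc.hyps by simp
qed

text \<open>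
This is why the weighted gaps telescope: an aggregate has the same weight in the iteration that
creates it and in the next one.
\<close>
lemma \<beta>_weight: "i \<ge> 1 \<Longrightarrow> \<eta> (i + 1) * (\<beta> (i + 1) - 1) = \<eta> i * \<beta> i"
  using \<beta>_step[of i] \<theta>_\<eta>[of i] by (metis mult.assoc mult.commute)

lemma energy_convex:
  assumes s: "0 \<le> s" "s \<le> 1"
  shows "energy ((1 - s) *\<^sub>R u + s *\<^sub>R u') ((1 - s) *\<^sub>R w + s *\<^sub>R w')
    \<le> (1 - s) * energy u w + s * energy u' w'"
proof -
  have sq: "(norm ((1 - s) *\<^sub>R a + s *\<^sub>R b))\<^sup>2 \<le> (1 - s) * (norm a)\<^sup>2 + s * (norm b)\<^sup>2"
    for a b :: "'c::real_inner"
  proof -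
    have "(1 - s) * (norm a)\<^sup>2 + s * (norm b)\<^sup>2 - (norm ((1 - s) *\<^sub>R a + s *\<^sub>R b))\<^sup>2
        = s * (1 - s) * (norm (a - b))\<^sup>2"
      by (simp add: power2_norm_eq_inner inner_add_left inner_add_right inner_diff_left
          inner_diff_right inner_commute algebra_simps)
    moreover have "0 \<le> s * (1 - s) * (norm (a - b))\<^sup>2" using s by simp
    ultimately show ?thesis by linarith
  qed
  have "(1 - p) * r * (norm ((1 - s) *\<^sub>R w + s *\<^sub>R w'))\<^sup>2
      \<le> (1 - p) * r * ((1 - s) * (norm w)\<^sup>2 + s * (norm w')\<^sup>2)"
    using pq r_pos sq[of w w'] by (intro mult_left_mono) auto
  with sq[of u u'] show ?thesis
    by (simp add: energy_def algebra_simps)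
qed

lemma norm_le_energy: "(norm u)\<^sup>2 \<le> energy u w" "(norm w)\<^sup>2 \<le> 1 / ((1 - p) * r) * energy u w"
proof -
  have c: "(1 - p) * r > 0" using pq r_pos by simp
  then show "(norm u)\<^sup>2 \<le> energy u w" by (simp add: energy_def)
  have "1 / ((1 - p) * r) * energy u w = 1 / ((1 - p) * r) * (norm u)\<^sup>2 + (norm w)\<^sup>2"
    unfolding energy_def distrib_left using pq r_pos by simp
  then show "(norm w)\<^sup>2 \<le> 1 / ((1 - p) * r) * energy u w"
    using c by simp
qed

end

section \<open>The gap along one trajectory\<close>

text \<open>
One trajectory of the method, with \<open>dx i\<close> and \<open>dy i\<close> as the errors of the gradients used in the
primal and the dual step.  Since all estimates up to the expectations concern single trajectories,
they are stated for arbitrary errors.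
\<close>
locale perturbed_apd = apd_problem X Y G gradG L_G K J p q \<beta> \<theta> \<eta> \<tau> x1 y1
  for X :: "'a::euclidean_space set" and Y :: "'b::euclidean_space set"
    and G gradG L_G K J p q \<beta> \<theta> \<eta> \<tau> x1 y1 +
  fixes dx :: "nat \<Rightarrow> 'a" and dy :: "nat \<Rightarrow> 'b"
    and x xag xmd xbar :: "nat \<Rightarrow> 'a" and y yag :: "nat \<Rightarrow> 'b"
  assumes start: "x 1 = x1" "y 1 = y1" "xag 1 = x1" "yag 1 = y1" "xbar 1 = x1"
    and xmd: "\<And>i. i \<ge> 1 \<Longrightarrow> xmd i = (1 - inverse (\<beta> i)) *\<^sub>R xag i + inverse (\<beta> i) *\<^sub>R x i"
    and y_step: "\<And>i. i \<ge> 1 \<Longrightarrow> is_arg_min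
      (\<lambda>u. (dy i - K (xbar i)) \<bullet> u + J u + 1 / \<tau> i * eucl_div u (y i)) (\<lambda>u. u \<in> Y) (y (i + 1))"
    and x_step: "\<And>i. i \<ge> 1 \<Longrightarrow> is_arg_min
      (\<lambda>u. (gradG (xmd i) + adjoint K (y (i + 1)) + dx i) \<bullet> u + 1 / \<eta> i * eucl_div u (x i))
      (\<lambda>u. u \<in> X) (x (i + 1))"
    and xag: "\<And>i. i \<ge> 1 \<Longrightarrow> xag (i + 1) = (1 - inverse (\<beta> i)) *\<^sub>R xag i + inverse (\<beta> i) *\<^sub>R x (i + 1)"
    and yag: "\<And>i. i \<ge> 1 \<Longrightarrow> yag (i + 1) = (1 - inverse (\<beta> i)) *\<^sub>R yag i + inverse (\<beta> i) *\<^sub>R y (i + 1)"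
    and xbar: "\<And>i. i \<ge> 1 \<Longrightarrow> xbar (i + 1) = \<theta> (i + 1) *\<^sub>R (x (i + 1) - x i) + x (i + 1)"
begin

lemma inverse_\<beta>_bounds: "i \<ge> 1 \<Longrightarrow> 0 < inverse (\<beta> i) \<and> inverse (\<beta> i) \<le> 1"
  using \<beta>_ge_1[of i] by (auto simp: inverse_le_1_iff)

lemma iterates_in: "i \<ge> 1 \<Longrightarrow> x i \<in> X \<and> y i \<in> Y"
proof (induction i rule: nat_induct_at_least)
  case base
  show ?case using start init by simp
next
  case (Suc i)
  then show ?case
    using x_step[of i] y_step[of i] by (simp add: is_arg_min_def)
qed

lemma combination_in:
  assumes "convex A" "u \<in> A" "w \<in> A" "i \<ge> 1"
  shows "(1 - inverse (\<beta> i)) *\<^sub>R u + inverse (\<beta> i) *\<^sub>R w \<in> A"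
  using assms inverse_\<beta>_bounds[of i] by (auto simp: convex_alt)

lemma aggregates_in: "i \<ge> 1 \<Longrightarrow> xag i \<in> X \<and> yag i \<in> Y"
proof (induction i rule: nat_induct_at_least)
  case base
  show ?case using start init by simp
next
  case (Suc i)
  then show ?case
    using xag[of i] yag[of i] iterates_in[of "i + 1"] convex_XY
    by (auto intro!: combination_in)
qed

lemma xmd_in: "i \<ge> 1 \<Longrightarrow> xmd i \<in> X"
  unfolding xmd using aggregates_in[of i] iterates_in[of i] convex_XY by (auto intro!: combination_in)

abbreviation Q :: "nat \<Rightarrow> 'a \<Rightarrow> 'b \<Rightarrow> real" where
  "Q i u w \<equiv> gap_Q G K J (xag i, yag i) (u, w)"

lemma scaled_aggregate:
  assumes "i \<ge> 1"
  shows "\<beta> i *\<^sub>R xag (i + 1) = (\<beta> i - 1) *\<^sub>R xag i + x (i + 1)"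
    and "\<beta> i *\<^sub>R yag (i + 1) = (\<beta> i - 1) *\<^sub>R yag i + y (i + 1)"
  using \<beta>_ge_1[OF assms] xag[OF assms] yag[OF assms]
  by (simp_all add: scaleR_add_right right_diff_distrib)

text \<open>
Smoothness is applied between \<open>xmd i\<close> and the new aggregate, whose difference is a multiple
\<open>inverse (\<beta> i)\<close> of the primal increment.  The linear term then splits into a part towards the old
aggregate and a part towards \<open>x (i + 1)\<close>, and both are bounded by the tangent inequality.
\<close>
lemma G_aggregate_step:
  assumes i: "i \<ge> 1" and u: "u \<in> X"
  shows "\<beta> i * G (xag (i + 1)) \<le> (\<beta> i - 1) * G (xag i) + G u
    + gradG (xmd i) \<bullet> (x (i + 1) - u) + L_G / (2 * \<beta> i) * (norm (x (i + 1) - x i))\<^sup>2"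
proof -
  let ?g = "gradG (xmd i)" and ?m = "xmd i"
  have b: "\<beta> i \<ge> 1" by (rule \<beta>_ge_1[OF i])
  have diff: "xag (i + 1) - ?m = inverse (\<beta> i) *\<^sub>R (x (i + 1) - x i)"
    using xag[OF i] xmd[OF i] by (simp add: scaleR_diff_right)
  have "xag (i + 1) \<in> X" "?m \<in> X" "xag i \<in> X"
    using aggregates_in[of "i + 1"] aggregates_in[OF i] xmd_in[OF i] by simp_all
  note in_X = this
  have smooth: "G (xag (i + 1)) \<le> G ?m + ?g \<bullet> (xag (i + 1) - ?m)
      + L_G / 2 * (inverse (\<beta> i))\<^sup>2 * (norm (x (i + 1) - x i))\<^sup>2"
    using G_smooth[OF in_X(2,1)] b unfolding diff by (simp add: power_mult_distrib abs_of_pos)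
  have scaled: "\<beta> i *\<^sub>R (xag (i + 1) - ?m) = (\<beta> i - 1) *\<^sub>R (xag i - ?m) + (x (i + 1) - ?m)"
    using scaled_aggregate(1)[OF i] by (simp add: algebra_simps)
  have "\<beta> i * G (xag (i + 1)) \<le> \<beta> i * (G ?m + ?g \<bullet> (xag (i + 1) - ?m)
      + L_G / 2 * (inverse (\<beta> i))\<^sup>2 * (norm (x (i + 1) - x i))\<^sup>2)"
    using smooth b by (intro mult_left_mono) auto
  also have "\<dots> = \<beta> i * G ?m + ?g \<bullet> (\<beta> i *\<^sub>R (xag (i + 1) - ?m))
      + L_G / (2 * \<beta> i) * (norm (x (i + 1) - x i))\<^sup>2"
    using b by (simp only: inner_scaleR_right) (simp add: field_simps power2_eq_square del: inner_diff_right)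
  also have "\<dots> = (\<beta> i - 1) * (G ?m + ?g \<bullet> (xag i - ?m)) + (G ?m + ?g \<bullet> (x (i + 1) - ?m))
      + L_G / (2 * \<beta> i) * (norm (x (i + 1) - x i))\<^sup>2"
    unfolding scaled by (simp only: inner_add_right inner_scaleR_right) (simp add: algebra_simps)
  also have "\<dots> \<le> (\<beta> i - 1) * G (xag i) + (G u + ?g \<bullet> (x (i + 1) - u))
      + L_G / (2 * \<beta> i) * (norm (x (i + 1) - x i))\<^sup>2"
  proof -
    have "(\<beta> i - 1) * (G ?m + ?g \<bullet> (xag i - ?m)) \<le> (\<beta> i - 1) * G (xag i)"
      using G_above_tangent[OF in_X(2,3)] b by (intro mult_left_mono) auto
    moreover have "G ?m + ?g \<bullet> (x (i + 1) - ?m) \<le> G u + ?g \<bullet> (x (i + 1) - u)"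
      using G_above_tangent[OF in_X(2) u] by (simp add: inner_diff_right)
    ultimately show ?thesis by linarith
  qed
  finally show ?thesis by (simp add: add.assoc)
qed

lemma J_aggregate_step:
  assumes i: "i \<ge> 1"
  shows "\<beta> i * J (yag (i + 1)) \<le> (\<beta> i - 1) * J (yag i) + J (y (i + 1))"
proof -
  have b: "\<beta> i \<ge> 1" by (rule \<beta>_ge_1[OF i])
  have "J (yag (i + 1)) \<le> (1 - inverse (\<beta> i)) * J (yag i) + inverse (\<beta> i) * J (y (i + 1))"
    unfolding yag[OF i] using inverse_\<beta>_bounds[OF i] aggregates_in[OF i] iterates_in[of "i + 1"]
    by (intro convex_onD[OF J_convex]) auto
  then have "\<beta> i * J (yag (i + 1)) \<le> \<beta> i * ((1 - inverse (\<beta> i)) * J (yag i) + inverse (\<beta> i) * J (y (i + 1)))"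
    using b by (intro mult_left_mono) auto
  also have "\<dots> = (\<beta> i - 1) * J (yag i) + J (y (i + 1))"
    using b by (simp add: field_simps)
  finally show ?thesis .
qed

text \<open>
All terms of the gap are averaged by the aggregation: the bilinear ones exactly, \<open>J\<close> by convexity and
\<open>G\<close> up to the smoothness term.  Adding the three-point inequalities of the two proximal steps leaves a
single bilinear term, in the deviation of \<open>x (i + 1)\<close> from the extrapolated point \<open>xbar i\<close>.
\<close>
lemma gap_step:
  assumes i: "i \<ge> 1" and u: "u \<in> X" and w: "w \<in> Y"
  shows "\<beta> i * Q (i + 1) u w \<le> (\<beta> i - 1) * Q i u w
    + 1 / (2 * \<eta> i) * ((norm (u - x i))\<^sup>2 - (norm (u - x (i + 1)))\<^sup>2 - (norm (x (i + 1) - x i))\<^sup>2)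
    + 1 / (2 * \<tau> i) * ((norm (w - y i))\<^sup>2 - (norm (w - y (i + 1)))\<^sup>2 - (norm (y (i + 1) - y i))\<^sup>2)
    + L_G / (2 * \<beta> i) * (norm (x (i + 1) - x i))\<^sup>2
    - K (x (i + 1) - xbar i) \<bullet> (y (i + 1) - w) - dx i \<bullet> (x (i + 1) - u) - dy i \<bullet> (y (i + 1) - w)"
proof -
  let ?x = "x (i + 1)" and ?y = "y (i + 1)"
  have b: "\<beta> i \<ge> 1" by (rule \<beta>_ge_1[OF i])
  have Kag: "\<beta> i * (K (xag (i + 1)) \<bullet> w) = (\<beta> i - 1) * (K (xag i) \<bullet> w) + K ?x \<bullet> w"
    using arg_cong[OF scaled_aggregate(1)[OF i], of "\<lambda>v. K v \<bullet> w"]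
    by (simp add: linear_add[OF K] linear_scale[OF K] inner_add_left)
  have yag': "\<beta> i * (K u \<bullet> yag (i + 1)) = (\<beta> i - 1) * (K u \<bullet> yag i) + K u \<bullet> ?y"
    using arg_cong[OF scaled_aggregate(2)[OF i], of "\<lambda>v. K u \<bullet> v"] by (simp add: inner_add_right)
  have "\<beta> i * Q (i + 1) u w - (\<beta> i - 1) * Q i u w =
      (\<beta> i * G (xag (i + 1)) - (\<beta> i - 1) * G (xag i)) - G u
      + (\<beta> i * (K (xag (i + 1)) \<bullet> w) - (\<beta> i - 1) * (K (xag i) \<bullet> w)) - J w
      - (\<beta> i * (K u \<bullet> yag (i + 1)) - (\<beta> i - 1) * (K u \<bullet> yag i))
      + (\<beta> i * J (yag (i + 1)) - (\<beta> i - 1) * J (yag i))"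
    by (simp add: gap_Q_def algebra_simps)
  also have "\<dots> \<le> gradG (xmd i) \<bullet> (?x - u) + L_G / (2 * \<beta> i) * (norm (?x - x i))\<^sup>2
      + K ?x \<bullet> w - K u \<bullet> ?y + J ?y - J w"
    using G_aggregate_step[OF i u] J_aggregate_step[OF i] Kag yag' by linarith
  finally have 1: "\<beta> i * Q (i + 1) u w - (\<beta> i - 1) * Q i u w \<le> \<dots>" .
  have adj: "adjoint K ?y \<bullet> v = K v \<bullet> ?y" for v
    using adjoint_works[OF K, of v ?y] by (simp add: inner_commute)
  have "(gradG (xmd i) + adjoint K ?y + dx i) \<bullet> ?x - (gradG (xmd i) + adjoint K ?y + dx i) \<bullet> u
      \<le> 1 / (2 * \<eta> i) * ((norm (u - x i))\<^sup>2 - (norm (u - ?x))\<^sup>2 - (norm (?x - x i))\<^sup>2)"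
    using x_step[OF i] stepsizes_pos(1)[OF i] u convex_XY(1)
    by (intro prox_three_point[OF convex_on_inner_left])
  then have 2: "gradG (xmd i) \<bullet> (?x - u) + (K ?x \<bullet> ?y - K u \<bullet> ?y) + dx i \<bullet> (?x - u)
      \<le> 1 / (2 * \<eta> i) * ((norm (u - x i))\<^sup>2 - (norm (u - ?x))\<^sup>2 - (norm (?x - x i))\<^sup>2)"
    by (simp add: inner_add_left inner_diff_right adj[simplified])
  have "((dy i - K (xbar i)) \<bullet> ?y + J ?y) - ((dy i - K (xbar i)) \<bullet> w + J w)
      \<le> 1 / (2 * \<tau> i) * ((norm (w - y i))\<^sup>2 - (norm (w - ?y))\<^sup>2 - (norm (?y - y i))\<^sup>2)"
    using y_step[OF i] stepsizes_pos(2)[OF i] w convex_XY(2) J_convex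
    by (intro prox_three_point[of Y "\<lambda>u. (dy i - K (xbar i)) \<bullet> u + J u"] convex_on_add convex_on_inner_left)
  then have 3: "dy i \<bullet> (?y - w) - K (xbar i) \<bullet> (?y - w) + J ?y - J w
      \<le> 1 / (2 * \<tau> i) * ((norm (w - y i))\<^sup>2 - (norm (w - ?y))\<^sup>2 - (norm (?y - y i))\<^sup>2)"
    by (simp add: inner_diff_left inner_diff_right)
  have 4: "K (?x - xbar i) \<bullet> (?y - w) = (K ?x \<bullet> ?y - K ?x \<bullet> w) - K (xbar i) \<bullet> (?y - w)"
    by (simp add: linear_diff[OF K] inner_diff_left inner_diff_right)
  show ?thesis
    using 1 2 3 4 by linarith
qed

text \<open>
The negative squares of the increments are distributed as follows.  On the primal side the fraction
\<open>1 - q\<close> pays for the correlation of the error with the increment, and the remaining \<open>q\<close> pays, by the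
stepsize condition, for the smoothness term and for the extrapolation of the next iteration.
On the dual side \<open>1 - p\<close> goes to the error and \<open>p\<close> is kept for the extrapolation.
\<close>
lemma weighted_gap_step:
  assumes i: "i \<ge> 1" and u: "u \<in> X" and w: "w \<in> Y"
  shows "\<eta> i * \<beta> i * Q (i + 1) u w \<le> \<eta> i * (\<beta> i - 1) * Q i u w
    + ((norm (u - x i))\<^sup>2 - (norm (u - x (i + 1)))\<^sup>2) / 2
    + r / 2 * ((norm (w - y i))\<^sup>2 - (norm (w - y (i + 1)))\<^sup>2)
    - \<eta> i * (K (x (i + 1) - xbar i) \<bullet> (y (i + 1) - w))
    - \<eta> i * \<tau> i * (onorm K)\<^sup>2 / (2 * p) * (norm (x (i + 1) - x i))\<^sup>2
    - p * r / 2 * (norm (y (i + 1) - y i))\<^sup>2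
    + noise i (dx i) (dy i) (x i - u) (y i - w)"
proof -
  let ?x = "x (i + 1)" and ?y = "y (i + 1)"
  let ?ax = "(norm (u - x i))\<^sup>2" and ?bx = "(norm (u - ?x))\<^sup>2" and ?cx = "(norm (?x - x i))\<^sup>2"
  let ?ay = "(norm (w - y i))\<^sup>2" and ?by = "(norm (w - ?y))\<^sup>2" and ?cy = "(norm (?y - y i))\<^sup>2"
  have e: "\<eta> i > 0" and t: "\<tau> i > 0" and b: "\<beta> i \<ge> 1"
    using stepsizes_pos i \<beta>_ge_1[OF i] by auto
  have "\<eta> i * (\<beta> i * Q (i + 1) u w) \<le> \<eta> i * ((\<beta> i - 1) * Q i u w
    + 1 / (2 * \<eta> i) * (?ax - ?bx - ?cx) + 1 / (2 * \<tau> i) * (?ay - ?by - ?cy)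
    + L_G / (2 * \<beta> i) * ?cx
    - K (?x - xbar i) \<bullet> (?y - w) - dx i \<bullet> (?x - u) - dy i \<bullet> (?y - w))"
    using gap_step[OF i u w] e by (intro mult_left_mono) auto
  also have "\<dots> = \<eta> i * (\<beta> i - 1) * Q i u w
    + (\<eta> i * (1 / (2 * \<eta> i))) * (?ax - ?bx - ?cx) + (\<eta> i * (1 / (2 * \<tau> i))) * (?ay - ?by - ?cy)
    + \<eta> i * L_G / (2 * \<beta> i) * ?cx
    - \<eta> i * (K (?x - xbar i) \<bullet> (?y - w)) - \<eta> i * (dx i \<bullet> (?x - u)) - \<eta> i * (dy i \<bullet> (?y - w))"
    by (simp add: algebra_simps add_divide_distrib diff_divide_distrib)
  also have "\<eta> i * (1 / (2 * \<eta> i)) = 1 / 2"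
    using e by simp
  also have "\<eta> i * (1 / (2 * \<tau> i)) = r / 2"
    using t \<eta>_eq[OF i] by simp
  finally have 1: "\<eta> i * \<beta> i * Q (i + 1) u w \<le> \<eta> i * (\<beta> i - 1) * Q i u w
    + 1 / 2 * (?ax - ?bx - ?cx) + r / 2 * (?ay - ?by - ?cy)
    + \<eta> i * L_G / (2 * \<beta> i) * ?cx
    - \<eta> i * (K (?x - xbar i) \<bullet> (?y - w)) - \<eta> i * (dx i \<bullet> (?x - u)) - \<eta> i * (dy i \<bullet> (?y - w))"
    by (simp add: mult.assoc)
  \<comment> \<open>In the random setting the error has mean zero given the past, of which \<open>x i\<close> but not \<open>x (i + 1)\<close>
    is a function; so the pairing is moved to \<open>x i\<close>.\<close>
  have "- (\<eta> i *\<^sub>R dx i) \<bullet> (?x - x i) = (?x - x i) \<bullet> (- (\<eta> i *\<^sub>R dx i))"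
    by (rule inner_commute)
  also have "\<dots> \<le> (1 - q) / 2 * ?cx + 1 / (2 * (1 - q)) * (norm (- (\<eta> i *\<^sub>R dx i)))\<^sup>2"
    using pq by (intro inner_young) simp
  finally have 2: "- (\<eta> i * (dx i \<bullet> (?x - u))) \<le> - (\<eta> i * (dx i \<bullet> (x i - u)))
      + (1 - q) / 2 * ?cx + (\<eta> i)\<^sup>2 / (2 * (1 - q)) * (norm (dx i))\<^sup>2"
    by (simp add: power_mult_distrib inner_diff_right algebra_simps)
  have "- (\<eta> i *\<^sub>R dy i) \<bullet> (?y - y i) = (?y - y i) \<bullet> (- (\<eta> i *\<^sub>R dy i))"
    by (rule inner_commute)
  also have "\<dots> \<le> (1 - p) * r / 2 * ?cy + 1 / (2 * ((1 - p) * r)) * (norm (- (\<eta> i *\<^sub>R dy i)))\<^sup>2"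
    using pq r_pos by (intro inner_young) simp
  also have "(norm (- (\<eta> i *\<^sub>R dy i)))\<^sup>2 = r * (\<eta> i * \<tau> i * (norm (dy i))\<^sup>2)"
    using \<eta>_eq[OF i] by (simp add: power_mult_distrib power2_eq_square)
  also have "1 / (2 * ((1 - p) * r)) * (r * (\<eta> i * \<tau> i * (norm (dy i))\<^sup>2)) = \<eta> i * \<tau> i / (2 * (1 - p)) * (norm (dy i))\<^sup>2"
    using pq r_pos by simp
  finally have 3: "- (\<eta> i * (dy i \<bullet> (?y - w))) \<le> - (\<eta> i * (dy i \<bullet> (y i - w)))
      + (1 - p) * r / 2 * ?cy + \<eta> i * \<tau> i / (2 * (1 - p)) * (norm (dy i))\<^sup>2"
    by (simp add: inner_diff_right algebra_simps)
  have "0 \<le> \<eta> i * (q / \<eta> i - L_G / \<beta> i - (onorm K)\<^sup>2 * \<tau> i / p) / 2"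
    using step_cond[OF i] e by simp
  also have "\<dots> = q / 2 - \<eta> i * L_G / (2 * \<beta> i) - \<eta> i * \<tau> i * (onorm K)\<^sup>2 / (2 * p)"
    using e by (simp add: right_diff_distrib diff_divide_distrib mult_ac)
  finally have "0 \<le> (q / 2 - \<eta> i * L_G / (2 * \<beta> i) - \<eta> i * \<tau> i * (onorm K)\<^sup>2 / (2 * p)) * ?cx"
    by simp
  then have 4: "\<eta> i * L_G / (2 * \<beta> i) * ?cx + \<eta> i * \<tau> i * (onorm K)\<^sup>2 / (2 * p) * ?cx \<le> q / 2 * ?cx"
    unfolding left_diff_distrib by linarith
  have 5: "1 / 2 * (?ax - ?bx - ?cx) + (1 - q) / 2 * ?cx + q / 2 * ?cx = (?ax - ?bx) / 2"
    by (simp add: field_simps)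
  have 6: "r / 2 * (?ay - ?by - ?cy) + (1 - p) * r / 2 * ?cy = r / 2 * (?ay - ?by) - p * r / 2 * ?cy"
    by (simp add: field_simps)
  show ?thesis
    unfolding noise_def using 1 2 3 4 5 6 by linarith
qed

lemma extrapolation_bound:
  assumes i: "i \<ge> 1"
  shows "\<eta> i * (K u \<bullet> w) \<le> \<eta> i * \<tau> i * (onorm K)\<^sup>2 / (2 * p) * (norm u)\<^sup>2 + p * r / 2 * (norm w)\<^sup>2"
proof -
  have e: "\<eta> i > 0" using stepsizes_pos i by auto
  have "\<eta> i * (K u \<bullet> w) = w \<bullet> (\<eta> i *\<^sub>R K u)"
    by (simp add: inner_commute)
  also have "\<dots> \<le> p * r / 2 * (norm w)\<^sup>2 + 1 / (2 * (p * r)) * (norm (\<eta> i *\<^sub>R K u))\<^sup>2"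
    using pq r_pos by (intro inner_young) simp
  also have "1 / (2 * (p * r)) * (norm (\<eta> i *\<^sub>R K u))\<^sup>2 \<le> 1 / (2 * (p * r)) * (\<eta> i * (onorm K * norm u))\<^sup>2"
    using e norm_K_le[of u] pq r_pos by (intro mult_left_mono power_mono) auto
  also have "1 / (2 * (p * r)) * (\<eta> i * (onorm K * norm u))\<^sup>2 = \<eta> i * \<tau> i * (onorm K)\<^sup>2 / (2 * p) * (norm u)\<^sup>2"
    using pq r_pos \<eta>_eq[OF i] by (simp add: power_mult_distrib power2_eq_square)
  finally show ?thesis
    by simp
qed

text \<open>
The extrapolation makes the bilinear terms of consecutive iterations cancel up to
\<open>\<eta> k * (K (x (k + 1) - x k) \<bullet> (y (k + 2) - y (k + 1)))\<close>, which is absorbed by the squares of the two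
increments that the weighted step has kept back.  The bilinear term of the last iteration remains.
\<close>
lemma telescoped_gap:
  assumes u: "u \<in> X" and w: "w \<in> Y" and k: "k \<ge> 1"
  shows "\<eta> k * \<beta> k * Q (k + 1) u w \<le>
      ((norm (u - x1))\<^sup>2 - (norm (u - x (k + 1)))\<^sup>2) / 2
    + r / 2 * ((norm (w - y1))\<^sup>2 - (norm (w - y (k + 1)))\<^sup>2)
    - \<eta> k * (K (x (k + 1) - x k) \<bullet> (y (k + 1) - w))
    - \<eta> k * \<tau> k * (onorm K)\<^sup>2 / (2 * p) * (norm (x (k + 1) - x k))\<^sup>2
    + (\<Sum>i=1..k. noise i (dx i) (dy i) (x i - u) (y i - w))"
  using k
proof (induction k rule: nat_induct_at_least)
  case base
  have "0 \<le> p * r / 2 * (norm (y (1 + 1) - y 1))\<^sup>2"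
    using pq r_pos by simp
  then show ?case
    using weighted_gap_step[of 1, OF _ u w] by (simp add: \<beta>1[simplified] start[simplified])
next
  case (Suc k)
  let ?j = "k + 1"
  have K: "K (x (?j + 1) - xbar ?j) \<bullet> (y (?j + 1) - w) = K (x (?j + 1) - x ?j) \<bullet> (y (?j + 1) - w)
      - \<theta> ?j * (K (x ?j - x k) \<bullet> (y (?j + 1) - w))"
    by (simp only: xbar[OF Suc.hyps(1)] linear_diff[OF K] linear_add[OF K] linear_scale[OF K])
      (simp add: inner_diff_left inner_add_left right_diff_distrib)
  have "\<eta> ?j * (K (x (?j + 1) - xbar ?j) \<bullet> (y (?j + 1) - w))
      = \<eta> ?j * (K (x (?j + 1) - x ?j) \<bullet> (y (?j + 1) - w)) - (\<eta> ?j * \<theta> ?j) * (K (x ?j - x k) \<bullet> (y (?j + 1) - w))"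
    unfolding K by (simp add: right_diff_distrib)
  also have "\<dots> = \<eta> ?j * (K (x (?j + 1) - x ?j) \<bullet> (y (?j + 1) - w)) - \<eta> k * (K (x ?j - x k) \<bullet> (y (?j + 1) - y ?j))
       - \<eta> k * (K (x ?j - x k) \<bullet> (y ?j - w))"
    unfolding \<theta>_\<eta>[OF Suc.hyps(1)] by (simp add: inner_diff_right algebra_simps)
  finally show ?case
    using Suc.IH weighted_gap_step[of ?j, OF _ u w] \<beta>_weight[OF Suc.hyps(1)]
      extrapolation_bound[OF Suc.hyps(1), of "x ?j - x k" "y (?j + 1) - y ?j"]
    by (simp add: diff_divide_distrib right_diff_distrib)
qed

lemma saddle_gap_nonneg:
  assumes "saddle_point X Y G K J (u, w)" "k \<ge> 1"
  shows "0 \<le> Q k u w"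
  using assms aggregates_in[of k] by (force simp: saddle_point_def gap_Q_def)

text \<open>
At a saddle point the gap on the left of the telescoped inequality is nonnegative.  The bilinear
term that is left costs the fraction \<open>p\<close> of the dual squared distance.
\<close>
lemma energy_bound:
  assumes saddle: "saddle_point X Y G K J (u, w)" and k: "k \<ge> 1"
  shows "energy (x (k + 1) - u) (y (k + 1) - w) \<le> (norm (u - x1))\<^sup>2 + r * (norm (w - y1))\<^sup>2
    + 2 * (\<Sum>i=1..k. noise i (dx i) (dy i) (x i - u) (y i - w))"
proof -
  have "u \<in> X" "w \<in> Y"
    using saddle by (auto simp: saddle_point_def)
  note T = telescoped_gap[OF this k]
  have "0 \<le> \<eta> k * \<beta> k * Q (k + 1) u w"
    using saddle_gap_nonneg[OF saddle, of "k + 1"] stepsizes_pos(1)[OF k] \<beta>_ge_1[OF k] by simp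
  moreover have "- (\<eta> k * (K (x (k + 1) - x k) \<bullet> (y (k + 1) - w)))
      \<le> \<eta> k * \<tau> k * (onorm K)\<^sup>2 / (2 * p) * (norm (x (k + 1) - x k))\<^sup>2 + p * r / 2 * (norm (w - y (k + 1)))\<^sup>2"
    using extrapolation_bound[OF k, of "x (k + 1) - x k" "w - y (k + 1)"]
    by (simp add: inner_diff_right algebra_simps)
  ultimately have "0 \<le> ((norm (u - x1))\<^sup>2 - (norm (u - x (k + 1)))\<^sup>2) / 2
    + r / 2 * ((norm (w - y1))\<^sup>2 - (norm (w - y (k + 1)))\<^sup>2) + p * r / 2 * (norm (w - y (k + 1)))\<^sup>2
    + (\<Sum>i=1..k. noise i (dx i) (dy i) (x i - u) (y i - w))"
    using T by linarith
  then show ?thesis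
    by (simp add: energy_def norm_minus_commute[of "x (Suc k)"] norm_minus_commute[of "y (Suc k)"] field_simps)
qed

lemma energy_aggregate_step:
  assumes "k \<ge> 1"
  shows "energy (xag (k + 1) - u) (yag (k + 1) - w)
    \<le> (1 - inverse (\<beta> k)) * energy (xag k - u) (yag k - w) + inverse (\<beta> k) * energy (x (k + 1) - u) (y (k + 1) - w)"
proof -
  have *: "xag (k + 1) - u = (1 - inverse (\<beta> k)) *\<^sub>R (xag k - u) + inverse (\<beta> k) *\<^sub>R (x (k + 1) - u)"
    "yag (k + 1) - w = (1 - inverse (\<beta> k)) *\<^sub>R (yag k - w) + inverse (\<beta> k) *\<^sub>R (y (k + 1) - w)"
    unfolding xag[OF assms] yag[OF assms] by (simp_all add: algebra_simps)
  show ?thesis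
    unfolding * using inverse_\<beta>_bounds[OF assms] by (intro energy_convex) auto
qed

definition Nx :: "nat \<Rightarrow> 'a" where "Nx k = (\<Sum>i=1..k. \<eta> i *\<^sub>R dx i)"
definition Ny :: "nat \<Rightarrow> 'b" where "Ny k = (\<Sum>i=1..k. \<eta> i *\<^sub>R dy i)"

text \<open>
The gradient, up to the sign and the weight \<open>\<beta> k * \<eta> k\<close>, of the affine function of \<open>(u, w)\<close> on the
right-hand side of the telescoped inequality.
\<close>
definition perturbation :: "nat \<Rightarrow> 'a \<times> 'b" where
  "perturbation k = (1 / (\<beta> k * \<eta> k)) *\<^sub>R
    (x1 - x (k + 1) - Nx k, r *\<^sub>R (y1 - y (k + 1)) - Ny k - \<eta> k *\<^sub>R K (x (k + 1) - x k))"

lemma noise_shift: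
  "(\<Sum>i=1..k. noise i (dx i) (dy i) (x i - u) (y i - w)) =
   (\<Sum>i=1..k. noise i (dx i) (dy i) (x i - u') (y i - w')) + Nx k \<bullet> (u - u') + Ny k \<bullet> (w - w')"
  by (simp add: Nx_def Ny_def noise_def inner_sum_left inner_diff_right algebra_simps
      flip: sum.distrib sum_subtractf)

text \<open>
Subtracting the perturbation replaces the arbitrary point \<open>(u, w)\<close> by the aggregate, at which the
affine function takes a value that does not depend on \<open>(u, w)\<close>.
\<close>
lemma perturbed_gap_bound:
  assumes u: "u \<in> X" and w: "w \<in> Y" and k: "k \<ge> 1"
  shows "\<eta> k * \<beta> k * (Q (k + 1) u w - perturbation k \<bullet> ((xag (k + 1), yag (k + 1)) - (u, w))) \<le>
    (norm (xag (k + 1) - x1))\<^sup>2 / 2 + r / 2 * (norm (yag (k + 1) - y1))\<^sup>2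
    + (\<Sum>i=1..k. noise i (dx i) (dy i) (x i - xag (k + 1)) (y i - yag (k + 1)))"
proof -
  let ?x = "x (k + 1)" and ?y = "y (k + 1)" and ?a = "xag (k + 1)" and ?b = "yag (k + 1)"
  have pos: "\<eta> k > 0" "\<beta> k > 0"
    using stepsizes_pos(1)[OF k] \<beta>_ge_1[OF k] by auto
  have v: "\<eta> k * \<beta> k * (perturbation k \<bullet> ((?a, ?b) - (u, w))) =
      (x1 - ?x) \<bullet> (?a - u) - Nx k \<bullet> (?a - u)
      + r * ((y1 - ?y) \<bullet> (?b - w)) - Ny k \<bullet> (?b - w) - \<eta> k * (K (?x - x k) \<bullet> (?b - w))"
    using pos by (simp add: perturbation_def inner_diff_left del: inner_diff_right) (simp add: field_simps)
  have sx: "((norm (u - x1))\<^sup>2 - (norm (u - ?x))\<^sup>2) / 2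
      = ((norm (?a - x1))\<^sup>2 - (norm (?a - ?x))\<^sup>2) / 2 + (x1 - ?x) \<bullet> (?a - u)"
    by (simp add: power2_norm_eq_inner inner_diff_left inner_diff_right inner_commute field_simps)
  have sq: "((norm (w - y1))\<^sup>2 - (norm (w - ?y))\<^sup>2)
      = ((norm (?b - y1))\<^sup>2 - (norm (?b - ?y))\<^sup>2) + 2 * ((y1 - ?y) \<bullet> (?b - w))"
    by (simp add: power2_norm_eq_inner inner_diff_left inner_diff_right inner_commute)
  have sy: "r / 2 * ((norm (w - y1))\<^sup>2 - (norm (w - ?y))\<^sup>2)
      = r / 2 * (norm (?b - y1))\<^sup>2 - r / 2 * (norm (?b - ?y))\<^sup>2 + r * ((y1 - ?y) \<bullet> (?b - w))"
    unfolding sq by (simp add: distrib_left right_diff_distrib del: inner_diff_left inner_diff_right)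
  have "- (\<eta> k * (K (?x - x k) \<bullet> (?y - ?b)))
      \<le> \<eta> k * \<tau> k * (onorm K)\<^sup>2 / (2 * p) * (norm (?x - x k))\<^sup>2 + p * r / 2 * (norm (?b - ?y))\<^sup>2"
    using extrapolation_bound[OF k, of "?x - x k" "?b - ?y"]
    by (simp add: inner_diff_right algebra_simps)
  moreover have "p * r / 2 * (norm (?b - ?y))\<^sup>2 \<le> r / 2 * (norm (?b - ?y))\<^sup>2"
    using pq r_pos by (intro mult_right_mono) auto
  moreover have "\<eta> k * (K (?x - x k) \<bullet> (?y - w)) = \<eta> k * (K (?x - x k) \<bullet> (?y - ?b)) + \<eta> k * (K (?x - x k) \<bullet> (?b - w))"
    by (simp add: inner_diff_right algebra_simps)
  moreover have "Nx k \<bullet> (u - ?a) = - (Nx k \<bullet> (?a - u))" "Ny k \<bullet> (w - ?b) = - (Ny k \<bullet> (?b - w))"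
    by (simp_all add: inner_diff_right)
  moreover have "0 \<le> (norm (?a - ?x))\<^sup>2" by simp
  moreover have "((norm (?a - x1))\<^sup>2 - (norm (?a - ?x))\<^sup>2) / 2 \<le> (norm (?a - x1))\<^sup>2 / 2"
    by simp
  ultimately have "\<eta> k * \<beta> k * Q (k + 1) u w - \<eta> k * \<beta> k * (perturbation k \<bullet> ((?a, ?b) - (u, w))) \<le>
      (norm (?a - x1))\<^sup>2 / 2 + r / 2 * (norm (?b - y1))\<^sup>2
      + (\<Sum>i=1..k. noise i (dx i) (dy i) (x i - ?a) (y i - ?b))"
    using telescoped_gap[OF u w k] noise_shift[of u w k ?a ?b] v sx sy by linarith
  then show ?thesis
    by (simp add: right_diff_distrib)
qed

text \<open>
The reference point is moved from the aggregate to a fixed point \<open>(xh, yh)\<close>, so that the remaining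
noise has mean zero up to the squares: the aggregate depends on all samples, a fixed point does not.
The price is the pairing of the error sums with the distance to the aggregate; the weight in Young's
inequality is \<open>1\<close> on the primal and \<open>(1 - p) * r\<close> on the dual side to reproduce the energy.
\<close>
lemma perturbed_gap_le:
  fixes xh :: 'a and yh :: 'b
  assumes u: "u \<in> X" and w: "w \<in> Y" and k: "k \<ge> 1"
  shows "Q (k + 1) u w - perturbation k \<bullet> ((xag (k + 1), yag (k + 1)) - (u, w)) \<le> 1 / (\<beta> k * \<eta> k) *
    ((norm (xh - x1))\<^sup>2 + r * (norm (yh - y1))\<^sup>2 + (1 / (1 - p) + 1 / 2) * energy (xag (k + 1) - xh) (yag (k + 1) - yh)
    + (norm (Nx k))\<^sup>2 / 2 + 1 / (2 * ((1 - p) * r)) * (norm (Ny k))\<^sup>2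
    + (\<Sum>i=1..k. noise i (dx i) (dy i) (x i - xh) (y i - yh)))"
proof -
  let ?a = "xag (k + 1)" and ?b = "yag (k + 1)"
  have pos: "\<eta> k > 0" "\<beta> k > 0"
    using stepsizes_pos(1)[OF k] \<beta>_ge_1[OF k] by auto
  have c: "(1 - p) * r > 0" using pq r_pos by simp
  have "(norm (?a - x1))\<^sup>2 / 2 \<le> (norm (?a - xh))\<^sup>2 + (norm (xh - x1))\<^sup>2"
    using norm_sum_square_le[of "?a - xh" "xh - x1"] by simp
  moreover have "r * ((norm (?b - y1))\<^sup>2 / 2) \<le> r * ((norm (?b - yh))\<^sup>2 + (norm (yh - y1))\<^sup>2)"
    using norm_sum_square_le[of "?b - yh" "yh - y1"] r_pos by (intro mult_left_mono) auto
  moreover have "(norm (?a - xh))\<^sup>2 + r * (norm (?b - yh))\<^sup>2 \<le> 1 / (1 - p) * energy (?a - xh) (?b - yh)"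
  proof -
    have "(1 - p) * ((norm (?a - xh))\<^sup>2 + r * (norm (?b - yh))\<^sup>2) \<le> energy (?a - xh) (?b - yh)"
      using pq by (simp add: energy_def algebra_simps)
    then show ?thesis using pq by (simp add: field_simps)
  qed
  moreover have "Nx k \<bullet> (?a - xh) \<le> (norm (?a - xh))\<^sup>2 / 2 + (norm (Nx k))\<^sup>2 / 2"
    using inner_young[of 1 "?a - xh" "Nx k"] by (simp add: inner_commute)
  moreover have "Ny k \<bullet> (?b - yh) \<le> (1 - p) * r / 2 * (norm (?b - yh))\<^sup>2 + 1 / (2 * ((1 - p) * r)) * (norm (Ny k))\<^sup>2"
    using inner_young[OF c, of "?b - yh" "Ny k"] by (simp add: inner_commute)
  moreover have "(1 / (1 - p) + 1 / 2) * energy (?a - xh) (?b - yh)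
      = 1 / (1 - p) * energy (?a - xh) (?b - yh) + (norm (?a - xh))\<^sup>2 / 2 + (1 - p) * r / 2 * (norm (?b - yh))\<^sup>2"
    unfolding distrib_right by (simp add: energy_def)
  ultimately have "\<eta> k * \<beta> k * (Q (k + 1) u w - perturbation k \<bullet> ((?a, ?b) - (u, w))) \<le>
    (norm (xh - x1))\<^sup>2 + r * (norm (yh - y1))\<^sup>2 + (1 / (1 - p) + 1 / 2) * energy (?a - xh) (?b - yh)
    + (norm (Nx k))\<^sup>2 / 2 + 1 / (2 * ((1 - p) * r)) * (norm (Ny k))\<^sup>2
    + (\<Sum>i=1..k. noise i (dx i) (dy i) (x i - xh) (y i - yh))"
    using perturbed_gap_bound[OF u w k] noise_shift[of ?a ?b k xh yh]
    by (simp add: distrib_left)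
  then show ?thesis
    using pos by (simp add: field_simps del: inner_diff_right)
qed

lemma norm_perturbation_le:
  assumes k: "k \<ge> 1"
  shows "norm (perturbation k) \<le> 1 / (\<beta> k * \<eta> k) *
    (norm (u - x1) + norm (x (k + 1) - u) + norm (Nx k)
     + r * (norm (w - y1) + norm (y (k + 1) - w)) + norm (Ny k)
     + \<eta> k * onorm K * (norm (x (k + 1) - u) + norm (x k - u)))"
proof -
  let ?x = "x (k + 1)" and ?y = "y (k + 1)"
  let ?p = "x1 - ?x - Nx k" and ?q = "r *\<^sub>R (y1 - ?y) - Ny k - \<eta> k *\<^sub>R K (?x - x k)"
  have pos: "\<eta> k > 0" "\<beta> k > 0"
    using stepsizes_pos(1)[OF k] \<beta>_ge_1[OF k] by auto
  have tri: "norm (a - b) \<le> norm (c - a) + norm (b - c)" for a b c :: "'c::real_normed_vector"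
    using norm_triangle_ineq[of "a - c" "c - b"] by (simp add: norm_minus_commute)
  have "norm ?p \<le> norm (u - x1) + norm (?x - u) + norm (Nx k)"
    using norm_triangle_ineq4[of "x1 - ?x" "Nx k"] tri[of x1 ?x u] by linarith
  moreover have "norm ?q \<le> r * (norm (w - y1) + norm (?y - w)) + norm (Ny k)
      + \<eta> k * onorm K * (norm (?x - u) + norm (x k - u))"
  proof -
    have "norm (r *\<^sub>R (y1 - ?y)) \<le> r * (norm (w - y1) + norm (?y - w))"
      using r_pos tri[of y1 ?y w] by (simp add: mult_left_mono)
    moreover have "norm (\<eta> k *\<^sub>R K (?x - x k)) \<le> \<eta> k * onorm K * (norm (?x - u) + norm (x k - u))"
    proof -
      have "norm (?x - x k) \<le> norm (?x - u) + norm (x k - u)"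
        using tri[of ?x "x k" u] by (simp add: norm_minus_commute)
      then have "norm (K (?x - x k)) \<le> onorm K * (norm (?x - u) + norm (x k - u))"
        using norm_K_le[of "?x - x k"] onorm_K_nonneg by (meson mult_left_mono order_trans)
      then have "\<eta> k * norm (K (?x - x k)) \<le> \<eta> k * (onorm K * (norm (?x - u) + norm (x k - u)))"
        using pos by (intro mult_left_mono) auto
      then show ?thesis using pos by (simp add: mult.assoc)
    qed
    ultimately show ?thesis
      using norm_triangle_ineq4[of "r *\<^sub>R (y1 - ?y) - Ny k" "\<eta> k *\<^sub>R K (?x - x k)"]
        norm_triangle_ineq4[of "r *\<^sub>R (y1 - ?y)" "Ny k"] by linarith
  qed
  moreover have "norm (?p, ?q) \<le> norm ?p + norm ?q"
    by (rule norm_Pair_le)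
  ultimately have "norm (?p, ?q) \<le> norm (u - x1) + norm (?x - u) + norm (Nx k)
     + r * (norm (w - y1) + norm (?y - w)) + norm (Ny k)
     + \<eta> k * onorm K * (norm (?x - u) + norm (x k - u))"
    by linarith
  then have "1 / (\<beta> k * \<eta> k) * norm (?p, ?q) \<le> 1 / (\<beta> k * \<eta> k) * \<dots>"
    using pos by (intro mult_left_mono) auto
  moreover have "norm (perturbation k) = 1 / (\<beta> k * \<eta> k) * norm (?p, ?q)"
    unfolding perturbation_def using pos by (subst norm_scaleR) simp
  ultimately show ?thesis by simp
qed

end

section \<open>Square-integrable random vectors\<close>

definition square_integrable :: "'w measure \<Rightarrow> ('w \<Rightarrow> 'a::euclidean_space) \<Rightarrow> bool" where
  "square_integrable M f \<longleftrightarrow> f \<in> borel_measurable M \<and> integrable M (\<lambda>\<omega>. (norm (f \<omega>))\<^sup>2)"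

lemma square_integrableD:
  assumes "square_integrable M f"
  shows "f \<in> borel_measurable M" "integrable M (\<lambda>\<omega>. (norm (f \<omega>))\<^sup>2)"
  using assms by (auto simp: square_integrable_def)

lemma square_integrable_add:
  assumes "square_integrable M f" "square_integrable M g"
  shows "square_integrable M (\<lambda>\<omega>. f \<omega> + g \<omega>)"
  unfolding square_integrable_def
proof
  note [measurable] = square_integrableD(1)[OF assms(1)] square_integrableD(1)[OF assms(2)]
  show "(\<lambda>\<omega>. f \<omega> + g \<omega>) \<in> borel_measurable M" by measurable
  show "integrable M (\<lambda>\<omega>. (norm (f \<omega> + g \<omega>))\<^sup>2)"
  proof (rule Bochner_Integration.integrable_bound)
    show "integrable M (\<lambda>\<omega>. 2 * (norm (f \<omega>))\<^sup>2 + 2 * (norm (g \<omega>))\<^sup>2)"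
      using assms by (auto simp: square_integrable_def)
  qed (auto simp: norm_sum_square_le)
qed

lemma square_integrable_linear:
  assumes "square_integrable M f" "linear h"
  shows "square_integrable M (\<lambda>\<omega>. h (f \<omega>))"
  unfolding square_integrable_def
proof
  have h: "bounded_linear h" using assms(2) by (simp add: linear_conv_bounded_linear)
  have [measurable]: "h \<in> borel_measurable borel"
    using h by (intro borel_measurable_continuous_onI linear_continuous_on)
  note [measurable] = square_integrableD(1)[OF assms(1)]
  show "(\<lambda>\<omega>. h (f \<omega>)) \<in> borel_measurable M" by measurable
  show "integrable M (\<lambda>\<omega>. (norm (h (f \<omega>)))\<^sup>2)"
  proof (rule Bochner_Integration.integrable_bound)
    show "integrable M (\<lambda>\<omega>. (onorm h)\<^sup>2 * (norm (f \<omega>))\<^sup>2)"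
      using assms by (auto simp: square_integrable_def)
    show "AE \<omega> in M. norm ((norm (h (f \<omega>)))\<^sup>2) \<le> norm ((onorm h)\<^sup>2 * (norm (f \<omega>))\<^sup>2)"
      using onorm[OF h] by (intro AE_I2) (simp flip: power_mult_distrib add: power_mono)
  qed measurable
qed

lemma square_integrable_scaleR:
  "square_integrable M f \<Longrightarrow> square_integrable M (\<lambda>\<omega>. c *\<^sub>R f \<omega>)"
  by (rule square_integrable_linear[OF _ bounded_linear.linear[OF bounded_linear_scaleR_right]])

lemma square_integrable_minus:
  "square_integrable M f \<Longrightarrow> square_integrable M (\<lambda>\<omega>. - f \<omega>)"
  using square_integrable_scaleR[of M f "-1"] by simp

lemma square_integrable_diff:
  "square_integrable M f \<Longrightarrow> square_integrable M g \<Longrightarrow> square_integrable M (\<lambda>\<omega>. f \<omega> - g \<omega>)"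
  using square_integrable_add[OF _ square_integrable_minus, of M f g] by simp

lemma (in prob_space) square_integrable_const: "square_integrable M (\<lambda>_. c)"
  by (simp add: square_integrable_def)

lemma square_integrable_cong:
  assumes "square_integrable M g" "\<And>\<omega>. \<omega> \<in> space M \<Longrightarrow> f \<omega> = g \<omega>"
  shows "square_integrable M f"
proof -
  have "f \<in> borel_measurable M"
    using square_integrableD(1)[OF assms(1)] by (subst measurable_cong[OF assms(2)]) auto
  moreover have "integrable M (\<lambda>\<omega>. (norm (f \<omega>))\<^sup>2)"
    using square_integrableD(2)[OF assms(1)] assms(2)
    by (subst Bochner_Integration.integrable_cong[where g = "\<lambda>\<omega>. (norm (g \<omega>))\<^sup>2"]) auto
  ultimately show ?thesis by (simp add: square_integrable_def)
qed

lemma (in prob_space) square_integrable_deterministic: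
  "(\<And>\<omega>. \<omega> \<in> space M \<Longrightarrow> f \<omega> = c) \<Longrightarrow> square_integrable M f"
  by (rule square_integrable_cong[OF square_integrable_const])

lemma (in prob_space)
  assumes "integrable M f" "integrable M g" "integrable M h" "integrable M l"
  shows affine_combination_integrable:
      "integrable M (\<lambda>\<omega>. c * (d + a * f \<omega> + g \<omega> / 2 + b * h \<omega> + l \<omega>) :: real)"
    and affine_combination_expectation: "expectation (\<lambda>\<omega>. c * (d + a * f \<omega> + g \<omega> / 2 + b * h \<omega> + l \<omega>))
      = c * (d + a * expectation f + expectation g / 2 + b * expectation h + expectation l)"
  using assms by (simp_all add: prob_space)

lemma (in prob_space) square_integrable_sum:
  "(\<And>i. i \<in> I \<Longrightarrow> square_integrable M (f i)) \<Longrightarrow> square_integrable M (\<lambda>\<omega>. \<Sum>i\<in>I. f i \<omega>)"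
  by (induction I rule: infinite_finite_induct) (auto intro: square_integrable_add square_integrable_const)

lemma square_integrable_bound:
  assumes "g \<in> borel_measurable M" "integrable M f" "\<And>\<omega>. \<omega> \<in> space M \<Longrightarrow> (norm (g \<omega>))\<^sup>2 \<le> f \<omega>"
  shows "square_integrable M g"
  unfolding square_integrable_def
proof
  note [measurable] = assms(1)
  show "integrable M (\<lambda>\<omega>. (norm (g \<omega>))\<^sup>2)"
    by (rule Bochner_Integration.integrable_bound[OF assms(2)]) (use assms(3) in \<open>auto intro!: AE_I2 order_trans[OF _ abs_ge_self]\<close>)
qed fact

lemma integrable_inner_of_square_integrable:
  assumes "square_integrable M f" "square_integrable M g"
  shows "integrable M (\<lambda>\<omega>. f \<omega> \<bullet> g \<omega>)"
proof (rule Bochner_Integration.integrable_bound)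
  note [measurable] = square_integrableD(1)[OF assms(1)] square_integrableD(1)[OF assms(2)]
  show "integrable M (\<lambda>\<omega>. (norm (f \<omega>))\<^sup>2 + (norm (g \<omega>))\<^sup>2)"
    using assms by (auto simp: square_integrable_def)
  show "(\<lambda>\<omega>. f \<omega> \<bullet> g \<omega>) \<in> borel_measurable M" by measurable
  have "\<bar>a \<bullet> b\<bar> \<le> (norm a)\<^sup>2 + (norm b)\<^sup>2" for a b :: 'b
    using inner_young[of 1 a b] inner_young[of 1 "- a" b] by (simp add: abs_le_iff)
  then show "AE \<omega> in M. norm (f \<omega> \<bullet> g \<omega>) \<le> norm ((norm (f \<omega>))\<^sup>2 + (norm (g \<omega>))\<^sup>2)"
    by (intro AE_I2) simp
qed

lemma (in prob_space)
  assumes "square_integrable M f"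
  shows integrable_norm_of_square_integrable: "integrable M (\<lambda>\<omega>. norm (f \<omega>))"
    and integral_norm_le_sqrt: "expectation (\<lambda>\<omega>. (norm (f \<omega>))\<^sup>2) \<le> c \<Longrightarrow> expectation (\<lambda>\<omega>. norm (f \<omega>)) \<le> sqrt c"
proof -
  note [measurable] = square_integrableD(1)[OF assms]
  note sq = square_integrableD(2)[OF assms]
  show int: "integrable M (\<lambda>\<omega>. norm (f \<omega>))"
    by (rule square_integrable_imp_integrable[OF _ sq]) measurable
  show "expectation (\<lambda>\<omega>. norm (f \<omega>)) \<le> sqrt c" if "expectation (\<lambda>\<omega>. (norm (f \<omega>))\<^sup>2) \<le> c"
  proof (rule real_le_rsqrt)
    have "0 \<le> variance (\<lambda>\<omega>. norm (f \<omega>))" by (rule variance_positive)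
    also have "\<dots> = expectation (\<lambda>\<omega>. (norm (f \<omega>))\<^sup>2) - (expectation (\<lambda>\<omega>. norm (f \<omega>)))\<^sup>2"
      by (rule variance_eq[OF int sq])
    finally show "(expectation (\<lambda>\<omega>. norm (f \<omega>)))\<^sup>2 \<le> c" using that by simp
  qed
qed

lemma (in prob_space) expectation_norm_sq_add_orthogonal:
  assumes f: "square_integrable M f" and g: "square_integrable M g"
    and "expectation (\<lambda>\<omega>. f \<omega> \<bullet> g \<omega>) = 0"
  shows "expectation (\<lambda>\<omega>. (norm (f \<omega> + g \<omega>))\<^sup>2)
    = expectation (\<lambda>\<omega>. (norm (f \<omega>))\<^sup>2) + expectation (\<lambda>\<omega>. (norm (g \<omega>))\<^sup>2)"
proof -
  have "(\<lambda>\<omega>. (norm (f \<omega> + g \<omega>))\<^sup>2) = (\<lambda>\<omega>. (norm (f \<omega>))\<^sup>2 + (norm (g \<omega>))\<^sup>2 + 2 * (f \<omega> \<bullet> g \<omega>))"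
    by (auto simp: power2_norm_eq_inner inner_add_left inner_add_right inner_commute)
  then show ?thesis
    using assms integrable_inner_of_square_integrable[OF f g]
    by (simp add: square_integrable_def)
qed

section \<open>Oracle errors given the past\<close>

text \<open>
A sub-\<open>\<sigma>\<close>-algebra \<open>H\<close>, encoded as a measure space of which only the measurable sets matter, that is
independent of a sample \<open>\<xi>\<close> with distribution \<open>P\<close>.  Independence is expressed by events because
functions of the history and the sample may have values in different types.
\<close>
definition (in prob_space) oracle_history where
  "oracle_history H P \<xi> \<longleftrightarrow> space H = space M \<and> sets H \<subseteq> events \<and> \<xi> \<in> M \<rightarrow>\<^sub>M P \<and> distr M P \<xi> = P \<and>
     indep_set (sets H) (sigma_sets (space M) {\<xi> -` B \<inter> space M | B. B \<in> sets P})"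

lemma (in prob_space) oracle_history_measurable:
  "oracle_history H P \<xi> \<Longrightarrow> f \<in> H \<rightarrow>\<^sub>M N \<Longrightarrow> f \<in> M \<rightarrow>\<^sub>M N"
  unfolding oracle_history_def by (auto intro: measurable_mono[THEN subsetD, of N N H M])

lemma (in prob_space) oracle_history_joint_distr:
  assumes H: "oracle_history H P \<xi>" and P: "prob_space P" and V: "V \<in> H \<rightarrow>\<^sub>M N"
  shows "distr M N V \<Otimes>\<^sub>M P = distr M (N \<Otimes>\<^sub>M P) (\<lambda>\<omega>. (V \<omega>, \<xi> \<omega>))"
proof (rule pair_measure_eqI)
  have xi[measurable]: "\<xi> \<in> M \<rightarrow>\<^sub>M P" and dP: "distr M P \<xi> = P" and spH: "space H = space M"
    and ind: "indep_set (sets H) (sigma_sets (space M) {\<xi> -` B \<inter> space M | B. B \<in> sets P})"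
    using H by (auto simp: oracle_history_def)
  have V'[measurable]: "V \<in> M \<rightarrow>\<^sub>M N"
    by (rule oracle_history_measurable[OF H V])
  show "sigma_finite_measure (distr M N V)"
    by (intro prob_space_imp_sigma_finite prob_space_distr V')
  show "sigma_finite_measure P"
    by (intro prob_space_imp_sigma_finite P)
  fix A B assume A: "A \<in> sets (distr M N V)" and B: "B \<in> sets P"
  have vA: "V -` A \<inter> space M \<in> sets H"
    using measurable_sets[OF V, of A] A spH by simp
  have xB: "\<xi> -` B \<inter> space M \<in> sigma_sets (space M) {\<xi> -` B \<inter> space M | B. B \<in> sets P}"
    using B by auto
  have "emeasure P B = emeasure (distr M P \<xi>) B" by (simp add: dP)
  also have "\<dots> = emeasure M (\<xi> -` B \<inter> space M)"
    using B by (simp add: emeasure_distr)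
  finally have "emeasure (distr M N V) A * emeasure P B
      = emeasure M (V -` A \<inter> space M) * emeasure M (\<xi> -` B \<inter> space M)"
    using A by (simp add: emeasure_distr)
  also have "\<dots> = emeasure M ((V -` A \<inter> space M) \<inter> (\<xi> -` B \<inter> space M))"
    using indep_setD[OF ind vA xB] by (simp add: emeasure_eq_measure ennreal_mult)
  also have "(V -` A \<inter> space M) \<inter> (\<xi> -` B \<inter> space M) = (\<lambda>\<omega>. (V \<omega>, \<xi> \<omega>)) -` (A \<times> B) \<inter> space M"
    by auto
  also have "emeasure M \<dots> = emeasure (distr M (N \<Otimes>\<^sub>M P) (\<lambda>\<omega>. (V \<omega>, \<xi> \<omega>))) (A \<times> B)"
    using A B by (subst emeasure_distr) auto
  finally show "emeasure (distr M N V) A * emeasure P B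
      = emeasure (distr M (N \<Otimes>\<^sub>M P) (\<lambda>\<omega>. (V \<omega>, \<xi> \<omega>))) (A \<times> B)" .
qed simp

lemma unbiased_mean_measurable:
  fixes F :: "'u::euclidean_space \<Rightarrow> 's \<Rightarrow> 'v::euclidean_space"
  assumes P: "prob_space P" and F: "unbiased_estimator P A F m"
  shows "m \<in> borel_measurable (restrict_space borel A)"
proof -
  interpret P: prob_space P by fact
  have [measurable]: "(\<lambda>(u, s). F u s) \<in> borel_measurable (restrict_space borel A \<Otimes>\<^sub>M P)"
    and F_mean: "\<And>u. u \<in> A \<Longrightarrow> (\<integral>s. F u s \<partial>P) = m u"
    using F by (auto simp: unbiased_estimator_def)
  have "(\<lambda>u. \<integral>s. F u s \<partial>P) \<in> borel_measurable (restrict_space borel A)"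
    by measurable
  then show ?thesis
    by (rule measurable_cong[THEN iffD1, rotated]) (auto simp: F_mean space_restrict_space)
qed

text \<open>
Query point and weight are functions of the history, so their joint distribution with the sample is
a product and Fubini's theorem applies: for a fixed query point the error has mean zero and variance
at most \<open>\<sigma>\<^sup>2\<close>.
\<close>
lemma (in prob_space)
  fixes F :: "'u::euclidean_space \<Rightarrow> 's \<Rightarrow> 'v::euclidean_space"
  assumes P: "prob_space P" and H: "oracle_history H P \<xi>"
    and F: "unbiased_estimator P A F m" "variance_bounded P A F m \<sigma>"
    and U: "U \<in> borel_measurable H" "\<And>\<omega>. \<omega> \<in> space M \<Longrightarrow> U \<omega> \<in> A"
  shows oracle_error_square_integrable:
      "square_integrable M (\<lambda>\<omega>. F (U \<omega>) (\<xi> \<omega>) - m (U \<omega>))" (is ?sq)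
    and oracle_error_variance: "expectation (\<lambda>\<omega>. (norm (F (U \<omega>) (\<xi> \<omega>) - m (U \<omega>)))\<^sup>2) \<le> \<sigma>\<^sup>2" (is ?var)
    and oracle_error_mean_zero: "W \<in> borel_measurable H \<Longrightarrow> square_integrable M W \<Longrightarrow>
      expectation (\<lambda>\<omega>. W \<omega> \<bullet> (F (U \<omega>) (\<xi> \<omega>) - m (U \<omega>))) = 0"
proof -
  interpret P: prob_space P by fact
  let ?A = "restrict_space borel A"
  have F_meas[measurable]: "(\<lambda>(u, s). F u s) \<in> borel_measurable (?A \<Otimes>\<^sub>M P)"
    and F_int: "\<And>u. u \<in> A \<Longrightarrow> integrable P (F u)" and F_mean: "\<And>u. u \<in> A \<Longrightarrow> (\<integral>s. F u s \<partial>P) = m u"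
    using F(1) by (auto simp: unbiased_estimator_def)
  have F_var_int: "\<And>u. u \<in> A \<Longrightarrow> integrable P (\<lambda>s. (norm (F u s - m u))\<^sup>2)"
    and F_var: "\<And>u. u \<in> A \<Longrightarrow> (\<integral>s. (norm (F u s - m u))\<^sup>2 \<partial>P) \<le> \<sigma>\<^sup>2"
    using F(2) by (auto simp: variance_bounded_def dual_norm_eq_norm)
  note [measurable] = unbiased_mean_measurable[OF P F(1)]
  have main: "?sq \<and> ?var \<and> (square_integrable M W \<longrightarrow> expectation (\<lambda>\<omega>. W \<omega> \<bullet> (F (U \<omega>) (\<xi> \<omega>) - m (U \<omega>))) = 0)"
    if W: "W \<in> borel_measurable H" for W :: "'a \<Rightarrow> 'v"
  proof -
    define N where "N = ?A \<Otimes>\<^sub>M (borel :: 'v measure)"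
    define V where "V = (\<lambda>\<omega>. (U \<omega>, W \<omega>))"
    have spH: "space H = space M" using H by (simp add: oracle_history_def)
    have "U \<in> H \<rightarrow>\<^sub>M ?A"
      using U spH by (intro measurable_restrict_space2) auto
    then have VH: "V \<in> H \<rightarrow>\<^sub>M N"
      using W unfolding V_def N_def by measurable
    have V[measurable]: "V \<in> M \<rightarrow>\<^sub>M N" and xi[measurable]: "\<xi> \<in> M \<rightarrow>\<^sub>M P"
      using oracle_history_measurable[OF H VH] H by (auto simp: oracle_history_def)
    have W'[measurable]: "W \<in> borel_measurable M"
      using oracle_history_measurable[OF H W] .
    define R where "R = distr M N V \<Otimes>\<^sub>M P"
    have R: "R = distr M (N \<Otimes>\<^sub>M P) (\<lambda>\<omega>. (V \<omega>, \<xi> \<omega>))"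
      unfolding R_def by (rule oracle_history_joint_distr[OF H P VH])
    interpret D: prob_space "distr M N V" by (rule prob_space_distr) fact
    interpret DP: pair_sigma_finite "distr M N V" P ..
    define e where "e = (\<lambda>(z :: 'u \<times> 'v, s). F (fst z) s - m (fst z))"
    have e[measurable]: "e \<in> borel_measurable (N \<Otimes>\<^sub>M P)"
    proof -
      have 1: "(\<lambda>(z :: 'u \<times> 'v, s). (fst z, s)) \<in> N \<Otimes>\<^sub>M P \<rightarrow>\<^sub>M ?A \<Otimes>\<^sub>M P"
        unfolding N_def by measurable
      have 2: "(\<lambda>(z :: 'u \<times> 'v, s). m (fst z)) \<in> borel_measurable (N \<Otimes>\<^sub>M P)"
        unfolding N_def by measurable
      show ?thesis
        using borel_measurable_diff[OF measurable_compose[OF 1 F_meas] 2]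
        by (simp add: e_def case_prod_beta)
    qed
    have err: "F (U \<omega>) (\<xi> \<omega>) - m (U \<omega>) = e (V \<omega>, \<xi> \<omega>)" for \<omega>
      by (simp add: e_def V_def)
    have spN: "fst z \<in> A" if "z \<in> space N" for z
      using that by (auto simp: N_def space_pair_measure space_restrict_space)
    have sq_nn: "(\<integral>\<^sup>+ \<omega>. ennreal ((norm (e (V \<omega>, \<xi> \<omega>)))\<^sup>2) \<partial>M) \<le> ennreal (\<sigma>\<^sup>2)"
    proof -
      have "(\<integral>\<^sup>+ \<omega>. ennreal ((norm (e (V \<omega>, \<xi> \<omega>)))\<^sup>2) \<partial>M) = (\<integral>\<^sup>+ zs. ennreal ((norm (e zs))\<^sup>2) \<partial>R)"
        unfolding R by (subst nn_integral_distr) auto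
      also have "\<dots> = (\<integral>\<^sup>+ z. \<integral>\<^sup>+ s. ennreal ((norm (e (z, s)))\<^sup>2) \<partial>P \<partial>distr M N V)"
        unfolding R_def by (subst P.nn_integral_fst[symmetric]) auto
      also have "\<dots> \<le> (\<integral>\<^sup>+ z. ennreal (\<sigma>\<^sup>2) \<partial>distr M N V)"
      proof (rule nn_integral_mono)
        fix z assume "z \<in> space (distr M N V)"
        then have z: "fst z \<in> A" using spN by simp
        show "(\<integral>\<^sup>+ s. ennreal ((norm (e (z, s)))\<^sup>2) \<partial>P) \<le> ennreal (\<sigma>\<^sup>2)"
          using nn_integral_eq_integral[OF F_var_int[OF z]] F_var[OF z]
          by (simp add: e_def ennreal_leI)
      qed
      also have "\<dots> = ennreal (\<sigma>\<^sup>2)"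
        using D.emeasure_space_1 by simp
      finally show ?thesis .
    qed
    have sq_int: "integrable M (\<lambda>\<omega>. (norm (e (V \<omega>, \<xi> \<omega>)))\<^sup>2)"
      using sq_nn by (intro integrableI_bounded) (auto simp: le_less_trans)
    then have 1: ?sq unfolding square_integrable_def err by auto
    have "ennreal (expectation (\<lambda>\<omega>. (norm (e (V \<omega>, \<xi> \<omega>)))\<^sup>2)) \<le> ennreal (\<sigma>\<^sup>2)"
      using sq_nn nn_integral_eq_integral[OF sq_int] by simp
    then have 2: ?var unfolding err by (simp add: ennreal_le_iff)
    have 3: "expectation (\<lambda>\<omega>. W \<omega> \<bullet> (F (U \<omega>) (\<xi> \<omega>) - m (U \<omega>))) = 0" if Wsq: "square_integrable M W"
    proof -
      define h where "h = (\<lambda>zs :: ('u \<times> 'v) \<times> 's. snd (fst zs) \<bullet> e zs)"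
      have h[measurable]: "h \<in> borel_measurable (N \<Otimes>\<^sub>M P)"
      proof -
        have "(\<lambda>zs :: ('u \<times> 'v) \<times> 's. snd (fst zs)) \<in> borel_measurable (N \<Otimes>\<^sub>M P)"
          unfolding N_def by measurable
        then show ?thesis unfolding h_def by (rule borel_measurable_inner) fact
      qed
      have hV: "h (V \<omega>, \<xi> \<omega>) = W \<omega> \<bullet> (F (U \<omega>) (\<xi> \<omega>) - m (U \<omega>))" for \<omega>
        by (simp add: h_def e_def V_def)
      have "integrable M (\<lambda>\<omega>. h (V \<omega>, \<xi> \<omega>))"
        unfolding hV by (rule integrable_inner_of_square_integrable[OF Wsq 1])
      then have hR: "integrable R h"
        unfolding R by (subst integrable_distr_eq) auto
      have "expectation (\<lambda>\<omega>. h (V \<omega>, \<xi> \<omega>)) = integral\<^sup>L R h"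
        unfolding R by (subst integral_distr) auto
      also have "\<dots> = (\<integral>z. \<integral>s. h (z, s) \<partial>P \<partial>distr M N V)"
        using DP.integral_fst'[OF hR[unfolded R_def]] unfolding R_def by simp
      also have "\<dots> = (\<integral>z. 0 \<partial>distr M N V)"
      proof (rule Bochner_Integration.integral_cong)
        fix z assume "z \<in> space (distr M N V)"
        then have z: "fst z \<in> A" using spN by simp
        show "(\<integral>s. h (z, s) \<partial>P) = 0"
          using F_int[OF z] F_mean[OF z] P.prob_space by (simp add: h_def e_def inner_diff_right[symmetric] del: inner_diff_right)
      qed simp
      finally show ?thesis unfolding hV by simp
    qed
    show ?thesis using 1 2 3 by blast
  qed
  show ?sq ?var using main[of "\<lambda>_. 0"] by auto
  show "W \<in> borel_measurable H \<Longrightarrow> square_integrable M W \<Longrightarrow>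
      expectation (\<lambda>\<omega>. W \<omega> \<bullet> (F (U \<omega>) (\<xi> \<omega>) - m (U \<omega>))) = 0"
    using main by blast
qed

section \<open>The random trajectory\<close>

locale stochastic_apd_run = apd_problem X Y G gradG L_G K J p q \<beta> \<theta> \<eta> \<tau> x1 y1 + prob_space M
  for X :: "'a::euclidean_space set" and Y :: "'b::euclidean_space set"
    and G gradG L_G K J p q \<beta> \<theta> \<eta> \<tau> x1 y1 and M :: "'w measure" +
  fixes P :: "'s measure"
    and GO :: "'a \<Rightarrow> 's \<Rightarrow> 'a" and KxO :: "'a \<Rightarrow> 's \<Rightarrow> 'b" and KyO :: "'b \<Rightarrow> 's \<Rightarrow> 'a"
    and \<xi> :: "evaluation \<Rightarrow> nat \<Rightarrow> 'w \<Rightarrow> 's"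
    and \<sigma>xG \<sigma>y \<sigma>xK :: real
    and x xag xmd xbar :: "nat \<Rightarrow> 'w \<Rightarrow> 'a" and y yag :: "nat \<Rightarrow> 'w \<Rightarrow> 'b"
  assumes P: "prob_space P"
    and samples_indep: "indep_vars (\<lambda>_. P) (\<lambda>(c, i). \<xi> c i) (UNIV \<times> {1..})"
    and samples_ident: "\<And>c i. i \<ge> 1 \<Longrightarrow> distr M P (\<xi> c i) = P"
    and unbiased: "unbiased_estimator P X GO gradG"
      "unbiased_estimator P UNIV KxO K"
      "unbiased_estimator P Y KyO (adjoint K)"
    and A1: "variance_bounded P X GO gradG \<sigma>xG"
      "variance_bounded P UNIV KxO K \<sigma>y"
      "variance_bounded P Y KyO (adjoint K) \<sigma>xK"
    and J_lsc: "lsc_on Y J"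
    and iterates: "\<And>\<omega>. \<omega> \<in> space M \<Longrightarrow>
      stochastic_apd X Y J \<beta> \<theta> \<eta> \<tau>
        (\<lambda>i u. GO u (\<xi> Eval_G i \<omega>)) (\<lambda>i u. KxO u (\<xi> Eval_Kx i \<omega>)) (\<lambda>i u. KyO u (\<xi> Eval_Ky i \<omega>))
        x1 y1
        (\<lambda>i. x i \<omega>) (\<lambda>i. y i \<omega>) (\<lambda>i. xag i \<omega>) (\<lambda>i. yag i \<omega>) (\<lambda>i. xmd i \<omega>) (\<lambda>i. xbar i \<omega>)"
begin

definition err_G :: "nat \<Rightarrow> 'w \<Rightarrow> 'a" where
  "err_G i \<omega> = GO (xmd i \<omega>) (\<xi> Eval_G i \<omega>) - gradG (xmd i \<omega>)"

definition err_Ky :: "nat \<Rightarrow> 'w \<Rightarrow> 'a" where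
  "err_Ky i \<omega> = KyO (y (i + 1) \<omega>) (\<xi> Eval_Ky i \<omega>) - adjoint K (y (i + 1) \<omega>)"

definition dx :: "nat \<Rightarrow> 'w \<Rightarrow> 'a" where "dx i \<omega> = err_G i \<omega> + err_Ky i \<omega>"

definition dy :: "nat \<Rightarrow> 'w \<Rightarrow> 'b" where
  "dy i \<omega> = - (KxO (xbar i \<omega>) (\<xi> Eval_Kx i \<omega>) - K (xbar i \<omega>))"

lemma updates:
  assumes "\<omega> \<in> space M" "i \<ge> 1"
  shows "is_arg_min (\<lambda>u. - KxO (xbar i \<omega>) (\<xi> Eval_Kx i \<omega>) \<bullet> u + J u + 1 / \<tau> i * eucl_div u (y i \<omega>))
          (\<lambda>u. u \<in> Y) (y (i + 1) \<omega>)"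
    and "is_arg_min (\<lambda>u. (GO (xmd i \<omega>) (\<xi> Eval_G i \<omega>) + KyO (y (i + 1) \<omega>) (\<xi> Eval_Ky i \<omega>)) \<bullet> u
      + 1 / \<eta> i * eucl_div u (x i \<omega>)) (\<lambda>u. u \<in> X) (x (i + 1) \<omega>)"
proof -
  note run = iterates[OF assms(1), unfolded stochastic_apd_def]
  show "is_arg_min (\<lambda>u. - KxO (xbar i \<omega>) (\<xi> Eval_Kx i \<omega>) \<bullet> u + J u + 1 / \<tau> i * eucl_div u (y i \<omega>))
          (\<lambda>u. u \<in> Y) (y (i + 1) \<omega>)"
    using run assms(2) by blast
  have "(a + b) \<bullet> u = a \<bullet> u + u \<bullet> b" for a b u :: 'a
    by (subst inner_commute[of u b]) (rule inner_add_left)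
  moreover have "is_arg_min (\<lambda>u. GO (xmd i \<omega>) (\<xi> Eval_G i \<omega>) \<bullet> u + u \<bullet> KyO (y (i + 1) \<omega>) (\<xi> Eval_Ky i \<omega>)
      + 1 / \<eta> i * eucl_div u (x i \<omega>)) (\<lambda>u. u \<in> X) (x (i + 1) \<omega>)"
    using run assms(2) by blast
  ultimately show "is_arg_min (\<lambda>u. (GO (xmd i \<omega>) (\<xi> Eval_G i \<omega>) + KyO (y (i + 1) \<omega>) (\<xi> Eval_Ky i \<omega>)) \<bullet> u
      + 1 / \<eta> i * eucl_div u (x i \<omega>)) (\<lambda>u. u \<in> X) (x (i + 1) \<omega>)"
    by (simp only:)
qed

lemma path:
  assumes "\<omega> \<in> space M"
  shows "perturbed_apd X Y G gradG L_G K J p q \<beta> \<theta> \<eta> \<tau> x1 y1 (\<lambda>i. dx i \<omega>) (\<lambda>i. dy i \<omega>)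
    (\<lambda>i. x i \<omega>) (\<lambda>i. xag i \<omega>) (\<lambda>i. xmd i \<omega>) (\<lambda>i. xbar i \<omega>) (\<lambda>i. y i \<omega>) (\<lambda>i. yag i \<omega>)"
proof unfold_locales
  note run = iterates[OF assms, unfolded stochastic_apd_def]
  show "x 1 \<omega> = x1" "y 1 \<omega> = y1" "xag 1 \<omega> = x1" "yag 1 \<omega> = y1" "xbar 1 \<omega> = x1"
    using run by blast+
  fix i :: nat assume i: "1 \<le> i"
  show "xmd i \<omega> = (1 - inverse (\<beta> i)) *\<^sub>R xag i \<omega> + inverse (\<beta> i) *\<^sub>R x i \<omega>"
    "xag (i + 1) \<omega> = (1 - inverse (\<beta> i)) *\<^sub>R xag i \<omega> + inverse (\<beta> i) *\<^sub>R x (i + 1) \<omega>"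
    "yag (i + 1) \<omega> = (1 - inverse (\<beta> i)) *\<^sub>R yag i \<omega> + inverse (\<beta> i) *\<^sub>R y (i + 1) \<omega>"
    "xbar (i + 1) \<omega> = \<theta> (i + 1) *\<^sub>R (x (i + 1) \<omega> - x i \<omega>) + x (i + 1) \<omega>"
    using run i by blast+
  show "is_arg_min (\<lambda>u. (dy i \<omega> - K (xbar i \<omega>)) \<bullet> u + J u + 1 / \<tau> i * eucl_div u (y i \<omega>))
          (\<lambda>u. u \<in> Y) (y (i + 1) \<omega>)"
    using updates(1)[OF assms i] by (simp add: dy_def)
  have "gradG (xmd i \<omega>) + adjoint K (y (i + 1) \<omega>) + dx i \<omega>
      = GO (xmd i \<omega>) (\<xi> Eval_G i \<omega>) + KyO (y (i + 1) \<omega>) (\<xi> Eval_Ky i \<omega>)"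
    by (simp add: dx_def err_G_def err_Ky_def)
  then show "is_arg_min (\<lambda>u. (gradG (xmd i \<omega>) + adjoint K (y (i + 1) \<omega>) + dx i \<omega>) \<bullet> u
      + 1 / \<eta> i * eucl_div u (x i \<omega>)) (\<lambda>u. u \<in> X) (x (i + 1) \<omega>)"
    using updates(2)[OF assms i] by (simp only:)
qed

text \<open>
The \<open>\<sigma>\<close>-algebra generated by the samples with index in \<open>A\<close>.
\<close>
definition history :: "(evaluation \<times> nat) set \<Rightarrow> 'w measure" where
  "history A = vimage_algebra (space M) (\<lambda>\<omega>. restrict (\<lambda>j. (case j of (c, i) \<Rightarrow> \<xi> c i) \<omega>) A) (PiM A (\<lambda>_. P))"

definition past :: "nat \<Rightarrow> (evaluation \<times> nat) set" where "past i = UNIV \<times> {1..<i}"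

abbreviation "all_samples \<equiv> (UNIV :: evaluation set) \<times> {1::nat..}"

lemma space_history[simp]: "space (history A) = space M"
  by (simp add: history_def)

lemma sample_measurable: "i \<ge> 1 \<Longrightarrow> \<xi> c i \<in> M \<rightarrow>\<^sub>M P"
  using samples_indep by (auto simp: indep_vars_def)

lemma history_map_measurable:
  assumes "A \<subseteq> all_samples"
  shows "(\<lambda>\<omega>. restrict (\<lambda>j. (case j of (c, i) \<Rightarrow> \<xi> c i) \<omega>) A) \<in> M \<rightarrow>\<^sub>M PiM A (\<lambda>_. P)"
  using assms sample_measurable by (intro measurable_restrict) auto

lemma sample_measurable_history:
  assumes "A \<subseteq> all_samples" "(c, i) \<in> A"
  shows "\<xi> c i \<in> history A \<rightarrow>\<^sub>M P"
proof -
  have "(\<lambda>\<omega>. restrict (\<lambda>j. (case j of (c, i) \<Rightarrow> \<xi> c i) \<omega>) A) \<in> history A \<rightarrow>\<^sub>M PiM A (\<lambda>_. P)"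
    unfolding history_def
    by (rule measurable_vimage_algebra1) (use measurable_space[OF history_map_measurable[OF assms(1)]] in auto)
  from measurable_compose[OF this measurable_component_singleton[OF assms(2)]]
  show ?thesis using assms(2) by simp
qed

lemma history_mono:
  assumes "A \<subseteq> B" "B \<subseteq> all_samples" "f \<in> history A \<rightarrow>\<^sub>M N"
  shows "f \<in> history B \<rightarrow>\<^sub>M N"
proof -
  have "(\<lambda>\<omega>. \<omega>) \<in> history B \<rightarrow>\<^sub>M history A"
    unfolding history_def[of A]
  proof (rule measurable_vimage_algebra2)
    show "(\<lambda>\<omega>. restrict (\<lambda>j. (case j of (c, i) \<Rightarrow> \<xi> c i) \<omega>) A) \<in> history B \<rightarrow>\<^sub>M PiM A (\<lambda>_. P)"
      using assms sample_measurable_history[OF assms(2)] by (intro measurable_restrict) auto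
  qed auto
  from measurable_compose[OF this assms(3)] show ?thesis .
qed

text \<open>
A sample that is not in \<open>A\<close> is independent of the samples in \<open>A\<close>: grouping an independent family into
disjoint blocks preserves independence.
\<close>
lemma history_oracle:
  assumes A: "A \<subseteq> all_samples" and c: "(c, i) \<notin> A" and i: "i \<ge> 1"
  shows "oracle_history (history A) P (\<xi> c i)"
  unfolding oracle_history_def
proof (intro conjI)
  let ?R = "\<lambda>A \<omega>. restrict (\<lambda>j. (case j of (c, i) \<Rightarrow> \<xi> c i) \<omega>) A"
  have R: "?R B \<in> space M \<rightarrow> space (PiM B (\<lambda>_. P))" if "B \<subseteq> all_samples" for B
    using measurable_space[OF history_map_measurable[OF that]] by blast
  have sets: "sets (history A) = {?R A -` S \<inter> space M | S. S \<in> sets (PiM A (\<lambda>_. P))}"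
    unfolding history_def by (rule sets_vimage_algebra2[OF R[OF A]])
  show "space (history A) = space M" by simp
  show "sets (history A) \<subseteq> events"
    unfolding sets using measurable_sets[OF history_map_measurable[OF A]] by blast
  show "\<xi> c i \<in> M \<rightarrow>\<^sub>M P" "distr M P (\<xi> c i) = P"
    using i samples_ident sample_measurable by auto
  have "indep_var (PiM A (\<lambda>_. P)) (?R A) (PiM {(c, i)} (\<lambda>_. P)) (?R {(c, i)})"
    using A c i by (intro indep_var_restrict[OF samples_indep]) auto
  then have ind: "indep_set (sigma_sets (space M) {?R A -` S \<inter> space M | S. S \<in> sets (PiM A (\<lambda>_. P))})
      (sigma_sets (space M) {?R {(c, i)} -` S \<inter> space M | S. S \<in> sets (PiM {(c, i)} (\<lambda>_. P))})"
    unfolding indep_var_eq by blast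
  have 1: "sets (history A) \<subseteq> sigma_sets (space M) {?R A -` S \<inter> space M | S. S \<in> sets (PiM A (\<lambda>_. P))}"
    unfolding sets by auto
  have 2: "{\<xi> c i -` B \<inter> space M |B. B \<in> sets P} \<subseteq>
      {?R {(c, i)} -` S \<inter> space M | S. S \<in> sets (PiM {(c, i)} (\<lambda>_. P))}"
  proof safe
    fix B assume B: "B \<in> sets P"
    let ?S = "(\<lambda>f. f (c, i)) -` B \<inter> space (PiM {(c, i)} (\<lambda>_. P))"
    have "?S \<in> sets (PiM {(c, i)} (\<lambda>_. P))"
      using B by (intro measurable_sets[OF measurable_component_singleton]) auto
    moreover have "\<xi> c i -` B \<inter> space M = ?R {(c, i)} -` ?S \<inter> space M"
      using R[of "{(c, i)}"] i by auto
    ultimately show "\<exists>S. \<xi> c i -` B \<inter> space M = ?R {(c, i)} -` S \<inter> space M \<and> S \<in> sets (PiM {(c, i)} (\<lambda>_. P))"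
      by blast
  qed
  show "indep_set (sets (history A)) (sigma_sets (space M) {\<xi> c i -` B \<inter> space M |B. B \<in> sets P})"
    using ind 1 sigma_sets_mono''[OF _ 2] unfolding indep_set_def
    by (auto elim!: indep_sets_mono_sets split: bool.split simp: subset_iff sigma_sets_mono'[OF 2, THEN subsetD])
qed

lemma estimate_measurable:
  assumes F: "unbiased_estimator P S F m" and A: "A \<subseteq> all_samples" "(c, i) \<in> A"
    and U: "U \<in> borel_measurable (history A)" "\<And>\<omega>. \<omega> \<in> space M \<Longrightarrow> U \<omega> \<in> S"
  shows "(\<lambda>\<omega>. F (U \<omega>) (\<xi> c i \<omega>)) \<in> borel_measurable (history A)"
proof -
  have "U \<in> history A \<rightarrow>\<^sub>M restrict_space borel S"
    using U by (intro measurable_restrict_space2) auto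
  then have pair: "(\<lambda>\<omega>. (U \<omega>, \<xi> c i \<omega>)) \<in> history A \<rightarrow>\<^sub>M restrict_space borel S \<Otimes>\<^sub>M P"
    using sample_measurable_history[OF A] by (rule measurable_Pair)
  show ?thesis
    using measurable_compose[OF pair F[unfolded unbiased_estimator_def, THEN conjunct1]] by simp
qed

lemma iterates_in_sets:
  assumes "\<omega> \<in> space M" "i \<ge> 1"
  shows "x i \<omega> \<in> X" "y i \<omega> \<in> Y" "xag i \<omega> \<in> X" "yag i \<omega> \<in> Y" "xmd i \<omega> \<in> X"
  using perturbed_apd.iterates_in[OF path[OF assms(1)] assms(2)]
    perturbed_apd.aggregates_in[OF path[OF assms(1)] assms(2)]
    perturbed_apd.xmd_in[OF path[OF assms(1)] assms(2)] by auto

lemma past_subset: "past i \<subseteq> all_samples"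
  by (auto simp: past_def)

lemma mem_past: "(c, j) \<in> past i \<longleftrightarrow> 1 \<le> j \<and> j < i"
  by (simp add: past_def)

lemma past_Suc:
  assumes "i \<ge> 1"
  shows "past i \<subseteq> past (i + 1)" "insert (Eval_Kx, i) (past i) \<subseteq> past (i + 1)" "past i \<subseteq> insert (Eval_Kx, i) (past i)"
    "insert (Eval_Kx, i) (past i) \<subseteq> all_samples"
  using assms mem_past past_subset[of i] by (auto simp: subset_iff)

lemma history_measurable_cong:
  assumes "g \<in> history A \<rightarrow>\<^sub>M N" "\<And>\<omega>. \<omega> \<in> space M \<Longrightarrow> f \<omega> = g \<omega>"
  shows "f \<in> history A \<rightarrow>\<^sub>M N"
  using assms by (subst measurable_cong[of _ f g]) auto

lemma xmd_adapted:
  assumes "i \<ge> 1" "x i \<in> borel_measurable (history A)" "xag i \<in> borel_measurable (history A)"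
  shows "xmd i \<in> borel_measurable (history A)"
proof -
  note [measurable] = assms(2,3)
  have "(\<lambda>\<omega>. (1 - inverse (\<beta> i)) *\<^sub>R xag i \<omega> + inverse (\<beta> i) *\<^sub>R x i \<omega>) \<in> borel_measurable (history A)"
    by measurable
  then show ?thesis
    by (rule history_measurable_cong) (rule perturbed_apd.xmd[OF path assms(1)])
qed

lemma y_adapted_next:
  assumes i: "i \<ge> 1" and [measurable]: "y i \<in> borel_measurable (history (past i))" "xbar i \<in> borel_measurable (history (past i))"
  shows "y (i + 1) \<in> borel_measurable (history (insert (Eval_Kx, i) (past i)))"
proof (rule prox_measurable[OF J_convex stepsizes_pos(2)[OF i],
      where w = "y i" and a = "\<lambda>\<omega>. - KxO (xbar i \<omega>) (\<xi> Eval_Kx i \<omega>)"])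
  let ?A = "insert (Eval_Kx, i) (past i)"
  note A = past_Suc(3,4)[OF i]
  note up = history_mono[OF A]
  show "y i \<in> borel_measurable (history ?A)" by (rule up) fact
  have "(\<lambda>\<omega>. KxO (xbar i \<omega>) (\<xi> Eval_Kx i \<omega>)) \<in> borel_measurable (history ?A)"
    by (rule estimate_measurable[OF unbiased(2) A(2)]) (auto intro: up assms(3))
  then show "(\<lambda>\<omega>. - KxO (xbar i \<omega>) (\<xi> Eval_Kx i \<omega>)) \<in> borel_measurable (history ?A)"
    by (rule borel_measurable_uminus)
  show "\<And>\<omega>. \<omega> \<in> space (history ?A) \<Longrightarrow>
    is_arg_min (\<lambda>u. - KxO (xbar i \<omega>) (\<xi> Eval_Kx i \<omega>) \<bullet> u + J u + 1 / \<tau> i * eucl_div u (y i \<omega>))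
      (\<lambda>u. u \<in> Y) (y (i + 1) \<omega>)"
    using updates(1)[OF _ i] by simp
qed

lemma x_adapted_next:
  assumes i: "i \<ge> 1" and [measurable]: "x i \<in> borel_measurable (history (past i))" "xag i \<in> borel_measurable (history (past i))"
    and y: "y (i + 1) \<in> borel_measurable (history (past (i + 1)))"
  shows "x (i + 1) \<in> borel_measurable (history (past (i + 1)))"
proof (rule prox_measurable[OF _ stepsizes_pos(1)[OF i], where h = "\<lambda>_. 0" and w = "x i"
      and a = "\<lambda>\<omega>. GO (xmd i \<omega>) (\<xi> Eval_G i \<omega>) + KyO (y (i + 1) \<omega>) (\<xi> Eval_Ky i \<omega>)"])
  let ?A = "past (i + 1)"
  note A = past_Suc(1)[OF i] past_subset[of "i + 1"]
  note up = history_mono[OF A]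
  have mem: "(c, i) \<in> ?A" for c unfolding mem_past using i by simp
  show "convex_on X (\<lambda>_. 0)" using convex_XY(1) by (simp add: convex_on_def)
  show "x i \<in> borel_measurable (history ?A)" by (rule up) fact
  have "xmd i \<in> borel_measurable (history ?A)"
    by (intro up xmd_adapted[OF i]) fact+
  then have "(\<lambda>\<omega>. GO (xmd i \<omega>) (\<xi> Eval_G i \<omega>)) \<in> borel_measurable (history ?A)"
    using iterates_in_sets i by (intro estimate_measurable[OF unbiased(1) A(2) mem]) auto
  moreover have "(\<lambda>\<omega>. KyO (y (i + 1) \<omega>) (\<xi> Eval_Ky i \<omega>)) \<in> borel_measurable (history ?A)"
    using iterates_in_sets[where i = "i + 1"] y by (intro estimate_measurable[OF unbiased(3) A(2) mem]) auto
  ultimately show "(\<lambda>\<omega>. GO (xmd i \<omega>) (\<xi> Eval_G i \<omega>) + KyO (y (i + 1) \<omega>) (\<xi> Eval_Ky i \<omega>)) \<in> borel_measurable (history ?A)"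
    by (rule borel_measurable_add)
  show "\<And>\<omega>. \<omega> \<in> space (history ?A) \<Longrightarrow>
    is_arg_min (\<lambda>u. (GO (xmd i \<omega>) (\<xi> Eval_G i \<omega>) + KyO (y (i + 1) \<omega>) (\<xi> Eval_Ky i \<omega>)) \<bullet> u + 0
      + 1 / \<eta> i * eucl_div u (x i \<omega>)) (\<lambda>u. u \<in> X) (x (i + 1) \<omega>)"
    using updates(2)[OF _ i] by simp
qed

text \<open>
Induction along the method: an iteration applies Borel functions, the estimators and the proximal
maps, to the old iterates and to the samples of this iteration.
\<close>
lemma adapted:
  assumes "i \<ge> 1"
  shows "x i \<in> borel_measurable (history (past i)) \<and> y i \<in> borel_measurable (history (past i)) \<and>
    xag i \<in> borel_measurable (history (past i)) \<and> yag i \<in> borel_measurable (history (past i)) \<and>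
    xbar i \<in> borel_measurable (history (past i))"
  using assms
proof (induction i rule: nat_induct_at_least)
  case base
  have const: "f \<in> borel_measurable (history (past 1))" if "\<And>\<omega>. \<omega> \<in> space M \<Longrightarrow> f \<omega> = c"
    for f :: "'w \<Rightarrow> 'c::euclidean_space" and c
    using that by (subst measurable_cong[of _ f "\<lambda>_. c"]) auto
  show ?case
    using perturbed_apd.start[OF path] by (intro conjI const) auto
next
  case (Suc i)
  note i = Suc.hyps
  let ?A = "past (i + 1)"
  note A = past_Suc(1,2)[OF i] past_subset[of "i + 1"]
  have y[measurable]: "y (i + 1) \<in> borel_measurable (history ?A)"
    using Suc.IH by (intro history_mono[OF A(2,3)] y_adapted_next[OF i]) auto
  have x[measurable]: "x (i + 1) \<in> borel_measurable (history ?A)"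
    using Suc.IH y by (intro x_adapted_next[OF i]) auto
  have [measurable]: "x i \<in> borel_measurable (history ?A)" "xag i \<in> borel_measurable (history ?A)"
    "yag i \<in> borel_measurable (history ?A)"
    using Suc.IH by (blast intro: history_mono[OF A(1,3)])+
  have "(\<lambda>\<omega>. (1 - inverse (\<beta> i)) *\<^sub>R xag i \<omega> + inverse (\<beta> i) *\<^sub>R x (i + 1) \<omega>) \<in> borel_measurable (history ?A)"
    by measurable
  then have xag: "xag (i + 1) \<in> borel_measurable (history ?A)"
    by (rule history_measurable_cong) (rule perturbed_apd.xag[OF path i])
  have "(\<lambda>\<omega>. (1 - inverse (\<beta> i)) *\<^sub>R yag i \<omega> + inverse (\<beta> i) *\<^sub>R y (i + 1) \<omega>) \<in> borel_measurable (history ?A)"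
    by measurable
  then have yag: "yag (i + 1) \<in> borel_measurable (history ?A)"
    by (rule history_measurable_cong) (rule perturbed_apd.yag[OF path i])
  have "(\<lambda>\<omega>. \<theta> (i + 1) *\<^sub>R (x (i + 1) \<omega> - x i \<omega>) + x (i + 1) \<omega>) \<in> borel_measurable (history ?A)"
    by measurable
  then have xbar: "xbar (i + 1) \<in> borel_measurable (history ?A)"
    by (rule history_measurable_cong) (rule perturbed_apd.xbar[OF path i])
  show ?case unfolding Suc_eq_plus1 using x y xag yag xbar by blast
qed

lemma measurable_of_history:
  assumes "A \<subseteq> all_samples" "f \<in> history A \<rightarrow>\<^sub>M N"
  shows "f \<in> M \<rightarrow>\<^sub>M N"
proof -
  have "(\<lambda>\<omega>. \<omega>) \<in> M \<rightarrow>\<^sub>M history A"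
    unfolding history_def
    by (rule measurable_vimage_algebra2) (auto simp: history_map_measurable[OF assms(1)])
  from measurable_compose[OF this assms(2)] show ?thesis .
qed

lemma iterates_measurable[measurable]:
  assumes "i \<ge> 1"
  shows "x i \<in> borel_measurable M" "y i \<in> borel_measurable M" "xag i \<in> borel_measurable M"
    "yag i \<in> borel_measurable M"
  using adapted[OF assms] by (auto intro: measurable_of_history[OF past_subset])

lemma adapted_measurable:
  assumes "i \<ge> 1"
  shows "x i \<in> borel_measurable (history (past i))" "y i \<in> borel_measurable (history (past i))"
    "xag i \<in> borel_measurable (history (past i))" "yag i \<in> borel_measurable (history (past i))"
    "xbar i \<in> borel_measurable (history (past i))" "xmd i \<in> borel_measurable (history (past i))"
  using adapted[OF assms] xmd_adapted[OF assms] by auto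

lemma err_Kx_oracle: "i \<ge> 1 \<Longrightarrow> oracle_history (history (past i)) P (\<xi> Eval_Kx i)"
  by (rule history_oracle[OF past_subset]) (auto simp: mem_past)

lemma err_G_oracle: "i \<ge> 1 \<Longrightarrow> oracle_history (history (past i)) P (\<xi> Eval_G i)"
  by (rule history_oracle[OF past_subset]) (auto simp: mem_past)

section \<open>Moments of the errors\<close>

text \<open>
The dual step of iteration \<open>i\<close> comes before the evaluation at \<open>y (i + 1)\<close>, so the sample \<open>Eval_Kx\<close>
belongs to the history of that evaluation.  The sample \<open>Eval_G\<close> is included as well, which makes the
two parts of the primal error orthogonal.
\<close>
definition pre_Ky :: "nat \<Rightarrow> (evaluation \<times> nat) set" where
  "pre_Ky i = insert (Eval_G, i) (insert (Eval_Kx, i) (past i))"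

lemma pre_Ky_subset:
  assumes "i \<ge> 1"
  shows "past i \<subseteq> pre_Ky i" "insert (Eval_Kx, i) (past i) \<subseteq> pre_Ky i" "pre_Ky i \<subseteq> all_samples"
    "pre_Ky i \<subseteq> past (i + 1)" "(Eval_G, i) \<in> pre_Ky i"
  using assms past_subset[of i] past_Suc[of i] mem_past[of Eval_G i "i + 1"]
  by (auto simp: pre_Ky_def)

lemma err_Ky_oracle: "i \<ge> 1 \<Longrightarrow> oracle_history (history (pre_Ky i)) P (\<xi> Eval_Ky i)"
  by (rule history_oracle[OF pre_Ky_subset(3)]) (auto simp: mem_past pre_Ky_def)

lemma y_next_pre_Ky:
  assumes "i \<ge> 1"
  shows "y (i + 1) \<in> borel_measurable (history (pre_Ky i))"
  by (rule history_mono[OF pre_Ky_subset(2,3)[OF assms]])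
    (rule y_adapted_next[OF assms adapted_measurable(2,5)[OF assms]])

lemma err_G_measurable:
  assumes i: "i \<ge> 1"
  shows "err_G i \<in> borel_measurable (history (pre_Ky i))"
proof -
  have xmd: "xmd i \<in> borel_measurable (history (pre_Ky i))"
    by (rule history_mono[OF pre_Ky_subset(1,3)[OF i] adapted_measurable(6)[OF i]])
  have in_X: "xmd i \<omega> \<in> X" if "\<omega> \<in> space M" for \<omega>
    using iterates_in_sets(5)[OF that i] .
  have "xmd i \<in> history (pre_Ky i) \<rightarrow>\<^sub>M restrict_space borel X"
    using xmd in_X by (intro measurable_restrict_space2) auto
  from measurable_compose[OF this unbiased_mean_measurable[OF P unbiased(1)]]
  have "(\<lambda>\<omega>. gradG (xmd i \<omega>)) \<in> borel_measurable (history (pre_Ky i))" .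
  moreover have "(\<lambda>\<omega>. GO (xmd i \<omega>) (\<xi> Eval_G i \<omega>)) \<in> borel_measurable (history (pre_Ky i))"
    by (rule estimate_measurable[OF unbiased(1) pre_Ky_subset(3,5)[OF i] xmd in_X])
  ultimately show ?thesis
    unfolding err_G_def[abs_def] by (intro borel_measurable_diff)
qed

lemma
  assumes i: "i \<ge> 1"
  shows err_G_square_integrable: "square_integrable M (err_G i)"
    and err_G_variance: "expectation (\<lambda>\<omega>. (norm (err_G i \<omega>))\<^sup>2) \<le> \<sigma>xG\<^sup>2"
    and err_G_mean_zero: "\<And>W. W \<in> borel_measurable (history (past i)) \<Longrightarrow> square_integrable M W \<Longrightarrow>
      expectation (\<lambda>\<omega>. W \<omega> \<bullet> err_G i \<omega>) = 0"
proof -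
  note * = P err_G_oracle[OF i] unbiased(1) A1(1) adapted_measurable(6)[OF i] iterates_in_sets(5)[OF _ i]
  show "square_integrable M (err_G i)"
    unfolding err_G_def[abs_def] by (rule oracle_error_square_integrable[OF *])
  show "expectation (\<lambda>\<omega>. (norm (err_G i \<omega>))\<^sup>2) \<le> \<sigma>xG\<^sup>2"
    unfolding err_G_def by (rule oracle_error_variance[OF *])
  show "expectation (\<lambda>\<omega>. W \<omega> \<bullet> err_G i \<omega>) = 0"
    if "W \<in> borel_measurable (history (past i))" "square_integrable M W" for W
    unfolding err_G_def by (rule oracle_error_mean_zero[OF * that])
qed

lemma
  assumes i: "i \<ge> 1"
  shows err_Ky_square_integrable: "square_integrable M (err_Ky i)"
    and err_Ky_variance: "expectation (\<lambda>\<omega>. (norm (err_Ky i \<omega>))\<^sup>2) \<le> \<sigma>xK\<^sup>2"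
    and err_Ky_mean_zero: "\<And>W. W \<in> borel_measurable (history (pre_Ky i)) \<Longrightarrow> square_integrable M W \<Longrightarrow>
      expectation (\<lambda>\<omega>. W \<omega> \<bullet> err_Ky i \<omega>) = 0"
proof -
  have in_Y: "y (i + 1) \<omega> \<in> Y" if "\<omega> \<in> space M" for \<omega>
    by (rule iterates_in_sets(2)[OF that]) simp
  note * = P err_Ky_oracle[OF i] unbiased(3) A1(3) y_next_pre_Ky[OF i] in_Y
  show "square_integrable M (err_Ky i)"
    unfolding err_Ky_def[abs_def] by (rule oracle_error_square_integrable[OF *])
  show "expectation (\<lambda>\<omega>. (norm (err_Ky i \<omega>))\<^sup>2) \<le> \<sigma>xK\<^sup>2"
    unfolding err_Ky_def by (rule oracle_error_variance[OF *])
  show "expectation (\<lambda>\<omega>. W \<omega> \<bullet> err_Ky i \<omega>) = 0"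
    if "W \<in> borel_measurable (history (pre_Ky i))" "square_integrable M W" for W
    unfolding err_Ky_def by (rule oracle_error_mean_zero[OF * that])
qed

lemma
  assumes i: "i \<ge> 1"
  shows dy_square_integrable: "square_integrable M (dy i)"
    and dy_variance: "expectation (\<lambda>\<omega>. (norm (dy i \<omega>))\<^sup>2) \<le> \<sigma>y\<^sup>2"
    and dy_mean_zero: "\<And>W. W \<in> borel_measurable (history (past i)) \<Longrightarrow> square_integrable M W \<Longrightarrow>
      expectation (\<lambda>\<omega>. W \<omega> \<bullet> dy i \<omega>) = 0"
proof -
  note * = P err_Kx_oracle[OF i] unbiased(2) A1(2) adapted_measurable(5)[OF i] UNIV_I
  show "square_integrable M (dy i)"
    unfolding dy_def[abs_def] by (intro square_integrable_minus oracle_error_square_integrable[OF *])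
  show "expectation (\<lambda>\<omega>. (norm (dy i \<omega>))\<^sup>2) \<le> \<sigma>y\<^sup>2"
    unfolding dy_def norm_minus_cancel by (rule oracle_error_variance[OF *])
  show "expectation (\<lambda>\<omega>. W \<omega> \<bullet> dy i \<omega>) = 0"
    if "W \<in> borel_measurable (history (past i))" "square_integrable M W" for W
    unfolding dy_def inner_minus_right using oracle_error_mean_zero[OF * that] by simp
qed

abbreviation \<sigma>x2 :: real where "\<sigma>x2 \<equiv> \<sigma>xG\<^sup>2 + \<sigma>xK\<^sup>2"

text \<open>
The two evaluations in the primal error are orthogonal because \<open>err_G i\<close> is a function of the history
of the second one.
\<close>
lemma
  assumes i: "i \<ge> 1"
  shows dx_square_integrable: "square_integrable M (dx i)"
    and dx_variance: "expectation (\<lambda>\<omega>. (norm (dx i \<omega>))\<^sup>2) \<le> \<sigma>x2"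
    and dx_mean_zero: "\<And>W. W \<in> borel_measurable (history (past i)) \<Longrightarrow> square_integrable M W \<Longrightarrow>
      expectation (\<lambda>\<omega>. W \<omega> \<bullet> dx i \<omega>) = 0"
proof -
  note sq = err_G_square_integrable[OF i] err_Ky_square_integrable[OF i]
  show "square_integrable M (dx i)"
    unfolding dx_def[abs_def] by (intro square_integrable_add sq)
  show "expectation (\<lambda>\<omega>. (norm (dx i \<omega>))\<^sup>2) \<le> \<sigma>x2"
    unfolding dx_def
    using expectation_norm_sq_add_orthogonal[OF sq err_Ky_mean_zero[OF i err_G_measurable[OF i] sq(1)]]
      err_G_variance[OF i] err_Ky_variance[OF i] by simp
  fix W :: "'w \<Rightarrow> 'a" assume W: "W \<in> borel_measurable (history (past i))" "square_integrable M W"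
  have W': "W \<in> borel_measurable (history (pre_Ky i))"
    by (rule history_mono[OF pre_Ky_subset(1,3)[OF i] W(1)])
  show "expectation (\<lambda>\<omega>. W \<omega> \<bullet> dx i \<omega>) = 0"
    unfolding dx_def inner_add_right
    using err_G_mean_zero[OF i W] err_Ky_mean_zero[OF i W' W(2)]
      integrable_inner_of_square_integrable[OF W(2) sq(1)] integrable_inner_of_square_integrable[OF W(2) sq(2)]
    by simp
qed

lemma dx_dy_adapted:
  assumes i: "i \<ge> 1"
  shows "dx i \<in> borel_measurable (history (past (i + 1)))" "dy i \<in> borel_measurable (history (past (i + 1)))"
proof -
  let ?A = "past (i + 1)"
  note A = past_subset[of "i + 1"]
  have mem: "(c, i) \<in> ?A" for c using i by (simp add: mem_past)
  have y: "y (i + 1) \<in> borel_measurable (history ?A)"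
    by (rule adapted_measurable) simp
  have in_Y: "y (i + 1) \<omega> \<in> Y" if "\<omega> \<in> space M" for \<omega>
    by (rule iterates_in_sets(2)[OF that]) simp
  have lin: "h \<in> borel_measurable borel" if "linear h" for h :: "'c::euclidean_space \<Rightarrow> 'd::euclidean_space"
    using that by (intro borel_measurable_continuous_onI linear_continuous_on) (simp add: linear_conv_bounded_linear)
  have "(\<lambda>\<omega>. KyO (y (i + 1) \<omega>) (\<xi> Eval_Ky i \<omega>)) \<in> borel_measurable (history ?A)"
    by (rule estimate_measurable[OF unbiased(3) A mem y in_Y])
  moreover have "(\<lambda>\<omega>. adjoint K (y (i + 1) \<omega>)) \<in> borel_measurable (history ?A)"
    by (rule measurable_compose[OF y lin[OF adjoint_linear[OF K]]])
  ultimately have "err_Ky i \<in> borel_measurable (history ?A)"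
    unfolding err_Ky_def[abs_def] by (intro borel_measurable_diff)
  moreover have "err_G i \<in> borel_measurable (history ?A)"
    by (rule history_mono[OF pre_Ky_subset(4)[OF i] A err_G_measurable[OF i]])
  ultimately show "dx i \<in> borel_measurable (history ?A)"
    unfolding dx_def[abs_def] by (intro borel_measurable_add)
  have xbar: "xbar i \<in> borel_measurable (history ?A)"
    by (rule history_mono[OF past_Suc(1)[OF i] A adapted_measurable(5)[OF i]])
  have "(\<lambda>\<omega>. KxO (xbar i \<omega>) (\<xi> Eval_Kx i \<omega>)) \<in> borel_measurable (history ?A)"
    by (rule estimate_measurable[OF unbiased(2) A mem xbar UNIV_I])
  moreover have "(\<lambda>\<omega>. K (xbar i \<omega>)) \<in> borel_measurable (history ?A)"
    by (rule measurable_compose[OF xbar lin[OF K]])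
  ultimately show "dy i \<in> borel_measurable (history ?A)"
    unfolding dy_def[abs_def] by (intro borel_measurable_uminus borel_measurable_diff)
qed

text \<open>
The quantity \<open>C\<^sup>2\<close> of the theorem.
\<close>
definition noise_level :: "nat \<Rightarrow> real" where
  "noise_level k = (\<Sum>i=1..k. (\<eta> i)\<^sup>2 * \<sigma>x2 / (1 - q) + \<eta> i * \<tau> i * \<sigma>y\<^sup>2 / (1 - p))"

lemma noise_level_mono:
  assumes "k \<le> l"
  shows "noise_level k \<le> noise_level l"
  unfolding noise_level_def
proof (rule sum_mono2)
  fix i assume "i \<in> {1..l} - {1..k}"
  then have "0 < \<eta> i" "0 < \<tau> i" using stepsizes_pos by auto
  then have "0 \<le> (\<eta> i)\<^sup>2 * \<sigma>x2 / (1 - q)" "0 \<le> \<eta> i * \<tau> i * \<sigma>y\<^sup>2 / (1 - p)"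
    using pq by (auto intro!: divide_nonneg_nonneg mult_nonneg_nonneg add_nonneg_nonneg)
  then show "0 \<le> (\<eta> i)\<^sup>2 * \<sigma>x2 / (1 - q) + \<eta> i * \<tau> i * \<sigma>y\<^sup>2 / (1 - p)" by linarith
qed (use assms in auto)

abbreviation noise_at :: "'a \<Rightarrow> 'b \<Rightarrow> nat \<Rightarrow> 'w \<Rightarrow> real" where
  "noise_at u w i \<omega> \<equiv> noise i (dx i \<omega>) (dy i \<omega>) (x i \<omega> - u) (y i \<omega> - w)"

text \<open>
The iterates \<open>x i\<close> and \<open>y i\<close> are functions of the earlier samples, so their pairings with the errors
have mean zero and only the squares remain.
\<close>
lemma
  assumes i: "i \<ge> 1" and sq: "square_integrable M (x i)" "square_integrable M (y i)"
  shows noise_integrable: "integrable M (noise_at u w i)"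
    and noise_expectation: "expectation (noise_at u w i)
      \<le> ((\<eta> i)\<^sup>2 * \<sigma>x2 / (1 - q) + \<eta> i * \<tau> i * \<sigma>y\<^sup>2 / (1 - p)) / 2"
proof -
  have e: "\<eta> i > 0" "\<tau> i > 0" using stepsizes_pos i by auto
  have sq': "square_integrable M (\<lambda>\<omega>. x i \<omega> - u)" "square_integrable M (\<lambda>\<omega>. y i \<omega> - w)"
    by (intro square_integrable_diff sq square_integrable_const)+
  note adm = adapted_measurable(1,2)[OF i, measurable]
  have m: "(\<lambda>\<omega>. x i \<omega> - u) \<in> borel_measurable (history (past i))"
    "(\<lambda>\<omega>. y i \<omega> - w) \<in> borel_measurable (history (past i))"
    by measurable
  have zero: "expectation (\<lambda>\<omega>. dx i \<omega> \<bullet> (x i \<omega> - u)) = 0" "expectation (\<lambda>\<omega>. dy i \<omega> \<bullet> (y i \<omega> - w)) = 0"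
    using dx_mean_zero[OF i m(1) sq'(1)] dy_mean_zero[OF i m(2) sq'(2)] by (simp_all only: inner_commute)
  note int = square_integrableD(2)[OF dx_square_integrable[OF i]] square_integrableD(2)[OF dy_square_integrable[OF i]]
    integrable_inner_of_square_integrable[OF dx_square_integrable[OF i] sq'(1)]
    integrable_inner_of_square_integrable[OF dy_square_integrable[OF i] sq'(2)]
  show "integrable M (noise_at u w i)"
    unfolding noise_def using int
    by (intro Bochner_Integration.integrable_add Bochner_Integration.integrable_diff integrable_mult_right) auto
  have "expectation (noise_at u w i) = (\<eta> i)\<^sup>2 / (2 * (1 - q)) * expectation (\<lambda>\<omega>. (norm (dx i \<omega>))\<^sup>2)
     + \<eta> i * \<tau> i / (2 * (1 - p)) * expectation (\<lambda>\<omega>. (norm (dy i \<omega>))\<^sup>2)"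
    unfolding noise_def using int zero by (simp del: inner_diff_right)
  also have "\<dots> \<le> (\<eta> i)\<^sup>2 / (2 * (1 - q)) * \<sigma>x2 + \<eta> i * \<tau> i / (2 * (1 - p)) * \<sigma>y\<^sup>2"
    using pq e dx_variance[OF i] dy_variance[OF i] by (intro add_mono mult_left_mono) auto
  also have "\<dots> = ((\<eta> i)\<^sup>2 * \<sigma>x2 / (1 - q) + \<eta> i * \<tau> i * \<sigma>y\<^sup>2 / (1 - p)) / 2"
    by (simp add: add_divide_distrib mult.commute)
  finally show "expectation (noise_at u w i)
      \<le> ((\<eta> i)\<^sup>2 * \<sigma>x2 / (1 - q) + \<eta> i * \<tau> i * \<sigma>y\<^sup>2 / (1 - p)) / 2" .
qed

lemma
  assumes "\<And>i. i \<in> {1..k} \<Longrightarrow> square_integrable M (x i) \<and> square_integrable M (y i)"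
  shows noise_sum_integrable: "integrable M (\<lambda>\<omega>. \<Sum>i=1..k. noise_at u w i \<omega>)"
    and noise_sum_expectation: "expectation (\<lambda>\<omega>. \<Sum>i=1..k. noise_at u w i \<omega>) \<le> noise_level k / 2"
proof -
  have int: "integrable M (noise_at u w i)" if "i \<in> {1..k}" for i
    using assms[OF that] that by (intro noise_integrable) auto
  then show "integrable M (\<lambda>\<omega>. \<Sum>i=1..k. noise_at u w i \<omega>)"
    by (rule Bochner_Integration.integrable_sum)
  have "expectation (\<lambda>\<omega>. \<Sum>i=1..k. noise_at u w i \<omega>) = (\<Sum>i=1..k. expectation (noise_at u w i))"
    using int by (rule Bochner_Integration.integral_sum)
  also have "\<dots> \<le> (\<Sum>i=1..k. ((\<eta> i)\<^sup>2 * \<sigma>x2 / (1 - q) + \<eta> i * \<tau> i * \<sigma>y\<^sup>2 / (1 - p)) / 2)"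
    using assms by (intro sum_mono noise_expectation) auto
  finally show "expectation (\<lambda>\<omega>. \<Sum>i=1..k. noise_at u w i \<omega>) \<le> noise_level k / 2"
    by (simp add: noise_level_def sum_divide_distrib)
qed

text \<open>
The partial sum before an iteration is a function of the earlier samples and hence orthogonal to the
next term, so the second moments add up.
\<close>
lemma
  fixes f :: "nat \<Rightarrow> 'w \<Rightarrow> 'c::euclidean_space"
  assumes sq: "\<And>i. i \<ge> 1 \<Longrightarrow> square_integrable M (f i)"
    and var: "\<And>i. i \<ge> 1 \<Longrightarrow> expectation (\<lambda>\<omega>. (norm (f i \<omega>))\<^sup>2) \<le> s"
    and adap: "\<And>i. i \<ge> 1 \<Longrightarrow> f i \<in> borel_measurable (history (past (i + 1)))"
    and orth: "\<And>i W. i \<ge> 1 \<Longrightarrow> W \<in> borel_measurable (history (past i)) \<Longrightarrow> square_integrable M W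
      \<Longrightarrow> expectation (\<lambda>\<omega>. W \<omega> \<bullet> f i \<omega>) = 0"
  shows weighted_sum_square_integrable: "square_integrable M (\<lambda>\<omega>. \<Sum>i=1..k. \<eta> i *\<^sub>R f i \<omega>)"
    and weighted_sum_variance: "expectation (\<lambda>\<omega>. (norm (\<Sum>i=1..k. \<eta> i *\<^sub>R f i \<omega>))\<^sup>2) \<le> (\<Sum>i=1..k. (\<eta> i)\<^sup>2 * s)"
proof -
  let ?S = "\<lambda>k \<omega>. \<Sum>i=1..k. \<eta> i *\<^sub>R f i \<omega>"
  have sqS: "square_integrable M (?S k)" for k
    by (intro square_integrable_sum square_integrable_scaleR sq) auto
  then show "square_integrable M (?S k)" .
  show "expectation (\<lambda>\<omega>. (norm (?S k \<omega>))\<^sup>2) \<le> (\<Sum>i=1..k. (\<eta> i)\<^sup>2 * s)"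
  proof (induction k)
    case 0
    show ?case by simp
  next
    case (Suc k)
    have meas: "?S k \<in> borel_measurable (history (past (Suc k)))"
    proof (intro borel_measurable_sum borel_measurable_scaleR borel_measurable_const)
      fix i assume "i \<in> {1..k}"
      then have i: "i \<ge> 1" "past (i + 1) \<subseteq> past (Suc k)" by (auto simp: past_def)
      show "f i \<in> borel_measurable (history (past (Suc k)))"
        by (rule history_mono[OF i(2) past_subset adap[OF i(1)]])
    qed
    have "expectation (\<lambda>\<omega>. ?S k \<omega> \<bullet> (\<eta> (Suc k) *\<^sub>R f (Suc k) \<omega>)) = 0"
      using orth[OF _ meas sqS] by simp
    from expectation_norm_sq_add_orthogonal[OF sqS square_integrable_scaleR[OF sq[of "Suc k"]] this]
    have "expectation (\<lambda>\<omega>. (norm (?S (Suc k) \<omega>))\<^sup>2) = expectation (\<lambda>\<omega>. (norm (?S k \<omega>))\<^sup>2)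
        + (\<eta> (Suc k))\<^sup>2 * expectation (\<lambda>\<omega>. (norm (f (Suc k) \<omega>))\<^sup>2)"
      by (simp add: power_mult_distrib)
    also have "\<dots> \<le> (\<Sum>i=1..k. (\<eta> i)\<^sup>2 * s) + (\<eta> (Suc k))\<^sup>2 * s"
      using Suc.IH var[of "Suc k"] by (intro add_mono mult_left_mono) auto
    finally show ?case by simp
  qed
qed

lemmas Nx_square_integrable = weighted_sum_square_integrable[OF dx_square_integrable dx_variance dx_dy_adapted(1) dx_mean_zero]
  and Nx_variance = weighted_sum_variance[OF dx_square_integrable dx_variance dx_dy_adapted(1) dx_mean_zero]
  and Ny_square_integrable = weighted_sum_square_integrable[OF dy_square_integrable dy_variance dx_dy_adapted(2) dy_mean_zero]
  and Ny_variance = weighted_sum_variance[OF dy_square_integrable dy_variance dx_dy_adapted(2) dy_mean_zero]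

lemma energy_integrable:
  assumes "square_integrable M f" "square_integrable M g"
  shows "integrable M (\<lambda>\<omega>. energy (f \<omega> - u) (g \<omega> - w))"
  unfolding energy_def
  by (intro Bochner_Integration.integrable_add integrable_mult_right square_integrableD(2)
      square_integrable_diff assms square_integrable_const)

text \<open>
The factor \<open>1 / ((1 - p) * r)\<close> is the weight of the dual error sum in the bound on the perturbed gap; it
turns \<open>(\<eta> i)\<^sup>2\<close> into \<open>\<eta> i * \<tau> i / (1 - p)\<close> because \<open>\<eta> i = r * \<tau> i\<close>.
\<close>
lemma weighted_error_variances:
  shows "expectation (\<lambda>\<omega>. (norm (\<Sum>i=1..k. \<eta> i *\<^sub>R dx i \<omega>))\<^sup>2)
      + 1 / ((1 - p) * r) * expectation (\<lambda>\<omega>. (norm (\<Sum>i=1..k. \<eta> i *\<^sub>R dy i \<omega>))\<^sup>2) \<le> noise_level k"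
proof -
  have c: "0 \<le> 1 / ((1 - p) * r)" using pq r_pos by simp
  have "expectation (\<lambda>\<omega>. (norm (\<Sum>i=1..k. \<eta> i *\<^sub>R dx i \<omega>))\<^sup>2) \<le> (\<Sum>i=1..k. (\<eta> i)\<^sup>2 * \<sigma>x2)"
    by (rule Nx_variance)
  also have "\<dots> \<le> (\<Sum>i=1..k. (\<eta> i)\<^sup>2 * \<sigma>x2 / (1 - q))"
  proof (rule sum_mono)
    fix i
    have "(\<eta> i)\<^sup>2 * \<sigma>x2 * (1 - q) \<le> (\<eta> i)\<^sup>2 * \<sigma>x2"
      using pq by (intro mult_left_le) auto
    then show "(\<eta> i)\<^sup>2 * \<sigma>x2 \<le> (\<eta> i)\<^sup>2 * \<sigma>x2 / (1 - q)"
      using pq by (simp add: pos_le_divide_eq)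
  qed
  finally have 1: "expectation (\<lambda>\<omega>. (norm (\<Sum>i=1..k. \<eta> i *\<^sub>R dx i \<omega>))\<^sup>2) \<le> \<dots>" .
  have "1 / ((1 - p) * r) * expectation (\<lambda>\<omega>. (norm (\<Sum>i=1..k. \<eta> i *\<^sub>R dy i \<omega>))\<^sup>2)
      \<le> 1 / ((1 - p) * r) * (\<Sum>i=1..k. (\<eta> i)\<^sup>2 * \<sigma>y\<^sup>2)"
    by (rule mult_left_mono[OF Ny_variance c])
  also have "\<dots> = (\<Sum>i=1..k. \<eta> i * \<tau> i * \<sigma>y\<^sup>2 / (1 - p))"
    unfolding sum_distrib_left
  proof (rule sum.cong)
    fix i assume "i \<in> {1..k}"
    then have "(\<eta> i)\<^sup>2 = r * (\<eta> i * \<tau> i)"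
      using \<eta>_eq[of i] by (simp add: power2_eq_square)
    then show "1 / ((1 - p) * r) * ((\<eta> i)\<^sup>2 * \<sigma>y\<^sup>2) = \<eta> i * \<tau> i * \<sigma>y\<^sup>2 / (1 - p)"
      using r_pos by simp
  qed simp
  finally show ?thesis
    using 1 unfolding noise_level_def sum.distrib by linarith
qed

section \<open>The perturbation as a random vector\<close>

definition perturbation :: "nat \<Rightarrow> 'w \<Rightarrow> 'a \<times> 'b" where
  "perturbation k \<omega> = (1 / (\<beta> k * \<eta> k)) *\<^sub>R
    (x1 - x (k + 1) \<omega> - (\<Sum>i=1..k. \<eta> i *\<^sub>R dx i \<omega>),
     r *\<^sub>R (y1 - y (k + 1) \<omega>) - (\<Sum>i=1..k. \<eta> i *\<^sub>R dy i \<omega>) - \<eta> k *\<^sub>R K (x (k + 1) \<omega> - x k \<omega>))"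

lemma path_perturbation:
  assumes "\<omega> \<in> space M"
  shows "perturbed_apd.perturbation K \<beta> \<eta> \<tau> x1 y1 (\<lambda>i. dx i \<omega>) (\<lambda>i. dy i \<omega>) (\<lambda>i. x i \<omega>) (\<lambda>i. y i \<omega>) k = perturbation k \<omega>"
  by (simp add: perturbation_def perturbed_apd.perturbation_def[OF path[OF assms]]
      perturbed_apd.Nx_def[OF path[OF assms]] perturbed_apd.Ny_def[OF path[OF assms]])

lemma perturbation_measurable:
  assumes k: "k \<ge> 1"
  shows "perturbation k \<in> borel_measurable M"
proof -
  have [measurable]: "K \<in> borel_measurable borel"
    using K by (intro borel_measurable_continuous_onI linear_continuous_on) (simp add: linear_conv_bounded_linear)
  have k': "k + 1 \<ge> 1" by simp
  define Sx Sy where "Sx = (\<lambda>\<omega>. \<Sum>i=1..k. \<eta> i *\<^sub>R dx i \<omega>)" and "Sy = (\<lambda>\<omega>. \<Sum>i=1..k. \<eta> i *\<^sub>R dy i \<omega>)"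
  have [measurable]: "Sx \<in> borel_measurable M"
    unfolding Sx_def by (rule square_integrableD(1)[OF Nx_square_integrable])
  have [measurable]: "Sy \<in> borel_measurable M"
    unfolding Sy_def by (rule square_integrableD(1)[OF Ny_square_integrable])
  note [measurable] = iterates_measurable(1,2)[OF k] iterates_measurable(1,2)[OF k']
  have "perturbation k = (\<lambda>\<omega>. (1 / (\<beta> k * \<eta> k)) *\<^sub>R
    (x1 - x (k + 1) \<omega> - Sx \<omega>, r *\<^sub>R (y1 - y (k + 1) \<omega>) - Sy \<omega> - \<eta> k *\<^sub>R K (x (k + 1) \<omega> - x k \<omega>)))"
    by (rule ext) (simp only: perturbation_def Sx_def Sy_def)
  moreover have "\<dots> \<in> borel_measurable M"
    by measurable
  ultimately show ?thesis by simp
qed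

text \<open>
The supremand is continuous in the aggregate, the perturbation and the scalar
\<open>s = G a + J b - v \<bullet> (a, b)\<close>, where \<open>(a, b)\<close> is the aggregate and \<open>v\<close> the perturbation.  Here \<open>J\<close> may
be discontinuous, but \<open>s\<close> is a measurable function of the sample point.
\<close>
lemma perturbed_gap_measurable:
  assumes k: "k \<ge> 1"
  shows "(\<lambda>\<omega>. perturbed_gap X Y G K J (xag (k + 1) \<omega>, yag (k + 1) \<omega>) (perturbation k \<omega>)) \<in> borel_measurable M"
proof -
  define f :: "'a \<times> 'b \<Rightarrow> real \<times> 'a \<times> 'b \<times> 'a \<times> 'b \<Rightarrow> real" where
    "f = (\<lambda>(u, w) (s, a, b, v). s + K a \<bullet> w - K u \<bullet> b + v \<bullet> (u, w) - G u - J w)"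
  define g where "g = (\<lambda>\<omega>. (G (xag (k + 1) \<omega>) + J (yag (k + 1) \<omega>) - perturbation k \<omega> \<bullet> (xag (k + 1) \<omega>, yag (k + 1) \<omega>),
    xag (k + 1) \<omega>, yag (k + 1) \<omega>, perturbation k \<omega>))"
  have K': "bounded_linear K" using K by (simp add: linear_conv_bounded_linear)
  have "continuous_on UNIV (f z)" for z
  proof (cases z)
    case (Pair u w)
    show ?thesis
      unfolding f_def Pair by (auto simp: case_prod_unfold intro!: continuous_intros bounded_linear.continuous_on[OF K'])
  qed
  then have "(\<lambda>p. SUP z\<in>X \<times> Y. ereal (f z p)) \<in> borel_measurable borel"
    by (rule borel_measurable_SUP_continuous)
  moreover have "g \<in> borel_measurable M"
  proof -
    have k': "k + 1 \<ge> 1" by simp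
    note [measurable] = iterates_measurable(3,4)[OF k'] perturbation_measurable[OF k]
    have "continuous_on X G"
      using G_grad by (intro has_derivative_continuous_on)
    then have G: "G \<in> borel_measurable (restrict_space borel X)"
      by (rule borel_measurable_continuous_on_restrict)
    have "xag (k + 1) \<in> M \<rightarrow>\<^sub>M restrict_space borel X"
      using iterates_in_sets(3)[OF _ k'] by (intro measurable_restrict_space2) auto
    from measurable_compose[OF this G] have [measurable]: "(\<lambda>\<omega>. G (xag (k + 1) \<omega>)) \<in> borel_measurable M" .
    have "yag (k + 1) \<in> M \<rightarrow>\<^sub>M restrict_space borel Y"
      using iterates_in_sets(4)[OF _ k'] by (intro measurable_restrict_space2) auto
    from measurable_compose[OF this borel_measurable_lsc_on[OF J_lsc]]
    have [measurable]: "(\<lambda>\<omega>. J (yag (k + 1) \<omega>)) \<in> borel_measurable M" .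
    show ?thesis unfolding g_def by measurable
  qed
  ultimately have "(\<lambda>\<omega>. SUP z\<in>X \<times> Y. ereal (f z (g \<omega>))) \<in> borel_measurable M"
    by (rule measurable_compose_rev)
  moreover have "gap_Q G K J (xag (k + 1) \<omega>, yag (k + 1) \<omega>) z - perturbation k \<omega> \<bullet> ((xag (k + 1) \<omega>, yag (k + 1) \<omega>) - z) = f z (g \<omega>)"
    for z \<omega>
    by (cases z) (simp add: f_def g_def gap_Q_def inner_diff_right[of "perturbation k \<omega>"] del: diff_Pair)
  ultimately show ?thesis
    unfolding perturbed_gap_def by simp
qed

section \<open>Expected energy and expected gap\<close>

context
  fixes xh :: 'a and yh :: 'b
  assumes saddle: "saddle_point X Y G K J (xh, yh)"
begin

abbreviation D2 :: real where "D2 \<equiv> (norm (xh - x1))\<^sup>2 + r * (norm (yh - y1))\<^sup>2"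

text \<open>
The noise up to iteration \<open>k\<close> is integrable once the iterates up to \<open>k\<close> are square-integrable, and
by the energy bound it then controls the squared distance of the next iterate to the saddle point.
\<close>
lemma iterates_square_integrable:
  "i \<ge> 1 \<Longrightarrow> square_integrable M (x i) \<and> square_integrable M (y i)"
proof (induction i rule: less_induct)
  case (less i)
  show ?case
  proof (cases "i = 1")
    case True
    show ?thesis
      unfolding True
      using perturbed_apd.start(1,2)[OF path]
      by (auto intro: square_integrable_deterministic[where c = x1] square_integrable_deterministic[where c = y1])
  next
    case False
    with less.prems obtain k where k: "i = k + 1" "k \<ge> 1"
      by (intro that[of "i - 1"]) auto
    let ?E = "\<lambda>\<omega>. D2 + 2 * (\<Sum>i=1..k. noise_at xh yh i \<omega>)"
    have int: "integrable M ?E"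
      using less.IH k by (intro Bochner_Integration.integrable_add integrable_mult_right noise_sum_integrable) auto
    have E: "energy (x i \<omega> - xh) (y i \<omega> - yh) \<le> ?E \<omega>" if "\<omega> \<in> space M" for \<omega>
      unfolding k(1) by (rule perturbed_apd.energy_bound[OF path[OF that] saddle k(2)])
    note [measurable] = iterates_measurable(1,2)[OF less.prems]
    have "(\<lambda>\<omega>. x i \<omega> - xh) \<in> borel_measurable M" by measurable
    then have "square_integrable M (\<lambda>\<omega>. x i \<omega> - xh)"
      by (rule square_integrable_bound[OF _ int]) (rule order_trans[OF norm_le_energy(1) E])
    from square_integrable_add[OF this square_integrable_const[of xh]]
    have 1: "square_integrable M (x i)" by simp
    have c: "0 \<le> 1 / ((1 - p) * r)" using pq r_pos by simp
    have "(\<lambda>\<omega>. y i \<omega> - yh) \<in> borel_measurable M" by measurable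
    then have "square_integrable M (\<lambda>\<omega>. y i \<omega> - yh)"
      by (rule square_integrable_bound[OF _ integrable_mult_right[OF int, of "1 / ((1 - p) * r)"]])
        (rule order_trans[OF norm_le_energy(2) mult_left_mono[OF E c]])
    from square_integrable_add[OF this square_integrable_const[of yh]]
    have "square_integrable M (y i)" by simp
    with 1 show ?thesis ..
  qed
qed

lemma energy_expectation:
  assumes i: "1 \<le> i" "i \<le> k + 1"
  shows "expectation (\<lambda>\<omega>. energy (x i \<omega> - xh) (y i \<omega> - yh)) \<le> D2 + noise_level k"
proof (cases "i = 1")
  case True
  have "expectation (\<lambda>\<omega>. energy (x i \<omega> - xh) (y i \<omega> - yh)) = expectation (\<lambda>\<omega>. energy (x1 - xh) (y1 - yh))"
    unfolding True using perturbed_apd.start[OF path] by (intro Bochner_Integration.integral_cong) auto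
  also have "\<dots> = energy (x1 - xh) (y1 - yh)"
    by (simp add: prob_space)
  also have "\<dots> \<le> D2"
  proof -
    have "(1 - p) * r * (norm (y1 - yh))\<^sup>2 \<le> r * (norm (y1 - yh))\<^sup>2"
      using pq r_pos by (intro mult_right_mono) auto
    then show ?thesis by (simp add: energy_def norm_minus_commute)
  qed
  also have "\<dots> \<le> D2 + noise_level k"
    using noise_level_mono[of 0 k] by (simp add: noise_level_def)
  finally show ?thesis .
next
  case False
  then obtain j where j: "i = j + 1" "j \<ge> 1" "j \<le> k"
    using i by (intro that[of "i - 1"]) auto
  note sq = iterates_square_integrable
  have N: "\<And>i. i \<in> {1..j} \<Longrightarrow> square_integrable M (x i) \<and> square_integrable M (y i)"
    using sq by auto
  have "expectation (\<lambda>\<omega>. energy (x i \<omega> - xh) (y i \<omega> - yh))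
      \<le> expectation (\<lambda>\<omega>. D2 + 2 * (\<Sum>i=1..j. noise_at xh yh i \<omega>))"
  proof (rule integral_mono)
    show "integrable M (\<lambda>\<omega>. energy (x i \<omega> - xh) (y i \<omega> - yh))"
      using sq[OF i(1)] by (intro energy_integrable) auto
    show "integrable M (\<lambda>\<omega>. D2 + 2 * (\<Sum>i=1..j. noise_at xh yh i \<omega>))"
      by (intro Bochner_Integration.integrable_add integrable_mult_right noise_sum_integrable[where k = j, OF N]) auto
    show "energy (x i \<omega> - xh) (y i \<omega> - yh) \<le> D2 + 2 * (\<Sum>i=1..j. noise_at xh yh i \<omega>)"
      if "\<omega> \<in> space M" for \<omega>
      unfolding j(1) by (rule perturbed_apd.energy_bound[OF path[OF that] saddle j(2)])
  qed
  also have "\<dots> = D2 + 2 * expectation (\<lambda>\<omega>. \<Sum>i=1..j. noise_at xh yh i \<omega>)"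
    using noise_sum_integrable[where k = j, OF N] by (simp add: prob_space del: Bochner_Integration.integral_sum)
  also have "\<dots> \<le> D2 + noise_level j"
    using noise_sum_expectation[where k = j and u = xh and w = yh, OF N] by simp
  also have "\<dots> \<le> D2 + noise_level k"
    using noise_level_mono[OF j(3)] by simp
  finally show ?thesis .
qed

lemma aggregates_square_integrable:
  "i \<ge> 1 \<Longrightarrow> square_integrable M (xag i) \<and> square_integrable M (yag i)"
proof (induction i rule: nat_induct_at_least)
  case base
  show ?case
    using perturbed_apd.start(3,4)[OF path]
    by (auto intro: square_integrable_deterministic[where c = x1] square_integrable_deterministic[where c = y1])
next
  case (Suc i)
  have "square_integrable M (xag (i + 1))"
    using Suc.IH iterates_square_integrable[of "i + 1"]
    by (intro square_integrable_cong[OF _ perturbed_apd.xag[OF path Suc.hyps]] square_integrable_add square_integrable_scaleR) auto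
  moreover have "square_integrable M (yag (i + 1))"
    using Suc.IH iterates_square_integrable[of "i + 1"]
    by (intro square_integrable_cong[OF _ perturbed_apd.yag[OF path Suc.hyps]] square_integrable_add square_integrable_scaleR) auto
  ultimately show ?case by simp
qed

text \<open>
The energy is convex and the aggregates are averages of iterates.
\<close>
lemma energy_aggregate_expectation:
  assumes "1 \<le> i" "i \<le> k + 1"
  shows "expectation (\<lambda>\<omega>. energy (xag i \<omega> - xh) (yag i \<omega> - yh)) \<le> D2 + noise_level k"
  using assms
proof (induction i rule: nat_induct_at_least)
  case base
  have "expectation (\<lambda>\<omega>. energy (xag 1 \<omega> - xh) (yag 1 \<omega> - yh)) = expectation (\<lambda>\<omega>. energy (x 1 \<omega> - xh) (y 1 \<omega> - yh))"
    using perturbed_apd.start[OF path] by (intro Bochner_Integration.integral_cong) auto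
  then show ?case using energy_expectation[of 1 k] by simp
next
  case (Suc i)
  let ?s = "inverse (\<beta> i)" and ?T = "D2 + noise_level k"
  have s: "0 \<le> ?s" "0 \<le> 1 - ?s" using \<beta>_ge_1[OF Suc.hyps] by (auto simp: inverse_le_1_iff)
  have int: "integrable M (\<lambda>\<omega>. energy (xag j \<omega> - xh) (yag j \<omega> - yh))"
      "integrable M (\<lambda>\<omega>. energy (x j \<omega> - xh) (y j \<omega> - yh))" if "j \<ge> 1" for j
    using iterates_square_integrable[OF that] aggregates_square_integrable[OF that]
    by (auto intro: energy_integrable)
  have "expectation (\<lambda>\<omega>. energy (xag (i + 1) \<omega> - xh) (yag (i + 1) \<omega> - yh))
      \<le> expectation (\<lambda>\<omega>. (1 - ?s) * energy (xag i \<omega> - xh) (yag i \<omega> - yh) + ?s * energy (x (i + 1) \<omega> - xh) (y (i + 1) \<omega> - yh))"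
    using Suc.hyps int perturbed_apd.energy_aggregate_step[OF path Suc.hyps]
    by (intro integral_mono Bochner_Integration.integrable_add integrable_mult_right) auto
  also have "\<dots> = (1 - ?s) * expectation (\<lambda>\<omega>. energy (xag i \<omega> - xh) (yag i \<omega> - yh))
      + ?s * expectation (\<lambda>\<omega>. energy (x (i + 1) \<omega> - xh) (y (i + 1) \<omega> - yh))"
    using int(1)[OF Suc.hyps] int(2)[of "i + 1"] by simp
  also have "\<dots> \<le> (1 - ?s) * ?T + ?s * ?T"
    using s Suc energy_expectation[of "i + 1" k] by (intro add_mono mult_left_mono) auto
  also have "\<dots> = ?T" by (simp add: algebra_simps)
  finally show ?case by simp
qed

definition gap_bound :: "nat \<Rightarrow> 'w \<Rightarrow> real" where
  "gap_bound k \<omega> = 1 / (\<beta> k * \<eta> k) * (D2 + (1 / (1 - p) + 1 / 2) * energy (xag (k + 1) \<omega> - xh) (yag (k + 1) \<omega> - yh)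
    + (norm (\<Sum>i=1..k. \<eta> i *\<^sub>R dx i \<omega>))\<^sup>2 / 2 + 1 / (2 * ((1 - p) * r)) * (norm (\<Sum>i=1..k. \<eta> i *\<^sub>R dy i \<omega>))\<^sup>2
    + (\<Sum>i=1..k. noise_at xh yh i \<omega>))"

lemma perturbed_gap_bounds:
  assumes k: "k \<ge> 1" and \<omega>: "\<omega> \<in> space M"
  shows "perturbed_gap X Y G K J (xag (k + 1) \<omega>, yag (k + 1) \<omega>) (perturbation k \<omega>) \<le> ereal (gap_bound k \<omega>)"
    and "0 \<le> perturbed_gap X Y G K J (xag (k + 1) \<omega>, yag (k + 1) \<omega>) (perturbation k \<omega>)"
proof -
  let ?z = "(xag (k + 1) \<omega>, yag (k + 1) \<omega>)"
  have "gap_Q G K J ?z (u, w) - perturbation k \<omega> \<bullet> (?z - (u, w)) \<le> gap_bound k \<omega>" if "u \<in> X" "w \<in> Y" for u w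
    using perturbed_apd.perturbed_gap_le[OF path[OF \<omega>] that k, of xh yh]
    unfolding path_perturbation[OF \<omega>] gap_bound_def perturbed_apd.Nx_def[OF path[OF \<omega>]] perturbed_apd.Ny_def[OF path[OF \<omega>]] .
  then show "perturbed_gap X Y G K J ?z (perturbation k \<omega>) \<le> ereal (gap_bound k \<omega>)"
    unfolding perturbed_gap_def by (intro SUP_least) auto
  have "?z \<in> X \<times> Y"
    using iterates_in_sets[OF \<omega>, of "k + 1"] by simp
  then have "ereal (gap_Q G K J ?z ?z - perturbation k \<omega> \<bullet> (?z - ?z)) \<le> perturbed_gap X Y G K J ?z (perturbation k \<omega>)"
    unfolding perturbed_gap_def by (rule SUP_upper)
  then show "0 \<le> perturbed_gap X Y G K J ?z (perturbation k \<omega>)"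
    by (simp add: gap_Q_def zero_ereal_def)
qed

text \<open>
The coefficient of \<open>C\<^sup>2\<close> is \<open>1 / (1 - p) + 1 / 2\<close> from the energy of the aggregate, whose mean is at
most \<open>D\<^sup>2 + C\<^sup>2\<close>, plus \<open>1 / 2\<close> each from the error sums and from the noise.
\<close>
lemma
  assumes k: "k \<ge> 1"
  shows gap_bound_integrable: "integrable M (gap_bound k)"
    and gap_bound_expectation: "expectation (gap_bound k) \<le>
      1 / (\<beta> k * \<eta> k) * ((6 - 4 * p) / (1 - p) * D2 + (5 - 3 * p) / (2 - 2 * p) * noise_level k)"
proof -
  have sq: "square_integrable M (xag (k + 1))" "square_integrable M (yag (k + 1))"
    using aggregates_square_integrable[of "k + 1"] by auto
  have N: "\<And>i. i \<in> {1..k} \<Longrightarrow> square_integrable M (x i) \<and> square_integrable M (y i)"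
    using iterates_square_integrable by auto
  note int = energy_integrable[OF sq, of xh yh] square_integrableD(2)[OF Nx_square_integrable[of k]]
    square_integrableD(2)[OF Ny_square_integrable[of k]] noise_sum_integrable[where k = k and u = xh and w = yh, OF N]
  show "integrable M (gap_bound k)"
    unfolding gap_bound_def[abs_def] by (rule affine_combination_integrable[OF int])
  have pos: "0 \<le> 1 / (\<beta> k * \<eta> k)"
    using stepsizes_pos(1)[OF k] \<beta>_ge_1[OF k] by simp
  have T: "0 \<le> D2" "0 \<le> noise_level k"
    using r_pos noise_level_mono[of 0 k] by (simp_all add: noise_level_def)
  let ?E = "expectation (\<lambda>\<omega>. energy (xag (k + 1) \<omega> - xh) (yag (k + 1) \<omega> - yh))"
  let ?Nx = "expectation (\<lambda>\<omega>. (norm (\<Sum>i=1..k. \<eta> i *\<^sub>R dx i \<omega>))\<^sup>2)"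
  let ?Ny = "expectation (\<lambda>\<omega>. (norm (\<Sum>i=1..k. \<eta> i *\<^sub>R dy i \<omega>))\<^sup>2)"
  let ?S = "expectation (\<lambda>\<omega>. \<Sum>i=1..k. noise_at xh yh i \<omega>)"
  have "expectation (gap_bound k) = 1 / (\<beta> k * \<eta> k) * (D2 + (1 / (1 - p) + 1 / 2) * ?E
      + ?Nx / 2 + 1 / (2 * ((1 - p) * r)) * ?Ny + ?S)"
    unfolding gap_bound_def[abs_def] by (rule affine_combination_expectation[OF int])
  also have "\<dots> \<le> 1 / (\<beta> k * \<eta> k) * ((6 - 4 * p) / (1 - p) * D2 + (5 - 3 * p) / (2 - 2 * p) * noise_level k)"
  proof (rule mult_left_mono[OF _ pos])
    have "(1 / (1 - p) + 1 / 2) * ?E \<le> (1 / (1 - p) + 1 / 2) * (D2 + noise_level k)"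
      using pq by (intro mult_left_mono energy_aggregate_expectation) auto
    moreover have "?Nx / 2 + 1 / (2 * ((1 - p) * r)) * ?Ny \<le> noise_level k / 2"
    proof -
      have "?Nx / 2 + 1 / (2 * ((1 - p) * r)) * ?Ny = (?Nx + 1 / ((1 - p) * r) * ?Ny) / 2"
        by (simp add: add_divide_distrib)
      also have "\<dots> \<le> noise_level k / 2"
        by (rule divide_right_mono[OF weighted_error_variances]) simp
      finally show ?thesis .
    qed
    moreover have "?S \<le> noise_level k / 2"
      by (rule noise_sum_expectation[where k = k, OF N])
    moreover have "D2 + (1 / (1 - p) + 1 / 2) * (D2 + noise_level k) + noise_level k
        \<le> (6 - 4 * p) / (1 - p) * D2 + (5 - 3 * p) / (2 - 2 * p) * noise_level k"
    proof -
      have 1: "(5 - 3 * p) / (2 - 2 * p) = 3 / 2 + 1 / (1 - p)"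
        using pq by (simp add: divide_simps)
      have 2: "(6 - 4 * p) / (1 - p) = (3 / 2 + 1 / (1 - p)) + (5 / 2 + 1 / (1 - p))"
        using pq by (simp add: divide_simps) (simp add: algebra_simps)
      have "0 \<le> (5 / 2 + 1 / (1 - p)) * D2"
        using T pq by (intro mult_nonneg_nonneg) auto
      then show ?thesis
        unfolding 1 2 by (simp only: distrib_right distrib_left)
    qed
    ultimately show "D2 + (1 / (1 - p) + 1 / 2) * ?E + ?Nx / 2 + 1 / (2 * ((1 - p) * r)) * ?Ny + ?S
        \<le> (6 - 4 * p) / (1 - p) * D2 + (5 - 3 * p) / (2 - 2 * p) * noise_level k"
      by linarith
  qed
  finally show "expectation (gap_bound k) \<le>
      1 / (\<beta> k * \<eta> k) * ((6 - 4 * p) / (1 - p) * D2 + (5 - 3 * p) / (2 - 2 * p) * noise_level k)" .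
qed

text \<open>
The second moments bound the first ones.  The dual distance carries the factor \<open>(1 - p) * r\<close> in the
energy, which is the source of \<open>sqrt (1 / (1 - p))\<close> and of \<open>sqrt (\<tau> 1 / \<eta> 1)\<close>.
\<close>
lemma norm_perturbation_expectation:
  assumes k: "k \<ge> 1" and T: "(norm (xh - x1))\<^sup>2 + r * (norm (yh - y1))\<^sup>2 + noise_level k \<le> T"
  shows "integrable M (perturbation k)"
    and "expectation (\<lambda>\<omega>. norm (perturbation k \<omega>)) \<le>
      2 * norm (xh - x1) / (\<beta> k * \<eta> k) + 2 * norm (yh - y1) / (\<beta> k * \<tau> k)
        + sqrt T * (2 / (\<beta> k * \<eta> k)
           + 1 / (\<beta> k * \<tau> k) * sqrt (\<tau> 1 / \<eta> 1) * (sqrt (1 / (1 - p)) + 1)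
           + 2 * onorm K / \<beta> k)"
proof -
  let ?c = "1 / (\<beta> k * \<eta> k)" and ?s = "sqrt (1 / r)"
  have pos: "\<eta> k > 0" "\<tau> k > 0" "\<beta> k > 0"
    using stepsizes_pos[OF k] \<beta>_ge_1[OF k] by auto
  have c: "(1 - p) * r > 0" using pq r_pos by simp
  have nl: "0 \<le> noise_level k"
    using noise_level_mono[of 0 k] by (simp add: noise_level_def)
  have D: "0 \<le> (norm (xh - x1))\<^sup>2 + r * (norm (yh - y1))\<^sup>2"
    using r_pos by simp
  note D2 = D nl T
  have T0: "0 \<le> T" using D2 by linarith
  have sq: "square_integrable M (\<lambda>\<omega>. x i \<omega> - xh)" "square_integrable M (\<lambda>\<omega>. y i \<omega> - yh)" if "i \<ge> 1" for i
    using iterates_square_integrable[OF that]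
    by (auto intro: square_integrable_diff square_integrable_const)
  have en: "expectation (\<lambda>\<omega>. energy (x i \<omega> - xh) (y i \<omega> - yh)) \<le> T" if "1 \<le> i" "i \<le> k + 1" for i
    using energy_expectation[OF that] T by linarith
  have int_en: "integrable M (\<lambda>\<omega>. energy (x i \<omega> - xh) (y i \<omega> - yh))" if "1 \<le> i" for i
    using iterates_square_integrable[OF that] by (auto intro: energy_integrable)
  have Ex: "expectation (\<lambda>\<omega>. norm (x i \<omega> - xh)) \<le> sqrt T" if i: "1 \<le> i" "i \<le> k + 1" for i
  proof (rule integral_norm_le_sqrt[OF sq(1)[OF i(1)]])
    have "expectation (\<lambda>\<omega>. (norm (x i \<omega> - xh))\<^sup>2) \<le> expectation (\<lambda>\<omega>. energy (x i \<omega> - xh) (y i \<omega> - yh))"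
      by (intro integral_mono square_integrableD(2)[OF sq(1)[OF i(1)]] int_en i norm_le_energy)
    then show "expectation (\<lambda>\<omega>. (norm (x i \<omega> - xh))\<^sup>2) \<le> T"
      using en[OF i] by linarith
  qed
  have Ey: "expectation (\<lambda>\<omega>. norm (y (k + 1) \<omega> - yh)) \<le> sqrt (1 / ((1 - p) * r) * T)"
  proof (rule integral_norm_le_sqrt)
    have k': "1 \<le> k + 1" by simp
    show "square_integrable M (\<lambda>\<omega>. y (k + 1) \<omega> - yh)" by (rule sq(2)[OF k'])
    have "expectation (\<lambda>\<omega>. (norm (y (k + 1) \<omega> - yh))\<^sup>2)
        \<le> expectation (\<lambda>\<omega>. 1 / ((1 - p) * r) * energy (x (k + 1) \<omega> - xh) (y (k + 1) \<omega> - yh))"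
      by (intro integral_mono square_integrableD(2)[OF sq(2)[OF k']] integrable_mult_right int_en[OF k'] norm_le_energy)
    also have "\<dots> = 1 / ((1 - p) * r) * expectation (\<lambda>\<omega>. energy (x (k + 1) \<omega> - xh) (y (k + 1) \<omega> - yh))"
      by (rule integral_mult_right_zero)
    also have "\<dots> \<le> 1 / ((1 - p) * r) * T"
      using c en[OF k' order_refl] by (intro mult_left_mono) auto
    finally show "expectation (\<lambda>\<omega>. (norm (y (k + 1) \<omega> - yh))\<^sup>2) \<le> 1 / ((1 - p) * r) * T" .
  qed
  let ?Nx = "\<lambda>\<omega>. \<Sum>i=1..k. \<eta> i *\<^sub>R dx i \<omega>" and ?Ny = "\<lambda>\<omega>. \<Sum>i=1..k. \<eta> i *\<^sub>R dy i \<omega>"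
  let ?vx = "expectation (\<lambda>\<omega>. (norm (?Nx \<omega>))\<^sup>2)" and ?vy = "expectation (\<lambda>\<omega>. (norm (?Ny \<omega>))\<^sup>2)"
  have v: "?vx + 1 / ((1 - p) * r) * ?vy \<le> noise_level k"
    by (rule weighted_error_variances)
  have v0: "0 \<le> ?vx" "0 \<le> ?vy" by (auto intro!: Bochner_Integration.integral_nonneg)
  then have v1: "0 \<le> 1 / ((1 - p) * r) * ?vy" using c by (intro mult_nonneg_nonneg) auto
  have ENx: "expectation (\<lambda>\<omega>. norm (?Nx \<omega>)) \<le> sqrt T"
  proof (rule integral_norm_le_sqrt[OF Nx_square_integrable])
    have "?vx \<le> noise_level k" using order_trans[OF add_left_mono[OF v1] v] by simp
    then show "?vx \<le> T" using D2 by linarith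
  qed
  have ENy: "expectation (\<lambda>\<omega>. norm (?Ny \<omega>)) \<le> sqrt (r * T)"
  proof (rule integral_norm_le_sqrt[OF Ny_square_integrable])
    have "1 / ((1 - p) * r) * ?vy \<le> noise_level k"
      using order_trans[OF add_right_mono[OF v0(1)] v] by simp
    also have "\<dots> \<le> T" using D2 by linarith
    finally have "1 / ((1 - p) * r) * ?vy \<le> T" .
    then have "?vy \<le> (1 - p) * r * T" using c by (simp add: field_simps)
    also have "\<dots> \<le> r * T" using pq r_pos T0 by (intro mult_right_mono) auto
    finally show "?vy \<le> r * T" .
  qed
  define B where "B = (\<lambda>\<omega>. ?c * (norm (xh - x1) + norm (x (k + 1) \<omega> - xh) + norm (?Nx \<omega>)
     + r * (norm (yh - y1) + norm (y (k + 1) \<omega> - yh)) + norm (?Ny \<omega>)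
     + \<eta> k * onorm K * (norm (x (k + 1) \<omega> - xh) + norm (x k \<omega> - xh))))"
  note int = integrable_norm_of_square_integrable[OF sq(1)[of "k + 1"]] integrable_norm_of_square_integrable[OF sq(2)[of "k + 1"]]
    integrable_norm_of_square_integrable[OF sq(1)[OF k]]
    integrable_norm_of_square_integrable[OF Nx_square_integrable] integrable_norm_of_square_integrable[OF Ny_square_integrable]
  have affine: "integrable M (\<lambda>\<omega>. ?c * (a + f1 \<omega> + f2 \<omega> + r * (b + f3 \<omega>) + f4 \<omega> + \<eta> k * onorm K * (f1 \<omega> + f5 \<omega>)))
      \<and> expectation (\<lambda>\<omega>. ?c * (a + f1 \<omega> + f2 \<omega> + r * (b + f3 \<omega>) + f4 \<omega> + \<eta> k * onorm K * (f1 \<omega> + f5 \<omega>)))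
       = ?c * (a + expectation f1 + expectation f2 + r * (b + expectation f3) + expectation f4
           + \<eta> k * onorm K * (expectation f1 + expectation f5))"
    if "integrable M f1" "integrable M f2" "integrable M f3" "integrable M f4" "integrable M f5"
    for f1 f2 f3 f4 f5 :: "'w \<Rightarrow> real" and a b
    using that by (simp add: prob_space)
  have "integrable M B \<and> expectation B = ?c * (norm (xh - x1) + expectation (\<lambda>\<omega>. norm (x (k + 1) \<omega> - xh)) + expectation (\<lambda>\<omega>. norm (?Nx \<omega>))
     + r * (norm (yh - y1) + expectation (\<lambda>\<omega>. norm (y (k + 1) \<omega> - yh))) + expectation (\<lambda>\<omega>. norm (?Ny \<omega>))
     + \<eta> k * onorm K * (expectation (\<lambda>\<omega>. norm (x (k + 1) \<omega> - xh)) + expectation (\<lambda>\<omega>. norm (x k \<omega> - xh))))"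
    unfolding B_def by (rule affine[OF int(1,4,2,5,3)]) simp_all
  then have B_int: "integrable M B" and B: "expectation B = ?c * (norm (xh - x1) + expectation (\<lambda>\<omega>. norm (x (k + 1) \<omega> - xh)) + expectation (\<lambda>\<omega>. norm (?Nx \<omega>))
     + r * (norm (yh - y1) + expectation (\<lambda>\<omega>. norm (y (k + 1) \<omega> - yh))) + expectation (\<lambda>\<omega>. norm (?Ny \<omega>))
     + \<eta> k * onorm K * (expectation (\<lambda>\<omega>. norm (x (k + 1) \<omega> - xh)) + expectation (\<lambda>\<omega>. norm (x k \<omega> - xh))))"
    by blast+
  have le_B: "norm (perturbation k \<omega>) \<le> B \<omega>" if "\<omega> \<in> space M" for \<omega>
    using perturbed_apd.norm_perturbation_le[OF path[OF that] k, of xh yh]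
    unfolding path_perturbation[OF that] B_def perturbed_apd.Nx_def[OF path[OF that]] perturbed_apd.Ny_def[OF path[OF that]] .
  show v_int: "integrable M (perturbation k)"
  proof (rule Bochner_Integration.integrable_bound[OF B_int perturbation_measurable[OF k]])
    show "AE \<omega> in M. norm (perturbation k \<omega>) \<le> norm (B \<omega>)"
    proof (rule AE_I2)
      fix \<omega> assume "\<omega> \<in> space M"
      from le_B[OF this] show "norm (perturbation k \<omega>) \<le> norm (B \<omega>)"
        unfolding real_norm_def by linarith
    qed
  qed
  have "expectation (\<lambda>\<omega>. norm (perturbation k \<omega>)) \<le> expectation B"
    by (rule integral_mono[OF integrable_norm[OF v_int] B_int le_B])
  also have "\<dots> \<le> ?c * (norm (xh - x1) + sqrt T + sqrt T + r * (norm (yh - y1) + sqrt (1 / ((1 - p) * r) * T))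
      + sqrt (r * T) + \<eta> k * onorm K * (sqrt T + sqrt T))"
    unfolding B using pos r_pos onorm_K_nonneg k
    by (intro mult_left_mono add_mono order_refl Ex Ey ENx ENy) auto
  also have "\<dots> = norm (xh - x1) * ?c + norm (yh - y1) * (r * ?c)
      + sqrt T * (2 * ?c + r * ?c * ?s * (sqrt (1 / (1 - p)) + 1) + 2 * onorm K * (\<eta> k * ?c))"
  proof -
    have 1: "sqrt (1 / ((1 - p) * r) * T) = sqrt (1 / (1 - p)) * ?s * sqrt T"
      unfolding real_sqrt_mult[symmetric] by simp
    have "r * ?s = sqrt r"
      using r_pos by (simp add: real_sqrt_divide real_div_sqrt)
    then have 2: "sqrt (r * T) = r * ?s * sqrt T"
      by (simp only: real_sqrt_mult)
    show ?thesis unfolding 1 2 by (simp only: distrib_left distrib_right) (simp add: mult_ac)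
  qed
  also have "r * ?c = 1 / (\<beta> k * \<tau> k)"
    using pos r_pos by (simp add: \<eta>_eq[OF k])
  also have "\<eta> k * ?c = 1 / \<beta> k"
    using pos by simp
  also have "1 / r = \<tau> 1 / \<eta> 1"
    by (simp add: r_def)
  also have "norm (xh - x1) * ?c + norm (yh - y1) * (1 / (\<beta> k * \<tau> k)) + sqrt T * (2 * ?c
        + 1 / (\<beta> k * \<tau> k) * sqrt (\<tau> 1 / \<eta> 1) * (sqrt (1 / (1 - p)) + 1) + 2 * onorm K * (1 / \<beta> k))
    \<le> 2 * norm (xh - x1) / (\<beta> k * \<eta> k) + 2 * norm (yh - y1) / (\<beta> k * \<tau> k)
        + sqrt T * (2 / (\<beta> k * \<eta> k)
           + 1 / (\<beta> k * \<tau> k) * sqrt (\<tau> 1 / \<eta> 1) * (sqrt (1 / (1 - p)) + 1) + 2 * onorm K / \<beta> k)"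
    using pos by (intro add_mono) (auto intro!: divide_right_mono)
  finally show "expectation (\<lambda>\<omega>. norm (perturbation k \<omega>)) \<le> \<dots>" .
qed

text \<open>
The gap is squeezed between \<open>0\<close>, the value of the supremand at the aggregate, and an integrable bound.
\<close>
lemma
  assumes k: "k \<ge> 1"
  shows perturbed_gap_finite: "\<omega> \<in> space M \<Longrightarrow>
      \<bar>perturbed_gap X Y G K J (xag (k + 1) \<omega>, yag (k + 1) \<omega>) (perturbation k \<omega>)\<bar> \<noteq> \<infinity>"
    and perturbed_gap_integrable: "integrable M (\<lambda>\<omega>. real_of_ereal
      (perturbed_gap X Y G K J (xag (k + 1) \<omega>, yag (k + 1) \<omega>) (perturbation k \<omega>)))" (is "integrable M ?g")
    and perturbed_gap_expectation: "expectation (\<lambda>\<omega>. real_of_ereal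
      (perturbed_gap X Y G K J (xag (k + 1) \<omega>, yag (k + 1) \<omega>) (perturbation k \<omega>))) \<le>
      1 / (\<beta> k * \<eta> k) * ((6 - 4 * p) / (1 - p) * ((norm (xh - x1))\<^sup>2 + r * (norm (yh - y1))\<^sup>2)
        + (5 - 3 * p) / (2 - 2 * p) * noise_level k)"
proof -
  note bounds = perturbed_gap_bounds[OF k]
  show fin: "\<bar>perturbed_gap X Y G K J (xag (k + 1) \<omega>, yag (k + 1) \<omega>) (perturbation k \<omega>)\<bar> \<noteq> \<infinity>"
    if "\<omega> \<in> space M" for \<omega>
    using bounds[OF that] by auto
  have g: "0 \<le> ?g \<omega> \<and> ?g \<omega> \<le> gap_bound k \<omega>" if "\<omega> \<in> space M" for \<omega>
    using bounds[OF that] fin[OF that] by (cases "perturbed_gap X Y G K J (xag (k + 1) \<omega>, yag (k + 1) \<omega>) (perturbation k \<omega>)") auto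
  note bound = gap_bound_integrable[OF k] gap_bound_expectation[OF k]
  show int: "integrable M ?g"
  proof (rule Bochner_Integration.integrable_bound[OF bound(1)])
    show "?g \<in> borel_measurable M"
      by (intro borel_measurable_real_of_ereal perturbed_gap_measurable[OF k])
    show "AE \<omega> in M. norm (?g \<omega>) \<le> norm (gap_bound k \<omega>)"
    proof (rule AE_I2)
      fix \<omega> assume "\<omega> \<in> space M"
      from g[OF this] show "norm (?g \<omega>) \<le> norm (gap_bound k \<omega>)"
        unfolding real_norm_def by linarith
    qed
  qed
  have "expectation ?g \<le> expectation (gap_bound k)"
    by (rule integral_mono[OF int bound(1)]) (use g in blast)
  also note bound(2)
  finally show "expectation ?g \<le> 1 / (\<beta> k * \<eta> k) * ((6 - 4 * p) / (1 - p) * ((norm (xh - x1))\<^sup>2 + r * (norm (yh - y1))\<^sup>2)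
        + (5 - 3 * p) / (2 - 2 * p) * noise_level k)" .
qed

end
end

section \<open>Convergence of the stochastic method\<close>

theorem theorem3p3:
  fixes X :: "'a::euclidean_space set" and Y :: "'b::euclidean_space set"
    and G :: "'a \<Rightarrow> real" and gradG :: "'a \<Rightarrow> 'a" and L_G L_K :: real
    and K :: "'a \<Rightarrow> 'b" and J :: "'b \<Rightarrow> real"
    and M :: "'w measure" and P :: "'s measure"
    and GO :: "'a \<Rightarrow> 's \<Rightarrow> 'a" and KxO :: "'a \<Rightarrow> 's \<Rightarrow> 'b" and KyO :: "'b \<Rightarrow> 's \<Rightarrow> 'a"
    and \<xi> :: "evaluation \<Rightarrow> nat \<Rightarrow> 'w \<Rightarrow> 's"
    and \<sigma>xG \<sigma>y \<sigma>xK \<sigma>x p q C D :: real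
    and \<beta> \<theta> \<eta> \<tau> :: "nat \<Rightarrow> real"
    and x1 :: 'a and y1 :: 'b
    and x xag xmd xbar :: "nat \<Rightarrow> 'w \<Rightarrow> 'a" and y yag :: "nat \<Rightarrow> 'w \<Rightarrow> 'b"
    and xhat :: 'a and yhat :: 'b and t :: nat
  assumes X: "closed X" "convex X" and Y: "closed Y" "convex Y"
    and G_convex: "convex_on X G"
    and G_grad: "\<And>u. u \<in> X \<Longrightarrow> (G has_derivative (\<lambda>h. gradG u \<bullet> h)) (at u within X)"
    and L_G: "L_G \<ge> 0"
    and G_smooth: "\<And>u w. u \<in> X \<Longrightarrow> w \<in> X \<Longrightarrow>
           G w - G u - gradG u \<bullet> (w - u) \<le> L_G / 2 * (norm (w - u))\<^sup>2"
    and K: "linear K" and L_K: "L_K = onorm K"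
    and J: "convex_on Y J" "lsc_on Y J"
    and M: "prob_space M" and P: "prob_space P"
    and samples_indep:
      "prob_space.indep_vars M (\<lambda>_. P) (\<lambda>(c, i). \<xi> c i) (UNIV \<times> {1..})"
    and samples_ident: "\<And>c i. i \<ge> 1 \<Longrightarrow> distr M P (\<xi> c i) = P"
    and unbiased: "unbiased_estimator P X GO gradG"
      "unbiased_estimator P UNIV KxO K"
      "unbiased_estimator P Y KyO (adjoint K)"
    and \<sigma>_nonneg: "\<sigma>xG \<ge> 0" "\<sigma>y \<ge> 0" "\<sigma>xK \<ge> 0"
    and A1: "variance_bounded P X GO gradG \<sigma>xG"
      "variance_bounded P UNIV KxO K \<sigma>y"
      "variance_bounded P Y KyO (adjoint K) \<sigma>xK"
    and \<sigma>x: "\<sigma>x = sqrt (\<sigma>xG\<^sup>2 + \<sigma>xK\<^sup>2)"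
    and init: "x1 \<in> X" "y1 \<in> Y"
    and stepsizes_pos: "\<And>i. i \<ge> 1 \<Longrightarrow> \<eta> i > 0" "\<And>i. i \<ge> 1 \<Longrightarrow> \<tau> i > 0"
    and iterates: "\<And>\<omega>. \<omega> \<in> space M \<Longrightarrow>
      stochastic_apd X Y J \<beta> \<theta> \<eta> \<tau>
        (\<lambda>i u. GO u (\<xi> Eval_G i \<omega>)) (\<lambda>i u. KxO u (\<xi> Eval_Kx i \<omega>)) (\<lambda>i u. KyO u (\<xi> Eval_Ky i \<omega>))
        x1 y1
        (\<lambda>i. x i \<omega>) (\<lambda>i. y i \<omega>) (\<lambda>i. xag i \<omega>) (\<lambda>i. yag i \<omega>) (\<lambda>i. xmd i \<omega>) (\<lambda>i. xbar i \<omega>)"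
    and pq: "0 < p" "p < 1" "0 < q" "q < 1"
    and \<beta>1: "\<beta> 1 = 1"
    and \<beta>_step: "\<And>i. i \<ge> 1 \<Longrightarrow> \<beta> (i + 1) - 1 = \<beta> i * \<theta> (i + 1)"
    and \<theta>: "\<And>i. i \<ge> 2 \<Longrightarrow> \<theta> i = \<eta> (i - 1) / \<eta> i"
           "\<And>i. i \<ge> 2 \<Longrightarrow> \<theta> i = \<tau> (i - 1) / \<tau> i"
    and step_cond: "\<And>i. i \<ge> 1 \<Longrightarrow> q / \<eta> i - L_G / \<beta> i - L_K\<^sup>2 * \<tau> i / p \<ge> 0"
    and saddle: "saddle_point X Y G K J (xhat, yhat)"
    and D: "D = sqrt ((norm (xhat - x1))\<^sup>2 + \<eta> 1 / \<tau> 1 * (norm (yhat - y1))\<^sup>2)"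
    and t: "t \<ge> 1"
    and C: "C = sqrt ((\<Sum>i=1..t. (\<eta> i)\<^sup>2 * \<sigma>x\<^sup>2 / (1 - q)) + (\<Sum>i=1..t. \<eta> i * \<tau> i * \<sigma>y\<^sup>2 / (1 - p)))"
  shows "\<exists>v :: 'w \<Rightarrow> 'a \<times> 'b.
    v \<in> borel_measurable M \<and>
    (AE \<omega> in M. \<bar>perturbed_gap X Y G K J (xag (t + 1) \<omega>, yag (t + 1) \<omega>) (v \<omega>)\<bar> \<noteq> \<infinity>) \<and>
    integrable M (\<lambda>\<omega>. real_of_ereal
      (perturbed_gap X Y G K J (xag (t + 1) \<omega>, yag (t + 1) \<omega>) (v \<omega>))) \<and>
    (\<integral>\<omega>. real_of_ereal
      (perturbed_gap X Y G K J (xag (t + 1) \<omega>, yag (t + 1) \<omega>) (v \<omega>)) \<partial>M)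
      \<le> 1 / (\<beta> t * \<eta> t) * ((6 - 4 * p) / (1 - p) * D\<^sup>2 + (5 - 3 * p) / (2 - 2 * p) * C\<^sup>2) \<and>
    integrable M v \<and>
    (\<integral>\<omega>. norm (v \<omega>) \<partial>M)
      \<le> 2 * norm (xhat - x1) / (\<beta> t * \<eta> t) + 2 * norm (yhat - y1) / (\<beta> t * \<tau> t)
        + sqrt (2 * D\<^sup>2 + C\<^sup>2) *
          (2 / (\<beta> t * \<eta> t)
           + 1 / (\<beta> t * \<tau> t) * sqrt (\<tau> 1 / \<eta> 1) * (sqrt (1 / (1 - p)) + 1)
           + 2 * L_K / \<beta> t)"
proof -
  interpret M: prob_space M by fact
  interpret stochastic_apd_run X Y G gradG L_G K J p q \<beta> \<theta> \<eta> \<tau> x1 y1 M P GO KxO KyO \<xi> \<sigma>xG \<sigma>y \<sigma>xK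
      x xag xmd xbar y yag
    by (intro stochastic_apd_run.intro apd_problem.intro stochastic_apd_run_axioms.intro)
      (fact G_convex G_grad G_smooth K J init stepsizes_pos pq \<beta>1 \<beta>_step \<theta>
        step_cond[unfolded L_K] M P samples_indep samples_ident unbiased A1 iterates)+
  have r0: "\<eta> 1 / \<tau> 1 = r" by (simp add: r_def)
  have D2: "D\<^sup>2 = (norm (xhat - x1))\<^sup>2 + r * (norm (yhat - y1))\<^sup>2"
    unfolding D r0 using r_pos by simp
  have "(\<Sum>i=1..t. (\<eta> i)\<^sup>2 * \<sigma>x\<^sup>2 / (1 - q)) + (\<Sum>i=1..t. \<eta> i * \<tau> i * \<sigma>y\<^sup>2 / (1 - p)) = noise_level t"
    by (simp add: noise_level_def \<sigma>x sum.distrib)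
  then have C2: "C\<^sup>2 = noise_level t"
    using noise_level_mono[of 0 t] by (simp add: C noise_level_def)
  have T: "(norm (xhat - x1))\<^sup>2 + r * (norm (yhat - y1))\<^sup>2 + noise_level t \<le> 2 * D\<^sup>2 + C\<^sup>2"
    using D2 C2 zero_le_power2[of D] by linarith
  show ?thesis
  proof (intro exI[of _ "perturbation t"] conjI)
    show "perturbation t \<in> borel_measurable M"
      by (rule perturbation_measurable[OF t])
    show "AE \<omega> in M. \<bar>perturbed_gap X Y G K J (xag (t + 1) \<omega>, yag (t + 1) \<omega>) (perturbation t \<omega>)\<bar> \<noteq> \<infinity>"
      by (intro AE_I2 perturbed_gap_finite[OF saddle t])
    show "integrable M (\<lambda>\<omega>. real_of_ereal (perturbed_gap X Y G K J (xag (t + 1) \<omega>, yag (t + 1) \<omega>) (perturbation t \<omega>)))"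
      by (rule perturbed_gap_integrable[OF saddle t])
    show "(\<integral>\<omega>. real_of_ereal (perturbed_gap X Y G K J (xag (t + 1) \<omega>, yag (t + 1) \<omega>) (perturbation t \<omega>)) \<partial>M)
      \<le> 1 / (\<beta> t * \<eta> t) * ((6 - 4 * p) / (1 - p) * D\<^sup>2 + (5 - 3 * p) / (2 - 2 * p) * C\<^sup>2)"
      unfolding D2 C2 by (rule perturbed_gap_expectation[OF saddle t])
    show "integrable M (perturbation t)"
      by (rule norm_perturbation_expectation(1)[OF saddle t T])
    show "(\<integral>\<omega>. norm (perturbation t \<omega>) \<partial>M)
      \<le> 2 * norm (xhat - x1) / (\<beta> t * \<eta> t) + 2 * norm (yhat - y1) / (\<beta> t * \<tau> t)
        + sqrt (2 * D\<^sup>2 + C\<^sup>2) *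
          (2 / (\<beta> t * \<eta> t)
           + 1 / (\<beta> t * \<tau> t) * sqrt (\<tau> 1 / \<eta> 1) * (sqrt (1 / (1 - p)) + 1)
           + 2 * L_K / \<beta> t)"
      unfolding L_K by (rule norm_perturbation_expectation(2)[OF saddle t T])
  qed
qed

end
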